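(* Let $\mathcal{Y}\subset\mathbb{R}^m$ be closed and let $\nu$ be a Borel measure on $\mathbb{R}^m$ with $\mathrm{supp}(\nu)=\mathcal{Y}$, $\int_{\mathcal{Y}}|h|\,\mathrm{d}\nu<\infty$ for all $h\in\mathbb{R}[\boldsymbol{y}]$, and $\sum_{d=1}^{\infty}\left(\int_{\mathcal{Y}}y_j^{2d}\,\mathrm{d}\nu(\boldsymbol{y})\right)^{-\frac{1}{2d}}=\infty$ for every $j\in\{1,\ldots,m\}$. Let $F\in\mathbb{S}[\boldsymbol{x}]^p$ and $G\in\mathbb{S}[\boldsymbol{x},\boldsymbol{y}]^q$ be homogeneous in $\boldsymbol{x}$ of even degree, let $$\mathcal{X}=\{\boldsymbol{x}\in\mathbb{R}^n\mid G(\boldsymbol{x},\boldsymbol{y})\succeq 0,\ \forall\boldsymbol{y}\in\mathcal{Y}\},$$ and suppose $F(\boldsymbol{x})\succ 0$ for all $\boldsymbol{x}\in\mathcal{X}\setminus\{\mathbf{0}\}$. Then there exist $N\in\mathbb{N}$ and SOS matrices $S_0\in\mathbb{S}[\boldsymbol{x}]^p$, $S\in\mathbb{S}[\boldsymbol{x},\boldsymbol{y}]^{pq}$ which are homogeneous in $\boldsymbol{x}$, with $\deg S_0=2N+\deg F$ and $\deg_{\boldsymbol{x}}S=2N+\deg F-\deg_{\boldsymbol{x}}G$, such that $$\Vert\boldsymbol{x}\Vert^{2N}F(\boldsymbol{x})=S_0(\boldsymbol{x})+\int_{\mathcal{Y}}\langle S(\boldsymbol{x},\boldsymbol{y}),G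(\boldsymbol{x},\boldsymbol{y})\rangle_p\,\mathrm{d}\nu(\boldsymbol{y}).$$
   Context: $\boldsymbol{x}=(x_1,\ldots,x_n)$, $\boldsymbol{y}=(y_1,\ldots,y_m)$; $\mathbb{N}$ includes $0$; $\Vert\cdot\Vert$ is the Euclidean norm. $\mathbb{S}[\cdot]^q$ denotes $q\times q$ symmetric matrices with real polynomial entries in the indicated variables. For a polynomial matrix $T$, $\deg T$ (resp. $\deg_{\boldsymbol{x}}T$) is the maximum over entries of the total degree (resp. total degree in $\boldsymbol{x}$); $T$ is homogeneous in $\boldsymbol{x}$ if all its entries are homogeneous in $\boldsymbol{x}$ of one common degree. An $r\times r$ SOS matrix is one of the form $T^{\intercal}T$ with $T$ an $l\times r$ real polynomial matrix in the same variables, $l\in\mathbb{N}$. For $A\in\mathbb{R}^{pq\times pq}$, $B\in\mathbb{R}^{q\times q}$, $\langle A,B\rangle_p:=\mathrm{tr}_p(A^{\intercal}(I_p\otimes B))\in\mathbb{R}^{p\times p}$, where for $C=[C_{ij}]_{i,j=1}^p$ with blocks $C_{ij}\in\mathbb{R}^{q\times q}$, $\mathrm{tr}_p(C):=[\mathrm{tr}(C_{ij})]_{i,j=1}^p$; the same definition is used for polynomial matrices. For $H(\boldsymbol{x},\boldsymbol{y})=\sum_\beta H_\beta(\boldsymbol{x})\boldsymbol{y}^\beta$, $\int_{\mathcal{Y}}H\,\mathrm{d}\nu(\boldsymbol{y}):=\sum_\beta H_\beta(\boldsymbol{x})\int_{\mathcal{Y}}\boldsymbol{y}^\beta\,\mathrm{d}\nu(\boldsymbol{y})$.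 *)

theory Defs
  imports "HOL-Analysis.Analysis" "HOL-Library.Poly_Mapping"
begin

text \<open>
  \<open>'n poly_x\<close> is the polynomial ring \<open>\<real>[x]\<close> in variables indexed by the finite type \<open>'n\<close>: finitely
  supported functions on exponent vectors, with the convolution product of \<^theory>\<open>HOL-Library.Poly_Mapping\<close>.
  \<open>\<real>[x,y]\<close> is represented as \<open>\<real>[x][y]\<close>, so that the coefficient \<open>H\<^sub>\<beta>(x)\<close> of \<open>y\<^sup>\<beta>\<close> in \<open>H\<close>
  is \<open>lookup H \<beta>\<close>. A polynomial in \<open>y\<close> alone is an \<open>'m poly_x\<close>.
\<close>

type_synonym 'n poly_x = "('n \<Rightarrow>\<^sub>0 nat) \<Rightarrow>\<^sub>0 real"
type_synonym ('n, 'm) poly_xy = "('m \<Rightarrow>\<^sub>0 nat) \<Rightarrow>\<^sub>0 'n poly_x"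

definition monomial_value :: "('n::finite \<Rightarrow>\<^sub>0 nat) \<Rightarrow> real^'n \<Rightarrow> real" where
  "monomial_value \<alpha> x = (\<Prod>i\<in>UNIV. (x $ i) ^ Poly_Mapping.lookup \<alpha> i)"

definition poly_x_value :: "'n::finite poly_x \<Rightarrow> real^'n \<Rightarrow> real" where
  "poly_x_value P x = (\<Sum>\<alpha>\<in>Poly_Mapping.keys P. Poly_Mapping.lookup P \<alpha> * monomial_value \<alpha> x)"

definition poly_xy_value :: "('n::finite, 'm::finite) poly_xy \<Rightarrow> real^'n \<Rightarrow> real^'m \<Rightarrow> real" where
  "poly_xy_value H x y =
     (\<Sum>\<beta>\<in>Poly_Mapping.keys H. poly_x_value (Poly_Mapping.lookup H \<beta>) x * monomial_value \<beta> y)"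

definition matrix_x_value :: "('n::finite poly_x)^'r^'s \<Rightarrow> real^'n \<Rightarrow> real^'r^'s" where
  "matrix_x_value A x = (\<chi> i j. poly_x_value (A $ i $ j) x)"

definition matrix_xy_value ::
    "(('n::finite, 'm::finite) poly_xy)^'r^'s \<Rightarrow> real^'n \<Rightarrow> real^'m \<Rightarrow> real^'r^'s" where
  "matrix_xy_value A x y = (\<chi> i j. poly_xy_value (A $ i $ j) x y)"

text \<open>The degree of the zero polynomial (and of the zero matrix) is \<open>0\<close>.\<close>

definition monomial_degree :: "('n::finite \<Rightarrow>\<^sub>0 nat) \<Rightarrow> nat" where
  "monomial_degree \<alpha> = (\<Sum>i\<in>UNIV. Poly_Mapping.lookup \<alpha> i)"

definition poly_x_degree :: "'n::finite poly_x \<Rightarrow> nat" where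
  "poly_x_degree P = Max (insert 0 (monomial_degree ` Poly_Mapping.keys P))"

definition poly_xy_degree_x :: "('n::finite, 'm::finite) poly_xy \<Rightarrow> nat" where
  "poly_xy_degree_x H =
     Max (insert 0 ((\<lambda>\<beta>. poly_x_degree (Poly_Mapping.lookup H \<beta>)) ` Poly_Mapping.keys H))"

definition matrix_x_degree :: "('n::finite poly_x)^'r::finite^'s::finite \<Rightarrow> nat" where
  "matrix_x_degree A = Max (range (\<lambda>(i, j). poly_x_degree (A $ i $ j)))"

definition matrix_xy_degree_x ::
    "(('n::finite, 'm::finite) poly_xy)^'r::finite^'s::finite \<Rightarrow> nat" where
  "matrix_xy_degree_x A = Max (range (\<lambda>(i, j). poly_xy_degree_x (A $ i $ j)))"

definition homogeneous :: "nat \<Rightarrow> 'n::finite poly_x \<Rightarrow> bool" where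
  "homogeneous d P \<longleftrightarrow> (\<forall>\<alpha>\<in>Poly_Mapping.keys P. monomial_degree \<alpha> = d)"

definition homogeneous_in_x :: "nat \<Rightarrow> ('n::finite, 'm::finite) poly_xy \<Rightarrow> bool" where
  "homogeneous_in_x d H \<longleftrightarrow> (\<forall>\<beta>\<in>Poly_Mapping.keys H. homogeneous d (Poly_Mapping.lookup H \<beta>))"

definition matrix_homogeneous :: "nat \<Rightarrow> ('n::finite poly_x)^'r^'s \<Rightarrow> bool" where
  "matrix_homogeneous d A \<longleftrightarrow> (\<forall>i j. homogeneous d (A $ i $ j))"

definition matrix_homogeneous_in_x ::
    "nat \<Rightarrow> (('n::finite, 'm::finite) poly_xy)^'r^'s \<Rightarrow> bool" where
  "matrix_homogeneous_in_x d A \<longleftrightarrow> (\<forall>i j. homogeneous_in_x d (A $ i $ j))"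

definition symmetric_matrix :: "'a^'r^'r \<Rightarrow> bool" where
  "symmetric_matrix A \<longleftrightarrow> transpose A = A"

definition psd :: "real^'r^'r \<Rightarrow> bool" where
  "psd A \<longleftrightarrow> symmetric_matrix A \<and> (\<forall>v. v \<bullet> (A *v v) \<ge> 0)"

definition pd :: "real^'r^'r \<Rightarrow> bool" where
  "pd A \<longleftrightarrow> symmetric_matrix A \<and> (\<forall>v. v \<noteq> 0 \<longrightarrow> v \<bullet> (A *v v) > 0)"

text \<open>
  \<open>S = T\<^sup>T T\<close> for a matrix \<open>T\<close> with \<open>l\<close> rows \<open>T 0, \<dots>, T (l - 1)\<close>. Since \<open>l\<close> is existentially quantified
  (and may be \<open>0\<close>), the rows are indexed by natural numbers instead of by a type. With
  \<open>'a = 'n poly_x\<close> or \<open>'a = ('n, 'm) poly_xy\<close> this is the notion of an SOS matrix over the respective ring.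
\<close>

definition sos_matrix :: "'a::comm_ring_1^'r^'r \<Rightarrow> bool" where
  "sos_matrix S \<longleftrightarrow> (\<exists>(l::nat) (T :: nat \<Rightarrow> 'a^'r). S = (\<chi> i j. \<Sum>k<l. T k $ i * T k $ j))"

text \<open>
  Matrices of size \<open>pq\<close> are indexed by pairs \<open>(i, k)\<close>: block index \<open>i\<close>, position \<open>k\<close> inside the block.
\<close>

definition kronecker ::
    "'a::times^'p::finite^'p \<Rightarrow> 'a^'q::finite^'q \<Rightarrow> 'a^('p \<times> 'q)^('p \<times> 'q)" where
  "kronecker A B = (\<chi> r c. A $ fst r $ fst c * B $ snd r $ snd c)"

definition block_trace :: "'a::semiring_1^('p::finite \<times> 'q::finite)^('p \<times> 'q) \<Rightarrow> 'a^'p^'p" where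
  "block_trace C = (\<chi> i j. trace (\<chi> k l. C $ (i, k) $ (j, l)))"

definition block_inner ::
    "'a::comm_ring_1^('p::finite \<times> 'q::finite)^('p \<times> 'q) \<Rightarrow> 'a^'q^'q \<Rightarrow> 'a^'p^'p" where
  "block_inner A B = block_trace (transpose A ** kronecker (mat 1) B)"

text \<open>\<open>Poly_Mapping.single 0 c\<close> is the constant polynomial \<open>c\<close>.\<close>

definition integral_y ::
    "(real^'m) measure \<Rightarrow> (real^'m) set \<Rightarrow> ('n::finite, 'm::finite) poly_xy \<Rightarrow> 'n poly_x" where
  "integral_y \<nu> Y H =
     (\<Sum>\<beta>\<in>Poly_Mapping.keys H.
        Poly_Mapping.lookup H \<beta> * Poly_Mapping.single 0 (LINT y:Y|\<nu>. monomial_value \<beta> y))"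

definition matrix_integral_y ::
    "(real^'m) measure \<Rightarrow> (real^'m) set \<Rightarrow> (('n::finite, 'm::finite) poly_xy)^'r^'s
      \<Rightarrow> ('n poly_x)^'r^'s" where
  "matrix_integral_y \<nu> Y A = (\<chi> i j. integral_y \<nu> Y (A $ i $ j))"

definition measure_support :: "'a::topological_space measure \<Rightarrow> 'a set" where
  "measure_support \<nu> = {y. \<forall>U. open U \<and> y \<in> U \<longrightarrow> emeasure \<nu> U > 0}"

text \<open>
  The sum over \<open>d \<ge> 1\<close> of \<open>(\<integral> y\<^sub>j ^ (2d) d\<nu>) ^ (-1/(2d))\<close> is taken in \<^typ>\<open>ennreal\<close>, where
  \<open>inverse 0 = \<infinity>\<close>, so that it diverges when an even moment vanishes; over the reals, \<open>0 powr a = 0\<close>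
  would give the wrong value there. The index \<open>d\<close> below is shifted by one.
\<close>

definition carleman :: "(real^'m) measure \<Rightarrow> (real^'m) set \<Rightarrow> 'm::finite \<Rightarrow> bool" where
  "carleman \<nu> Y j \<longleftrightarrow>
     suminf (\<lambda>d. inverse (ennreal ((LINT y:Y|\<nu>. (y $ j) ^ (2 * Suc d)) powr (1 / real (2 * Suc d))))) = \<infinity>"

end

theory Submission
  imports Defs
begin

text \<open>
  The theorem is reduced to a positivity statement for finitely many scalar constraints and from
  there to the positivity of a single matrix form on the sphere.

  For a polynomial \<open>q\<close> in \<open>y\<close> and a vector \<open>v\<close>, the form \<open>g\<^sub>q\<^sub>v(x) = \<integral> q(y)\<^sup>2 (v \<bullet> G(x, y) v) d\<nu>(y)\<close> is
  nonnegative on \<open>X\<close>, and \<open>\<rho>\<^sup>2 g\<^sub>q\<^sub>v\<close> times the identity is the integral of an inner product of \<open>G\<close> with an SOS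
  matrix, for every form \<open>\<rho>\<close>. Conversely every \<open>x\<close> outside \<open>X\<close> violates one of these constraints
  (\<open>negative_square_integral\<close>): a polynomial that is negative somewhere on the support of \<open>\<nu>\<close> has a negative
  integral against some square. This is where Carleman's condition enters. It makes the polynomials
  dense in weighted \<open>L\<^sup>2\<close> spaces, by the argument of Bang's proof of the Denjoy--Carleman theorem. That proof only uses
  Taylor expansions and norm estimates, so it applies to the curve \<open>t \<mapsto> cos (t y\<^sub>j)\<close> modulo polynomials
  (\<open>Bang_step\<close>, \<open>approx_poly_cos\<close>). Once the cosines are in the
  closure of the polynomials, so are periodic bumps, which isolate a point where the polynomial is negative.

  By compactness of the sphere, finitely many constraints \<open>\<gamma>\<^sub>i\<close> suffice: where all of them are nonnegative, \<open>F\<close>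
  is positive definite. After scaling to \<open>\<bar>\<gamma>\<^sub>i\<bar> \<le> 1/2\<close> on the sphere, the matrix
  \<open>F - (\<Sum>\<^sub>i \<gamma>\<^sub>i (1 - \<gamma>\<^sub>i)\<^sup>2\<^sup>k) I\<close> is positive definite on the whole sphere for large \<open>k\<close>, because the subtracted terms tend
  to \<open>0\<close> or to \<open>- \<infinity>\<close> (\<open>eventually_positive_difference\<close>). Its homogenization \<open>H\<close> is an SOS matrix after multiplication by
  a power of the norm (\<open>positive_definite_form_sos\<close>), a matrix version of a theorem of Reznick. It is proved by expanding
  \<open>H + C (1 - \<parallel>x\<parallel>\<^sup>2)\<^sup>2\<close> in Bernstein polynomials on a cube. The squares \<open>(1 - \<gamma>\<^sub>i)\<^sup>2\<^sup>k\<close> become the matrix \<open>S\<close>.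
\<close>

section \<open>Evaluation of polynomials\<close>

lemma monomial_value_zero [simp]: "monomial_value 0 x = 1"
  by (simp add: monomial_value_def)

lemma monomial_value_add: "monomial_value (\<alpha> + \<beta>) x = monomial_value \<alpha> x * monomial_value \<beta> x"
  by (simp add: monomial_value_def lookup_add power_add prod.distrib)

lemma monomial_value_single: "monomial_value (Poly_Mapping.single i k) x = (x $ i) ^ k"
proof -
  have "monomial_value (Poly_Mapping.single i k) x = (\<Prod>j\<in>UNIV. if j = i then (x $ i) ^ k else 1)"
    unfolding monomial_value_def
    by (rule prod.cong) (auto simp: lookup_single)
  then show ?thesis by simp
qed

lemma poly_mapping_as_sum:
  fixes P :: "'a \<Rightarrow>\<^sub>0 'b::comm_monoid_add"
  shows "P = (\<Sum>k\<in>Poly_Mapping.keys P. Poly_Mapping.single k (Poly_Mapping.lookup P k))"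
proof (rule poly_mapping_eqI)
  fix j
  have "(\<Sum>k\<in>Poly_Mapping.keys P. (Poly_Mapping.lookup P k when k = j)) =
        (\<Sum>k\<in>Poly_Mapping.keys P. if k = j then Poly_Mapping.lookup P j else 0)"
    by (rule sum.cong) (auto simp: when_def)
  then show "Poly_Mapping.lookup P j =
     Poly_Mapping.lookup (\<Sum>k\<in>Poly_Mapping.keys P. Poly_Mapping.single k (Poly_Mapping.lookup P k)) j"
    by (auto simp: lookup_sum lookup_single in_keys_iff)
qed

text \<open>
  Evaluation along a coefficient homomorphism \<open>\<phi>\<close> and a multiplicative \<open>m\<close>. It makes
  \<open>poly_x_value\<close> and \<open>poly_xy_value\<close> two instances of one ring homomorphism.
\<close>

definition eval_along ::
    "('b::comm_semiring_1 \<Rightarrow> real) \<Rightarrow> ('a \<Rightarrow> real) \<Rightarrow> ('a::comm_monoid_add \<Rightarrow>\<^sub>0 'b) \<Rightarrow> real" where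
  "eval_along \<phi> m P = (\<Sum>k\<in>Poly_Mapping.keys P. \<phi> (Poly_Mapping.lookup P k) * m k)"

context
  fixes \<phi> :: "'b::comm_semiring_1 \<Rightarrow> real" and m :: "'a::comm_monoid_add \<Rightarrow> real"
  assumes hom0: "\<phi> 0 = 0" and homa: "\<And>a b. \<phi> (a + b) = \<phi> a + \<phi> b"
    and homm: "\<And>a b. \<phi> (a * b) = \<phi> a * \<phi> b" and multm: "\<And>a b. m (a + b) = m a * m b"
begin

lemma eval_along_superset:
  assumes "finite A" "Poly_Mapping.keys P \<subseteq> A"
  shows "eval_along \<phi> m P = (\<Sum>k\<in>A. \<phi> (Poly_Mapping.lookup P k) * m k)"
  unfolding eval_along_def
  by (rule sum.mono_neutral_left) (use assms in \<open>auto simp: in_keys_iff hom0\<close>)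

lemma eval_along_add: "eval_along \<phi> m (P + Q) = eval_along \<phi> m P + eval_along \<phi> m Q"
proof -
  let ?A = "Poly_Mapping.keys P \<union> Poly_Mapping.keys Q"
  have "eval_along \<phi> m R = (\<Sum>k\<in>?A. \<phi> (Poly_Mapping.lookup R k) * m k)" if "R \<in> {P, Q, P + Q}" for R
    using that keys_add[of P Q] by (intro eval_along_superset) auto
  then show ?thesis
    by (simp add: lookup_add homa sum.distrib ring_distribs)
qed

lemma eval_along_single: "eval_along \<phi> m (Poly_Mapping.single k c) = \<phi> c * m k"
  by (subst eval_along_superset[of "{k}"]) auto

lemma eval_along_zero: "eval_along \<phi> m 0 = 0"
  by (simp add: eval_along_def)

lemma eval_along_sum: "eval_along \<phi> m (\<Sum>i\<in>I. f i) = (\<Sum>i\<in>I. eval_along \<phi> m (f i))"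
  by (induction I rule: infinite_finite_induct) (auto simp: eval_along_zero eval_along_add)

lemma eval_along_mult: "eval_along \<phi> m (P * Q) = eval_along \<phi> m P * eval_along \<phi> m Q"
proof -
  let ?s = "\<lambda>P k. Poly_Mapping.single k (Poly_Mapping.lookup P k)"
  have "eval_along \<phi> m (P * Q) =
      eval_along \<phi> m ((\<Sum>k\<in>Poly_Mapping.keys P. ?s P k) * (\<Sum>k\<in>Poly_Mapping.keys Q. ?s Q k))"
    using poly_mapping_as_sum[of P] poly_mapping_as_sum[of Q] by simp
  also have "\<dots> = (\<Sum>k\<in>Poly_Mapping.keys P. \<phi> (Poly_Mapping.lookup P k) * m k) *
      (\<Sum>k\<in>Poly_Mapping.keys Q. \<phi> (Poly_Mapping.lookup Q k) * m k)"
    by (simp add: sum_product eval_along_sum mult_single eval_along_single homm multm mult_ac)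
  finally show ?thesis by (simp add: eval_along_def)
qed

end

lemma poly_x_value_eval: "poly_x_value P x = eval_along id (\<lambda>\<alpha>. monomial_value \<alpha> x) P"
  by (simp add: poly_x_value_def eval_along_def)

lemma poly_x_value_zero [simp]: "poly_x_value 0 x = 0"
  by (simp add: poly_x_value_def)

lemma poly_x_value_add [simp]: "poly_x_value (P + Q) x = poly_x_value P x + poly_x_value Q x"
  unfolding poly_x_value_eval by (rule eval_along_add) (auto simp: monomial_value_add)

lemma poly_x_value_mult [simp]: "poly_x_value (P * Q) x = poly_x_value P x * poly_x_value Q x"
  unfolding poly_x_value_eval by (rule eval_along_mult) (auto simp: monomial_value_add)

lemma poly_x_value_single [simp]: "poly_x_value (Poly_Mapping.single \<alpha> c) x = c * monomial_value \<alpha> x"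
  unfolding poly_x_value_eval
  by (subst eval_along_single) (auto simp: monomial_value_add)

lemma poly_x_value_one [simp]: "poly_x_value 1 x = 1"
  using poly_x_value_single[of 0 1 x] by (simp flip: single_one)

lemma poly_x_value_sum [simp]: "poly_x_value (\<Sum>i\<in>I. f i) x = (\<Sum>i\<in>I. poly_x_value (f i) x)"
  by (induction I rule: infinite_finite_induct) auto

lemma poly_x_value_power [simp]: "poly_x_value (P ^ k) x = poly_x_value P x ^ k"
  by (induction k) auto

lemma poly_x_value_uminus [simp]: "poly_x_value (- P) x = - poly_x_value P x"
  using poly_x_value_add[of P "- P" x] by simp

lemma poly_x_value_diff [simp]: "poly_x_value (P - Q) x = poly_x_value P x - poly_x_value Q x"
  using poly_x_value_add[of P "- Q" x] by simp

lemma poly_x_value_of_nat [simp]: "poly_x_value (of_nat k) x = of_nat k"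
  by (induction k) auto

lemma poly_xy_value_eval:
  "poly_xy_value H x y = eval_along (\<lambda>P. poly_x_value P x) (\<lambda>\<beta>. monomial_value \<beta> y) H"
  by (simp add: poly_xy_value_def eval_along_def)

lemma poly_xy_value_zero [simp]: "poly_xy_value 0 x y = 0"
  by (simp add: poly_xy_value_def)

lemma poly_xy_value_add [simp]: "poly_xy_value (P + Q) x y = poly_xy_value P x y + poly_xy_value Q x y"
  unfolding poly_xy_value_eval by (rule eval_along_add) (auto simp: monomial_value_add)

lemma poly_xy_value_mult [simp]: "poly_xy_value (P * Q) x y = poly_xy_value P x y * poly_xy_value Q x y"
  unfolding poly_xy_value_eval by (rule eval_along_mult) (auto simp: monomial_value_add)

lemma poly_xy_value_single [simp]:
  "poly_xy_value (Poly_Mapping.single \<beta> P) x y = poly_x_value P x * monomial_value \<beta> y"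
  unfolding poly_xy_value_eval
  by (subst eval_along_single) (auto simp: monomial_value_add)

lemma poly_xy_value_sum [simp]:
  "poly_xy_value (\<Sum>i\<in>I. f i) x y = (\<Sum>i\<in>I. poly_xy_value (f i) x y)"
  by (induction I rule: infinite_finite_induct) auto

definition specialize :: "real^'n \<Rightarrow> ('n::finite, 'm::finite) poly_xy \<Rightarrow> 'm poly_x" where
  "specialize x H = (\<Sum>\<beta>\<in>Poly_Mapping.keys H.
     Poly_Mapping.single \<beta> (poly_x_value (Poly_Mapping.lookup H \<beta>) x))"

lemma poly_x_value_specialize [simp]: "poly_x_value (specialize x H) y = poly_xy_value H x y"
  by (simp add: specialize_def poly_xy_value_def)

definition in_y :: "'m::finite poly_x \<Rightarrow> ('n::finite, 'm) poly_xy" where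
  "in_y q = (\<Sum>\<beta>\<in>Poly_Mapping.keys q.
     Poly_Mapping.single \<beta> (Poly_Mapping.single 0 (Poly_Mapping.lookup q \<beta>)))"

lemma poly_xy_value_in_y [simp]: "poly_xy_value (in_y q) x y = poly_x_value q y"
  by (simp add: in_y_def poly_x_value_def[of q])

lemma continuous_on_monomial_value [continuous_intros]: "continuous_on A (monomial_value \<alpha>)"
  unfolding monomial_value_def by (intro continuous_intros)

lemma continuous_on_poly_x_value [continuous_intros]: "continuous_on A (poly_x_value P)"
  unfolding poly_x_value_def by (intro continuous_intros)

lemma poly_x_value_measurable [measurable]: "poly_x_value P \<in> borel_measurable borel"
  by (intro borel_measurable_continuous_onI continuous_on_poly_x_value)

section \<open>Homogeneous polynomials\<close>

lemma monomial_degree_zero [simp]: "monomial_degree 0 = 0"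
  by (simp add: monomial_degree_def)

lemma monomial_degree_add: "monomial_degree (\<alpha> + \<beta>) = monomial_degree \<alpha> + monomial_degree \<beta>"
  by (simp add: monomial_degree_def lookup_add sum.distrib)

lemma monomial_degree_single: "monomial_degree (Poly_Mapping.single i k) = k"
proof -
  have "monomial_degree (Poly_Mapping.single i k) = (\<Sum>j\<in>UNIV. if j = i then k else 0)"
    unfolding monomial_degree_def by (rule sum.cong) (auto simp: lookup_single)
  then show ?thesis by simp
qed

lemma homogeneous_zero [simp]: "homogeneous d 0"
  by (simp add: homogeneous_def)

lemma homogeneous_add: "homogeneous d P \<Longrightarrow> homogeneous d Q \<Longrightarrow> homogeneous d (P + Q)"
  using keys_add[of P Q] by (auto simp: homogeneous_def)

lemma homogeneous_mult: "homogeneous d P \<Longrightarrow> homogeneous e Q \<Longrightarrow> homogeneous (d + e) (P * Q)"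
  using keys_mult[of P Q] by (fastforce simp: homogeneous_def monomial_degree_add)

lemma homogeneous_single: "monomial_degree \<alpha> = d \<Longrightarrow> homogeneous d (Poly_Mapping.single \<alpha> c)"
  by (auto simp: homogeneous_def)

lemma homogeneous_sum: "(\<And>i. i \<in> I \<Longrightarrow> homogeneous d (f i)) \<Longrightarrow> homogeneous d (\<Sum>i\<in>I. f i)"
  by (induction I rule: infinite_finite_induct) (auto intro: homogeneous_add)

lemma homogeneous_power: "homogeneous d P \<Longrightarrow> homogeneous (k * d) (P ^ k)"
proof (induction k)
  case 0
  then show ?case using homogeneous_single[of 0 0 1] by simp
next
  case (Suc k)
  then show ?case using homogeneous_mult[of d P "k * d" "P ^ k"] by simp
qed

lemma homogeneous_diff:
  assumes "homogeneous d P" "homogeneous d Q"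
  shows "homogeneous d (P - Q)"
  using assms unfolding homogeneous_def by (metis diff_self in_keys_iff lookup_minus)

lemma homogeneous_in_x_zero [simp]: "homogeneous_in_x d 0"
  by (simp add: homogeneous_in_x_def)

lemma homogeneous_in_x_iff: "homogeneous_in_x d H \<longleftrightarrow> (\<forall>\<beta>. homogeneous d (Poly_Mapping.lookup H \<beta>))"
  by (metis homogeneous_in_x_def homogeneous_zero in_keys_iff)

lemma homogeneous_in_x_add:
  "homogeneous_in_x d P \<Longrightarrow> homogeneous_in_x d Q \<Longrightarrow> homogeneous_in_x d (P + Q)"
  by (simp add: homogeneous_in_x_iff lookup_add homogeneous_add)

lemma homogeneous_in_x_sum:
  "(\<And>i. i \<in> I \<Longrightarrow> homogeneous_in_x d (f i)) \<Longrightarrow> homogeneous_in_x d (\<Sum>i\<in>I. f i)"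
  by (induction I rule: infinite_finite_induct) (auto intro: homogeneous_in_x_add)

lemma homogeneous_in_x_single: "homogeneous d P \<Longrightarrow> homogeneous_in_x d (Poly_Mapping.single \<beta> P)"
  by (simp add: homogeneous_in_x_iff lookup_single when_def)

lemma homogeneous_in_x_mult:
  assumes "homogeneous_in_x d P" "homogeneous_in_x e Q"
  shows "homogeneous_in_x (d + e) (P * Q)"
proof -
  have "P * Q = (\<Sum>k\<in>Poly_Mapping.keys P. Poly_Mapping.single k (Poly_Mapping.lookup P k)) *
      (\<Sum>k\<in>Poly_Mapping.keys Q. Poly_Mapping.single k (Poly_Mapping.lookup Q k))"
    using poly_mapping_as_sum[of P] poly_mapping_as_sum[of Q] by simp
  then show ?thesis
    using assms
    by (auto simp: sum_product mult_single homogeneous_in_x_iff[of d] homogeneous_in_x_iff[of e]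
        intro!: homogeneous_in_x_sum homogeneous_in_x_single homogeneous_mult)
qed

lemma homogeneous_in_x_in_y: "homogeneous_in_x 0 (in_y q)"
  unfolding in_y_def
  by (intro homogeneous_in_x_sum homogeneous_in_x_single homogeneous_single) simp

lemma monomial_value_scale: "monomial_value \<alpha> (c *\<^sub>R x) = c ^ monomial_degree \<alpha> * monomial_value \<alpha> x"
  by (simp add: monomial_value_def monomial_degree_def power_mult_distrib prod.distrib power_sum)

lemma poly_x_value_scale:
  "homogeneous d P \<Longrightarrow> poly_x_value P (c *\<^sub>R x) = c ^ d * poly_x_value P x"
  by (auto simp: poly_x_value_def homogeneous_def monomial_value_scale sum_distrib_left mult_ac
      intro!: sum.cong)

lemma poly_x_degree_homogeneous:
  assumes "homogeneous d P"
  shows "poly_x_degree P = (if P = 0 then 0 else d)"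
proof (cases "P = 0")
  case False
  then have "Poly_Mapping.keys P \<noteq> {}"
    by simp
  then have "monomial_degree ` Poly_Mapping.keys P = {d}"
    using assms by (simp add: homogeneous_def image_constant_conv cong: image_cong_simp)
  then show ?thesis using False by (simp add: poly_x_degree_def)
qed (simp add: poly_x_degree_def)

lemma Max_range_eqI:
  fixes f :: "'a::finite \<Rightarrow> nat"
  assumes "\<And>i. f i \<le> d" and "f i = d"
  shows "Max (range f) = d"
  using assms by (intro Max_eqI) auto

lemma matrix_x_degree_homogeneous:
  assumes hom: "matrix_homogeneous d A"
  shows "matrix_x_degree A = (if A = 0 then 0 else d)"
proof (cases "A = 0")
  case False
  then obtain i j where ij: "A $ i $ j \<noteq> 0"
    by (auto simp: vec_eq_iff)
  have "matrix_x_degree A = d"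
    unfolding matrix_x_degree_def
    by (rule Max_range_eqI[where i = "(i, j)"])
      (use hom ij in \<open>auto simp: matrix_homogeneous_def poly_x_degree_homogeneous[of d]\<close>)
  with False show ?thesis by simp
qed (simp add: matrix_x_degree_def poly_x_degree_def)

lemma poly_xy_degree_x_homogeneous:
  assumes "homogeneous_in_x d H"
  shows "poly_xy_degree_x H = (if H = 0 then 0 else d)"
proof (cases "H = 0")
  case False
  have "poly_x_degree (Poly_Mapping.lookup H \<beta>) = d" if "\<beta> \<in> Poly_Mapping.keys H" for \<beta>
    using assms that by (auto simp: homogeneous_in_x_def poly_x_degree_homogeneous[of d] in_keys_iff)
  moreover have "Poly_Mapping.keys H \<noteq> {}"
    using False by simp
  ultimately have "(\<lambda>\<beta>. poly_x_degree (Poly_Mapping.lookup H \<beta>)) ` Poly_Mapping.keys H = {d}"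
    by (simp add: image_constant_conv cong: image_cong_simp)
  then show ?thesis using False by (simp add: poly_xy_degree_x_def)
qed (simp add: poly_xy_degree_x_def)

lemma matrix_xy_degree_x_homogeneous:
  assumes hom: "matrix_homogeneous_in_x d A"
  shows "matrix_xy_degree_x A = (if A = 0 then 0 else d)"
proof (cases "A = 0")
  case False
  then obtain i j where ij: "A $ i $ j \<noteq> 0"
    by (auto simp: vec_eq_iff)
  have "matrix_xy_degree_x A = d"
    unfolding matrix_xy_degree_x_def
    by (rule Max_range_eqI[where i = "(i, j)"])
      (use hom ij in \<open>auto simp: matrix_homogeneous_in_x_def poly_xy_degree_x_homogeneous[of d]\<close>)
  with False show ?thesis by simp
qed (simp add: matrix_xy_degree_x_def poly_xy_degree_x_def)

text \<open>
  The functions given by homogeneous polynomials. Most of the argument manipulates values, and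
  only the final matrices are assembled from actual polynomials.
\<close>

definition form :: "nat \<Rightarrow> (real^'n::finite \<Rightarrow> real) \<Rightarrow> bool" where
  "form d f \<longleftrightarrow> (\<exists>P. homogeneous d P \<and> f = poly_x_value P)"

lemma form_zero: "form d (\<lambda>x. 0)"
  unfolding form_def by (intro exI[of _ 0]) auto

lemma form_const: "form 0 (\<lambda>x. c)"
  unfolding form_def by (intro exI[of _ "Poly_Mapping.single 0 c"]) (auto intro: homogeneous_single)

lemma form_component: "form 1 (\<lambda>x. x $ i)"
  unfolding form_def
  by (intro exI[of _ "Poly_Mapping.single (Poly_Mapping.single i 1) 1"])
    (auto intro: homogeneous_single simp: monomial_degree_single monomial_value_single)

lemma form_add: "form d f \<Longrightarrow> form d g \<Longrightarrow> form d (\<lambda>x. f x + g x)"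
  unfolding form_def
proof (elim exE conjE)
  fix P Q :: "'a poly_x"
  assume "homogeneous d P" "homogeneous d Q" "f = poly_x_value P" "g = poly_x_value Q"
  then show "\<exists>R. homogeneous d R \<and> (\<lambda>x. f x + g x) = poly_x_value R"
    by (intro exI[of _ "P + Q"]) (auto intro: homogeneous_add)
qed

lemma form_mult: "form d f \<Longrightarrow> form e g \<Longrightarrow> form (d + e) (\<lambda>x. f x * g x)"
  unfolding form_def
proof (elim exE conjE)
  fix P Q :: "'a poly_x"
  assume "homogeneous d P" "homogeneous e Q" "f = poly_x_value P" "g = poly_x_value Q"
  then show "\<exists>R. homogeneous (d + e) R \<and> (\<lambda>x. f x * g x) = poly_x_value R"
    by (intro exI[of _ "P * Q"]) (auto intro: homogeneous_mult)
qed

lemma form_cmult: "form d f \<Longrightarrow> form d (\<lambda>x. c * f x)"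
  using form_mult[OF form_const[of c], of d f] by simp

lemma form_sum: "(\<And>i. i \<in> I \<Longrightarrow> form d (f i)) \<Longrightarrow> form d (\<lambda>x. \<Sum>i\<in>I. f i x)"
  by (induction I rule: infinite_finite_induct) (auto intro: form_add form_zero)

lemma norm_square_vec: "(norm (x::real^'n::finite))\<^sup>2 = (\<Sum>i\<in>UNIV. (x $ i)\<^sup>2)"
  by (simp add: norm_vec_def L2_set_def sum_nonneg)

lemma form_scale: "form d f \<Longrightarrow> f (c *\<^sub>R x) = c ^ d * f x"
  by (auto simp: form_def poly_x_value_scale)

lemma form_uminus: "form d f \<Longrightarrow> f (- x) = (- 1) ^ d * f x"
  using form_scale[of d f "-1" x] by simp

section \<open>Square integrable functions\<close>

definition L2 :: "'a measure \<Rightarrow> ('a \<Rightarrow> real) \<Rightarrow> bool" where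
  "L2 \<mu> f \<longleftrightarrow> f \<in> borel_measurable \<mu> \<and> integrable \<mu> (\<lambda>x. (f x)\<^sup>2)"

definition norm2 :: "'a measure \<Rightarrow> ('a \<Rightarrow> real) \<Rightarrow> real" where
  "norm2 \<mu> f = sqrt (\<integral>x. (f x)\<^sup>2 \<partial>\<mu>)"

lemma norm2_nonneg [simp]: "0 \<le> norm2 \<mu> f"
  by (simp add: norm2_def)

lemma norm2_square: "(norm2 \<mu> f)\<^sup>2 = (\<integral>x. (f x)\<^sup>2 \<partial>\<mu>)"
  by (simp add: norm2_def)

lemma L2_integrable_mult:
  assumes "L2 \<mu> f" "L2 \<mu> g"
  shows "integrable \<mu> (\<lambda>x. f x * g x)"
proof (rule Bochner_Integration.integrable_bound)
  show "integrable \<mu> (\<lambda>x. (f x)\<^sup>2 + (g x)\<^sup>2)"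
    using assms by (auto simp: L2_def)
  show "(\<lambda>x. f x * g x) \<in> borel_measurable \<mu>"
    using assms by (auto simp: L2_def)
  have "\<bar>a * b\<bar> \<le> a\<^sup>2 + b\<^sup>2" for a b :: real
  proof -
    have "2 * \<bar>a * b\<bar> \<le> a\<^sup>2 + b\<^sup>2"
      using sum_squares_bound[of "\<bar>a\<bar>" "\<bar>b\<bar>"] by (simp add: abs_mult)
    then show ?thesis by (smt (verit) abs_ge_zero)
  qed
  then show "AE x in \<mu>. norm (f x * g x) \<le> norm ((f x)\<^sup>2 + (g x)\<^sup>2)"
    by (simp add: abs_of_nonneg)
qed

lemma L2_add: "L2 \<mu> f \<Longrightarrow> L2 \<mu> g \<Longrightarrow> L2 \<mu> (\<lambda>x. f x + g x)"
  using L2_integrable_mult[of \<mu> f g]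
  by (simp add: L2_def power2_sum mult.assoc borel_measurable_add)

lemma L2_cmult: "L2 \<mu> f \<Longrightarrow> L2 \<mu> (\<lambda>x. c * f x)"
  by (auto simp: L2_def power_mult_distrib)

lemma L2_diff: "L2 \<mu> f \<Longrightarrow> L2 \<mu> g \<Longrightarrow> L2 \<mu> (\<lambda>x. f x - g x)"
  using L2_add[of \<mu> f "\<lambda>x. (-1) * g x"] L2_cmult[of \<mu> g "-1"] by simp

lemma L2_dominated:
  assumes "L2 \<mu> g" "f \<in> borel_measurable \<mu>" "\<And>x. \<bar>f x\<bar> \<le> \<bar>g x\<bar>"
  shows "L2 \<mu> f"
  unfolding L2_def
proof
  show "integrable \<mu> (\<lambda>x. (f x)\<^sup>2)"
  proof (rule Bochner_Integration.integrable_bound)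
    show "integrable \<mu> (\<lambda>x. (g x)\<^sup>2)" using assms(1) by (simp add: L2_def)
    show "(\<lambda>x. (f x)\<^sup>2) \<in> borel_measurable \<mu>" using assms(2) by measurable
    show "AE x in \<mu>. norm ((f x)\<^sup>2) \<le> norm ((g x)\<^sup>2)"
      using abs_le_square_iff[THEN iffD1, OF assms(3)] by simp
  qed
qed fact

lemma norm2_mono:
  assumes "L2 \<mu> g" "f \<in> borel_measurable \<mu>" "\<And>x. \<bar>f x\<bar> \<le> \<bar>g x\<bar>"
  shows "norm2 \<mu> f \<le> norm2 \<mu> g"
  unfolding norm2_def
proof (intro real_sqrt_le_mono integral_mono)
  show "(f x)\<^sup>2 \<le> (g x)\<^sup>2" for x
    using abs_le_square_iff[THEN iffD1, OF assms(3)] .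
qed (use L2_dominated[OF assms] assms(1) in \<open>auto simp: L2_def\<close>)

lemma norm2_cmult: "norm2 \<mu> (\<lambda>x. c * f x) = \<bar>c\<bar> * norm2 \<mu> f"
  by (simp add: norm2_def power_mult_distrib real_sqrt_mult)

lemma norm2_Cauchy_Schwarz:
  assumes "L2 \<mu> f" "L2 \<mu> g"
  shows "\<bar>\<integral>x. f x * g x \<partial>\<mu>\<bar> \<le> norm2 \<mu> f * norm2 \<mu> g"
proof -
  define A B C where "A = (\<integral>x. (f x)\<^sup>2 \<partial>\<mu>)" and "B = (\<integral>x. f x * g x \<partial>\<mu>)"
    and "C = (\<integral>x. (g x)\<^sup>2 \<partial>\<mu>)"
  note int = L2_integrable_mult[OF assms]
  have nonneg: "0 \<le> A + 2 * t * B + t\<^sup>2 * C" for t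
  proof -
    have "A + 2 * t * B + t\<^sup>2 * C = (\<integral>x. (f x)\<^sup>2 + 2 * t * (f x * g x) + t\<^sup>2 * (g x)\<^sup>2 \<partial>\<mu>)"
      using assms int by (simp add: A_def B_def C_def L2_def)
    also have "\<dots> = (\<integral>x. (f x + t * g x)\<^sup>2 \<partial>\<mu>)"
      by (intro Bochner_Integration.integral_cong) (auto simp: power2_sum power_mult_distrib)
    finally show ?thesis by simp
  qed
  have AC: "0 \<le> A" "0 \<le> C" by (auto simp: A_def C_def)
  have "B\<^sup>2 \<le> A * C"
  proof (cases "C = 0")
    case True
    have "B = 0"
    proof (rule ccontr)
      assume "B \<noteq> 0"
      then show False
        using nonneg[of "- (A + 1) / (2 * B)"] True AC by (simp add: field_simps)
    qed
    with True show ?thesis by simp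
  next
    case False
    with nonneg[of "- B / C"] AC show ?thesis
      by (simp add: field_simps power2_eq_square)
  qed
  then have "sqrt (B\<^sup>2) \<le> sqrt (A * C)" by (rule real_sqrt_le_mono)
  then show ?thesis by (simp add: A_def B_def C_def norm2_def real_sqrt_mult)
qed

lemma norm2_triangle:
  assumes "L2 \<mu> f" "L2 \<mu> g"
  shows "norm2 \<mu> (\<lambda>x. f x + g x) \<le> norm2 \<mu> f + norm2 \<mu> g"
proof (rule power2_le_imp_le)
  have "(norm2 \<mu> (\<lambda>x. f x + g x))\<^sup>2 = (\<integral>x. (f x)\<^sup>2 + 2 * (f x * g x) + (g x)\<^sup>2 \<partial>\<mu>)"
    unfolding norm2_square
    by (intro Bochner_Integration.integral_cong) (auto simp: power2_sum)
  also have "\<dots> = (norm2 \<mu> f)\<^sup>2 + 2 * (\<integral>x. f x * g x \<partial>\<mu>) + (norm2 \<mu> g)\<^sup>2"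
    using assms L2_integrable_mult[OF assms] by (simp add: norm2_square L2_def)
  also have "\<dots> \<le> (norm2 \<mu> f + norm2 \<mu> g)\<^sup>2"
    using norm2_Cauchy_Schwarz[OF assms] by (simp add: power2_sum)
  finally show "(norm2 \<mu> (\<lambda>x. f x + g x))\<^sup>2 \<le> (norm2 \<mu> f + norm2 \<mu> g)\<^sup>2" .
qed (simp add: add_nonneg_nonneg)

section \<open>Density of the polynomials\<close>

text \<open>The phases \<open>i \<pi> / 2\<close> express all derivatives by the cosine itself.\<close>

lemma cos_Taylor_bound:
  fixes u v :: real
  shows "\<bar>cos (u + v) - (\<Sum>i<m. v ^ i / fact i * cos (u + real i * pi / 2))\<bar> \<le> \<bar>v\<bar> ^ m / fact m"
proof -
  have "((\<lambda>v. cos (u + v + real i * pi / 2)) has_real_derivative cos (u + w + real (Suc i) * pi / 2)) (at w)"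
    for i w
  proof -
    have "cos (u + w + real (Suc i) * pi / 2) = cos ((u + w + real i * pi / 2) + pi / 2)"
      by (simp add: field_simps)
    also have "\<dots> = - sin (u + w + real i * pi / 2)"
      by (simp add: cos_add)
    finally show ?thesis
      by (auto intro!: derivative_eq_intros)
  qed
  then obtain t where t: "cos (u + v) =
      (\<Sum>i<m. cos (u + 0 + real i * pi / 2) / fact i * v ^ i) + cos (u + t + real m * pi / 2) / fact m * v ^ m"
    using Maclaurin_all_le[of "\<lambda>i v. cos (u + v + real i * pi / 2)" "\<lambda>v. cos (u + v)" v m] by auto
  have "\<bar>cos (u + t + real m * pi / 2) / fact m * v ^ m\<bar> \<le> 1 / fact m * \<bar>v\<bar> ^ m"
    unfolding abs_mult power_abs
    by (intro mult_right_mono) (auto simp: abs_mult divide_simps)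
  then show ?thesis using t by (simp add: mult.commute)
qed

lemma exp_partial_sum_le:
  assumes "0 \<le> (x::real)"
  shows "(\<Sum>i\<le>n. x ^ i / fact i) \<le> exp x"
proof -
  have "(\<lambda>i. x ^ i / fact i) sums exp x"
    using exp_converges[of x] by (simp add: divide_inverse mult.commute)
  then have "summable (\<lambda>i. x ^ i / fact i)" and "suminf (\<lambda>i. x ^ i / fact i) = exp x"
    by (simp_all add: sums_iff)
  then show ?thesis
    using sum_le_suminf[of "\<lambda>i. x ^ i / fact i" "{..n}"] assms by simp
qed

locale polynomial_moments =
  fixes \<mu> :: "(real^'m::finite) measure"
  assumes sets_eq [measurable_cong]: "sets \<mu> = sets borel"
    and integrable_poly: "\<And>q. integrable \<mu> (poly_x_value q)"
begin

lemma L2_poly: "L2 \<mu> (poly_x_value q)"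
proof -
  have "poly_x_value (q ^ 2) = (\<lambda>y. (poly_x_value q y)\<^sup>2)" by auto
  then show ?thesis
    using integrable_poly[of "q ^ 2"] integrable_poly[of q] by (simp add: L2_def)
qed

definition approx :: "real \<Rightarrow> (real^'m \<Rightarrow> real) \<Rightarrow> bool" where
  "approx \<epsilon> f \<longleftrightarrow> L2 \<mu> f \<and> (\<exists>q. norm2 \<mu> (\<lambda>y. f y - poly_x_value q y) \<le> \<epsilon>)"

lemma approxI: "L2 \<mu> f \<Longrightarrow> norm2 \<mu> (\<lambda>y. f y - poly_x_value q y) \<le> \<epsilon> \<Longrightarrow> approx \<epsilon> f"
  by (auto simp: approx_def)

lemma approx_mono: "approx \<epsilon> f \<Longrightarrow> \<epsilon> \<le> \<epsilon>' \<Longrightarrow> approx \<epsilon>' f"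
  unfolding approx_def by (meson order_trans)

lemma approx_add:
  assumes "approx \<epsilon> f" "approx \<delta> g"
  shows "approx (\<epsilon> + \<delta>) (\<lambda>y. f y + g y)"
proof -
  from assms obtain q r where L: "L2 \<mu> f" "L2 \<mu> g"
    and q: "norm2 \<mu> (\<lambda>y. f y - poly_x_value q y) \<le> \<epsilon>"
    and r: "norm2 \<mu> (\<lambda>y. g y - poly_x_value r y) \<le> \<delta>"
    by (auto simp: approx_def)
  have "norm2 \<mu> (\<lambda>y. f y + g y - poly_x_value (q + r) y)
      = norm2 \<mu> (\<lambda>y. (f y - poly_x_value q y) + (g y - poly_x_value r y))"
    by (simp add: algebra_simps)
  also have "\<dots> \<le> \<epsilon> + \<delta>"
    using norm2_triangle[OF L2_diff[OF L(1) L2_poly[of q]] L2_diff[OF L(2) L2_poly[of r]]] q r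
    by linarith
  finally show ?thesis by (rule approxI[OF L2_add[OF L]])
qed

lemma approx_cmult:
  assumes "approx \<epsilon> f"
  shows "approx (\<bar>c\<bar> * \<epsilon>) (\<lambda>y. c * f y)"
proof -
  from assms obtain q where L: "L2 \<mu> f"
    and q: "norm2 \<mu> (\<lambda>y. f y - poly_x_value q y) \<le> \<epsilon>"
    by (auto simp: approx_def)
  have "norm2 \<mu> (\<lambda>y. c * f y - poly_x_value (Poly_Mapping.single 0 c * q) y)
      = norm2 \<mu> (\<lambda>y. c * (f y - poly_x_value q y))"
    by (simp add: algebra_simps)
  also have "\<dots> \<le> \<bar>c\<bar> * \<epsilon>"
    unfolding norm2_cmult using q by (intro mult_left_mono) auto
  finally show ?thesis by (rule approxI[OF L2_cmult[OF L]])
qed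

lemma approx_poly: "0 \<le> \<epsilon> \<Longrightarrow> approx \<epsilon> (poly_x_value q)"
  unfolding approx_def using L2_poly by (auto intro!: exI[of _ q] simp: norm2_def)

lemma approx_sum:
  assumes "finite I" "\<And>i. i \<in> I \<Longrightarrow> approx (\<epsilon> i) (f i)"
  shows "approx (\<Sum>i\<in>I. \<epsilon> i) (\<lambda>y. \<Sum>i\<in>I. f i y)"
  using assms
proof (induction I rule: finite_induct)
  case empty
  have "poly_x_value (0 :: 'm poly_x) = (\<lambda>y. 0)" by auto
  then show ?case using approx_poly[of 0 0] by simp
next
  case (insert i I)
  then show ?case using approx_add[of "\<epsilon> i" "f i"] by simp
qed

lemma approx_small:
  assumes "L2 \<mu> g" "f \<in> borel_measurable borel" "\<And>y. \<bar>f y\<bar> \<le> \<bar>g y\<bar>" "norm2 \<mu> g \<le> \<epsilon>"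
  shows "approx \<epsilon> f"
proof -
  have m: "f \<in> borel_measurable \<mu>" using assms(2) by measurable
  have "norm2 \<mu> f \<le> \<epsilon>" using norm2_mono[OF assms(1) m assms(3)] assms(4) by linarith
  then show ?thesis
    unfolding approx_def using L2_dominated[OF assms(1) m assms(3)] by (auto intro!: exI[of _ 0])
qed

text \<open>
  The induction step of Bang's proof of the Denjoy--Carleman theorem, for the curve
  \<open>t \<mapsto> q cos (t y\<^sub>j + c)\<close> in the quotient of \<open>L\<^sup>2\<close> by the polynomials. Its \<open>k\<close>-th derivatives have
  norm at most \<open>M k\<close>; if all of them are even smaller, by the factors \<open>exp (k - n - 1)\<close>, then moving
  by \<open>h\<close> costs at most a factor \<open>exp 1\<close>, by the Taylor expansion of order \<open>n + 1 - k\<close>.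
\<close>

lemma Bang_step:
  fixes M :: "nat \<Rightarrow> real" and q :: "'m poly_x" and j :: 'm
  defines "tw \<equiv> (\<lambda>k c t y. poly_x_value q y * (y $ j) ^ k * cos (t * (y $ j) + c))"
  assumes pos: "\<And>k. 0 < M k"
    and ratio: "\<And>a b. a \<le> b \<Longrightarrow> M (Suc a) / M a \<le> M (Suc b) / M b"
    and bound: "\<And>k. norm2 \<mu> (\<lambda>y. poly_x_value q y * (y $ j) ^ k) \<le> M k"
    and small: "\<And>k c. approx (exp (real k - real (Suc n)) * M k) (tw k c t)"
    and h: "\<bar>h\<bar> * (exp 1 * M (Suc n)) \<le> M n"
  shows "approx (exp (real k - real n) * M k) (tw k c (t + h))"
proof -
  have poly: "(\<lambda>y. poly_x_value q y * (y $ j) ^ k) =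
      poly_x_value (q * Poly_Mapping.single (Poly_Mapping.single j k) 1)" for k
    by (auto simp: monomial_value_single)
  then have L2: "L2 \<mu> (\<lambda>y. poly_x_value q y * (y $ j) ^ k)" for k
    using L2_poly by simp
  have tw_meas: "tw k c t \<in> borel_measurable borel" for k c t
    unfolding tw_def by measurable
  show ?thesis
  proof (cases "n \<le> k")
    case True
    have "M k \<le> exp (real k - real n) * M k"
      using True pos[of k] by (simp add: one_le_exp_iff)
    then have "norm2 \<mu> (\<lambda>y. poly_x_value q y * (y $ j) ^ k) \<le> exp (real k - real n) * M k"
      using bound[of k] by linarith
    then show ?thesis
      by (intro approx_small[OF L2[of k] tw_meas]) (auto simp: tw_def abs_mult mult_left_le)
  next
    case False
    define m where "m = Suc n - k"
    have km: "k + m = Suc n" using False by (simp add: m_def)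
    \<comment> \<open>The Taylor bounds add up to a partial sum of \<open>exp x\<close>, which costs at most the factor \<open>exp 1\<close>.\<close>
    define r where "r = M (Suc n) / M n"
    define x where "x = exp 1 * \<bar>h\<bar> * r"
    have r0: "0 < r"
      using pos by (simp add: r_def)
    then have x0: "0 \<le> x"
      by (simp add: x_def)
    have x1: "x \<le> 1"
      using h pos[of n] by (simp add: x_def r_def field_simps)
    have growth: "M (k + i) \<le> M k * r ^ i" if "i \<le> m" for i
      using that
    proof (induction i)
      case (Suc i)
      then have "M (Suc (k + i)) / M (k + i) \<le> r"
        unfolding r_def using km by (intro ratio) auto
      then have "M (Suc (k + i)) \<le> M (k + i) * r"
        using pos[of "k + i"] by (simp add: field_simps)
      also have "\<dots> \<le> M k * r ^ i * r"
        using Suc r0 by (intro mult_right_mono) auto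
      finally show ?case by (simp add: mult_ac)
    qed simp
    let ?E = "exp (real k - real (Suc n)) * M k"
    define S where "S = (\<lambda>y. \<Sum>i<m. h ^ i / fact i * tw (k + i) (c + real i * pi / 2) t y)"
    define R where "R = (\<lambda>y. tw k c (t + h) y - S y)"
    have "approx (\<Sum>i<m. ?E * (x ^ i / fact i)) S"
      unfolding S_def
    proof (intro approx_sum)
      fix i assume i: "i \<in> {..<m}"
      show "approx (?E * (x ^ i / fact i)) (\<lambda>y. h ^ i / fact i * tw (k + i) (c + real i * pi / 2) t y)"
      proof (rule approx_mono[OF approx_cmult[OF small]])
        have "\<bar>h ^ i / fact i\<bar> * (exp (real (k + i) - real (Suc n)) * M (k + i))
            \<le> (\<bar>h\<bar> ^ i / fact i) * (exp (real (k + i) - real (Suc n)) * (M k * r ^ i))"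
          unfolding abs_divide power_abs abs_of_pos[OF fact_gt_zero]
          using growth[of i] i by (intro mult_left_mono) auto
        also have "\<dots> = ?E * (x ^ i / fact i)"
        proof -
          have "exp (real (k + i) - real (Suc n)) = exp (real k - real (Suc n)) * exp 1 ^ i"
            by (simp add: exp_of_nat_mult[symmetric] exp_add[symmetric] algebra_simps)
          then show ?thesis
            by (simp only: x_def power_mult_distrib) (simp add: mult_ac)
        qed
        finally show "\<bar>h ^ i / fact i\<bar> * (exp (real (k + i) - real (Suc n)) * M (k + i))
            \<le> ?E * (x ^ i / fact i)" .
      qed
    qed auto
    moreover have "approx (?E * (x ^ m / fact m)) R"
    proof (rule approx_small)
      let ?g = "\<lambda>y. \<bar>h\<bar> ^ m / fact m * (poly_x_value q y * (y $ j) ^ Suc n)"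
      show "L2 \<mu> ?g" by (rule L2_cmult[OF L2])
      show "R \<in> borel_measurable borel"
        unfolding R_def S_def using tw_meas by measurable
      show "\<bar>R y\<bar> \<le> \<bar>?g y\<bar>" for y
      proof -
        have "R y = poly_x_value q y * (y $ j) ^ k * (cos ((t * (y $ j) + c) + h * (y $ j)) -
            (\<Sum>i<m. (h * (y $ j)) ^ i / fact i * cos ((t * (y $ j) + c) + real i * pi / 2)))"
          unfolding R_def S_def tw_def
          by (simp add: algebra_simps sum_distrib_left power_add power_mult_distrib)
        then have "\<bar>R y\<bar> \<le> \<bar>poly_x_value q y * (y $ j) ^ k\<bar> * (\<bar>h * (y $ j)\<bar> ^ m / fact m)"
          using cos_Taylor_bound[of "t * (y $ j) + c" "h * (y $ j)" m]
          by (simp only: abs_mult[of "_ * _ ^ k"] mult_left_mono abs_ge_zero)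
        also have "\<dots> = \<bar>?g y\<bar>"
          by (simp add: abs_mult power_abs power_mult_distrib power_add mult_ac flip: km)
        finally show ?thesis .
      qed
      have "norm2 \<mu> ?g \<le> \<bar>h\<bar> ^ m / fact m * M (Suc n)"
        unfolding norm2_cmult abs_divide power_abs abs_of_pos[OF fact_gt_zero] abs_abs
        by (intro mult_left_mono bound) auto
      also have "\<dots> \<le> \<bar>h\<bar> ^ m / fact m * (M k * r ^ m)"
        using growth[of m] km by (intro mult_left_mono) auto
      also have "\<dots> = ?E * (x ^ m / fact m)"
      proof -
        have "exp (real k - real (Suc n)) * exp 1 ^ m = 1"
          by (simp add: exp_of_nat_mult[symmetric] exp_add[symmetric] flip: km)
        then have "?E * (x ^ m / fact m) = 1 * (\<bar>h\<bar> ^ m / fact m * (M k * r ^ m))"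
          by (simp only: x_def power_mult_distrib mult_ac times_divide_eq_right)
        from this[symmetric] show ?thesis by (simp only: mult_1_left)
      qed
      finally show "norm2 \<mu> ?g \<le> ?E * (x ^ m / fact m)" .
    qed
    ultimately have "approx ((\<Sum>i<m. ?E * (x ^ i / fact i)) + ?E * (x ^ m / fact m)) (\<lambda>y. S y + R y)"
      by (rule approx_add)
    moreover have "(\<Sum>i<m. ?E * (x ^ i / fact i)) + ?E * (x ^ m / fact m)
        = ?E * (\<Sum>i\<le>m. x ^ i / fact i)"
      by (simp add: sum_distrib_left lessThan_Suc_atMost[symmetric] distrib_left)
    moreover have "?E * (\<Sum>i\<le>m. x ^ i / fact i) \<le> ?E * exp 1"
      using exp_partial_sum_le[OF x0, of m] x1 pos[of k]
      by (intro mult_left_mono) (auto intro: order_trans)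
    moreover have "?E * exp 1 = exp (real k - real n) * M k"
      by (simp add: exp_add[symmetric] mult_ac flip: exp_add)
    moreover have "(\<lambda>y. S y + R y) = tw k c (t + h)"
      by (auto simp: R_def)
    ultimately show ?thesis
      by (metis approx_mono)
  qed
qed

text \<open>
  Going back from \<open>t\<close> to \<open>0\<close>, where the curve is polynomial, in steps as long as allowed shows that the curve
  is arbitrarily small modulo the polynomials. The divergence of the sum says that the steps suffice for every \<open>t\<close>.
\<close>

lemma approx_poly_cos:
  fixes M :: "nat \<Rightarrow> real" and q :: "'m poly_x" and j :: 'm
  assumes pos: "\<And>k. 0 < M k"
    and ratio: "\<And>a b. a \<le> b \<Longrightarrow> M (Suc a) / M a \<le> M (Suc b) / M b"
    and bound: "\<And>k. norm2 \<mu> (\<lambda>y. poly_x_value q y * (y $ j) ^ k) \<le> M k"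
    and div: "\<not> summable (\<lambda>k. M k / M (Suc k))"
    and "0 < \<epsilon>"
  shows "approx \<epsilon> (\<lambda>y. poly_x_value q y * cos (t * (y $ j) + c))"
proof -
  define tw where "tw = (\<lambda>k c t y. poly_x_value q y * (y $ j) ^ k * cos (t * (y $ j) + c))"
  define \<delta> where "\<delta> = (\<lambda>k. M k / (exp 1 * M (Suc k)))"
  have \<delta>0: "0 < \<delta> k" for k using pos by (simp add: \<delta>_def)
  have tw0: "tw k c 0 = poly_x_value (q * Poly_Mapping.single (Poly_Mapping.single j k) (cos c))" for k c
    by (auto simp: tw_def monomial_value_single)
  have reach: "approx (exp (real k - real a) * M k) (tw k c t)"
    if "\<bar>t\<bar> \<le> (\<Sum>i<N. \<delta> (a + i))" for N a t k c
    using that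
  proof (induction N arbitrary: a t k c)
    case 0
    have "approx (exp (real k - real a) * M k) (tw k c 0)"
      unfolding tw0 by (intro approx_poly) (simp add: less_imp_le[OF pos])
    then show ?case using 0 by simp
  next
    case (Suc N)
    define h where "h = sgn t * min \<bar>t\<bar> (\<delta> a)"
    have sum: "\<bar>t\<bar> \<le> \<delta> a + (\<Sum>i<N. \<delta> (Suc a + i))"
      using Suc.prems by (subst (asm) sum.lessThan_Suc_shift) simp
    have h: "\<bar>h\<bar> \<le> \<delta> a" "\<bar>t - h\<bar> \<le> (\<Sum>i<N. \<delta> (Suc a + i))"
      using sum \<delta>0[of a] sum_nonneg[of "{..<N}" "\<lambda>i. \<delta> (Suc a + i)"] less_imp_le[OF \<delta>0]
      by (auto simp: h_def sgn_if min_def)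
    have "approx (exp (real k - real a) * M k) (tw k c (t - h + h))"
      unfolding tw_def
    proof (rule Bang_step[OF pos ratio bound])
      show "approx (exp (real k - real (Suc a)) * M k)
          (\<lambda>y. poly_x_value q y * (y $ j) ^ k * cos ((t - h) * (y $ j) + c))" for k c
        using Suc.IH[OF h(2)] unfolding tw_def .
      show "\<bar>h\<bar> * (exp 1 * M (Suc a)) \<le> M a"
        using h(1) pos[of "Suc a"] by (simp add: \<delta>_def field_simps)
    qed
    then show ?case by simp
  qed
  have "((\<lambda>a. exp (- real a) * M 0) \<longlongrightarrow> 0 * M 0) sequentially"
    by (intro tendsto_mult tendsto_const filterlim_compose[OF exp_at_bot])
      (simp add: filterlim_uminus_at_bot filterlim_real_sequentially)
  then obtain a where a: "exp (- real a) * M 0 < \<epsilon>"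
    using order_tendstoD(2)[of _ 0 sequentially \<epsilon>] \<open>0 < \<epsilon>\<close>
    by (auto simp: eventually_sequentially)
  have "\<not> summable (\<lambda>i. \<delta> (a + i))"
  proof
    assume "summable (\<lambda>i. \<delta> (a + i))"
    then have "summable (\<lambda>i. \<delta> i)"
      using summable_iff_shift[of \<delta> a] by (simp add: add.commute)
    then have "summable (\<lambda>i. exp 1 * \<delta> i)" by (rule summable_mult)
    then show False using div by (simp add: \<delta>_def)
  qed
  then have "\<not> (\<forall>N. (\<Sum>i<N. \<delta> (a + i)) \<le> \<bar>t\<bar>)"
    using summableI_nonneg_bounded[of "\<lambda>i. \<delta> (a + i)" "\<bar>t\<bar>"] less_imp_le[OF \<delta>0] by blast
  then obtain N where "\<bar>t\<bar> < (\<Sum>i<N. \<delta> (a + i))"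
    by (auto simp: not_le)
  then have "approx (exp (real 0 - real a) * M 0) (tw 0 c t)"
    by (intro reach[where N = N]) simp
  then show ?thesis
    using a by (auto simp: tw_def elim: approx_mono)
qed

definition approximable :: "(real^'m \<Rightarrow> real) \<Rightarrow> bool" where
  "approximable f \<longleftrightarrow> (\<forall>\<epsilon>>0. approx \<epsilon> f)"

text \<open>
  The closure of the polynomials is not an algebra. Its bounded multipliers are one, and
  this is why the cosines can be combined freely.
\<close>

definition multiplier :: "(real^'m \<Rightarrow> real) \<Rightarrow> bool" where
  "multiplier w \<longleftrightarrow> w \<in> borel_measurable borel \<and> (\<exists>C. \<forall>y. \<bar>w y\<bar> \<le> C) \<and>
     (\<forall>q. approximable (\<lambda>y. poly_x_value q y * w y))"

lemma approximable_mult: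
  assumes w: "multiplier w" and f: "approximable f"
  shows "approximable (\<lambda>y. f y * w y)"
  unfolding approximable_def
proof (intro allI impI)
  fix \<epsilon> :: real assume "0 < \<epsilon>"
  obtain C0 where C0: "\<And>y. \<bar>w y\<bar> \<le> C0" using w by (auto simp: multiplier_def)
  define C where "C = C0 + 1"
  have C: "\<bar>w y\<bar> \<le> C" "0 < C" for y using C0[of y] by (auto simp: C_def intro: order_trans)
  have "approx (\<epsilon> / (2 * C)) f"
    using f \<open>0 < \<epsilon>\<close> C(2) by (simp add: approximable_def)
  then obtain q where Lf: "L2 \<mu> f"
    and q: "norm2 \<mu> (\<lambda>y. f y - poly_x_value q y) \<le> \<epsilon> / (2 * C)"
    by (auto simp: approx_def)
  define g where "g = (\<lambda>y. f y - poly_x_value q y)"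
  have Lg: "L2 \<mu> g" unfolding g_def by (intro L2_diff Lf L2_poly)
  have "approx (\<epsilon> / 2) (\<lambda>y. poly_x_value q y * w y)"
    using w \<open>0 < \<epsilon>\<close> by (simp add: multiplier_def approximable_def)
  moreover have "approx (\<epsilon> / 2) (\<lambda>y. g y * w y)"
  proof (rule approx_small)
    show "L2 \<mu> (\<lambda>y. C * g y)" by (rule L2_cmult[OF Lg])
    have "f \<in> borel_measurable borel" "w \<in> borel_measurable borel"
      using Lf w measurable_cong_sets[OF sets_eq refl]
      by (auto simp: L2_def multiplier_def)
    then show "(\<lambda>y. g y * w y) \<in> borel_measurable borel"
      unfolding g_def by measurable
    show "\<bar>g y * w y\<bar> \<le> \<bar>C * g y\<bar>" for y
      using C(1)[of y] C(2) by (simp add: abs_mult mult.commute[of "\<bar>g y\<bar>"] mult_right_mono)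
    show "norm2 \<mu> (\<lambda>y. C * g y) \<le> \<epsilon> / 2"
      using q C(2) unfolding norm2_cmult g_def by (simp add: field_simps)
  qed
  ultimately have "approx (\<epsilon> / 2 + \<epsilon> / 2) (\<lambda>y. poly_x_value q y * w y + g y * w y)"
    by (rule approx_add)
  then show "approx \<epsilon> (\<lambda>y. f y * w y)"
    by (simp add: g_def algebra_simps)
qed

lemma multiplier_const: "multiplier (\<lambda>y. c)"
  unfolding multiplier_def
proof (intro conjI allI)
  fix q :: "'m poly_x"
  have "(\<lambda>y. poly_x_value q y * c) = poly_x_value (q * Poly_Mapping.single 0 c)" by auto
  then show "approximable (\<lambda>y. poly_x_value q y * c)"
    by (simp add: approximable_def approx_poly)
qed auto

lemma multiplier_add:
  assumes "multiplier v" "multiplier w"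
  shows "multiplier (\<lambda>y. v y + w y)"
  unfolding multiplier_def
proof (intro conjI allI)
  show "(\<lambda>y. v y + w y) \<in> borel_measurable borel"
    using assms by (auto simp: multiplier_def)
  obtain C D where "\<And>y. \<bar>v y\<bar> \<le> C" "\<And>y. \<bar>w y\<bar> \<le> D"
    using assms by (auto simp: multiplier_def)
  then have "\<bar>v y + w y\<bar> \<le> C + D" for y
    by (meson abs_triangle_ineq add_mono order_trans)
  then show "\<exists>C. \<forall>y. \<bar>v y + w y\<bar> \<le> C" by blast
  fix q :: "'m poly_x"
  show "approximable (\<lambda>y. poly_x_value q y * (v y + w y))"
    unfolding approximable_def
  proof (intro allI impI)
    fix \<epsilon> :: real assume "0 < \<epsilon>"
    then have "approx (\<epsilon> / 2 + \<epsilon> / 2) (\<lambda>y. poly_x_value q y * v y + poly_x_value q y * w y)"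
      using assms by (intro approx_add) (auto simp: multiplier_def approximable_def)
    then show "approx \<epsilon> (\<lambda>y. poly_x_value q y * (v y + w y))"
      by (simp add: algebra_simps)
  qed
qed

lemma multiplier_mult:
  assumes "multiplier v" "multiplier w"
  shows "multiplier (\<lambda>y. v y * w y)"
  unfolding multiplier_def
proof (intro conjI allI)
  show "(\<lambda>y. v y * w y) \<in> borel_measurable borel"
    using assms by (auto simp: multiplier_def)
  obtain C D where CD: "\<And>y. \<bar>v y\<bar> \<le> C" "\<And>y. \<bar>w y\<bar> \<le> D"
    using assms by (auto simp: multiplier_def)
  have "\<bar>v y * w y\<bar> \<le> C * D" for y
    using CD[of y] by (auto simp: abs_mult intro!: mult_mono intro: order_trans[OF abs_ge_zero])
  then show "\<exists>C. \<forall>y. \<bar>v y * w y\<bar> \<le> C" by blast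
  show "approximable (\<lambda>y. poly_x_value q y * (v y * w y))" for q
    using approximable_mult[OF assms(2), of "\<lambda>y. poly_x_value q y * v y"] assms(1)
    by (simp add: multiplier_def mult.assoc)
qed

lemma multiplier_sum: "(\<And>i. i \<in> I \<Longrightarrow> multiplier (f i)) \<Longrightarrow> multiplier (\<lambda>y. \<Sum>i\<in>I. f i y)"
  by (induction I rule: infinite_finite_induct) (auto intro: multiplier_add multiplier_const)

lemma multiplier_polynomial_function:
  assumes "real_polynomial_function \<pi>" and w: "\<And>j. multiplier (\<lambda>y. w y $ j)"
  shows "multiplier (\<lambda>y. \<pi> (w y :: real^'m))"
  using assms(1)
proof (induction \<pi> rule: real_polynomial_function.induct)
  case (linear f)
  have "f (w y) = (\<Sum>j\<in>UNIV. f (axis j 1) * (w y $ j))" for y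
  proof -
    have "f (w y) = f (\<Sum>j\<in>UNIV. (w y $ j) *\<^sub>R axis j 1)"
      by (metis (no_types, lifting) basis_expansion scalar_mult_eq_scaleR sum.cong)
    then show ?thesis
      using bounded_linear.linear[OF linear]
      by (simp add: linear_sum linear_scale mult.commute)
  qed
  then show ?case
    by (simp add: multiplier_sum multiplier_mult multiplier_const w)
qed (auto intro: multiplier_add multiplier_mult multiplier_const)

lemma approximable_uniform_limit:
  assumes meas: "f \<in> borel_measurable borel"
    and lim: "\<And>\<epsilon>. 0 < \<epsilon> \<Longrightarrow> \<exists>w. multiplier w \<and> (\<forall>y. \<bar>f y - w y\<bar> \<le> \<epsilon>)"
  shows "approximable f"
  unfolding approximable_def
proof (intro allI impI)
  fix \<epsilon> :: real assume "0 < \<epsilon>"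
  define A where "A = norm2 \<mu> (\<lambda>y. 1) + 1"
  have A: "0 < A" "norm2 \<mu> (\<lambda>y. 1) \<le> A" by (auto simp: A_def add_nonneg_pos)
  have one: "poly_x_value (1 :: 'm poly_x) = (\<lambda>y. 1)" by auto
  obtain w where w: "multiplier w" and fw: "\<And>y. \<bar>f y - w y\<bar> \<le> \<epsilon> / (2 * A)"
    using lim[of "\<epsilon> / (2 * A)"] \<open>0 < \<epsilon>\<close> A(1) by auto
  have "approximable (\<lambda>y. poly_x_value 1 y * w y)"
    using w unfolding multiplier_def by blast
  then have "approx (\<epsilon> / 2) w"
    using \<open>0 < \<epsilon>\<close> by (simp add: approximable_def)
  moreover have "approx (\<epsilon> / 2) (\<lambda>y. f y - w y)"
  proof (rule approx_small)
    show "L2 \<mu> (\<lambda>y. \<epsilon> / (2 * A) * 1)"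
      using L2_poly[of 1] unfolding one by (rule L2_cmult)
    show "(\<lambda>y. f y - w y) \<in> borel_measurable borel"
      using meas w by (auto simp: multiplier_def)
    show "\<bar>f y - w y\<bar> \<le> \<bar>\<epsilon> / (2 * A) * 1\<bar>" for y using fw[of y] by linarith
    have "\<epsilon> / (2 * A) * norm2 \<mu> (\<lambda>y. 1) \<le> \<epsilon> / (2 * A) * A"
      using A \<open>0 < \<epsilon>\<close> by (intro mult_left_mono) auto
    then show "norm2 \<mu> (\<lambda>y. \<epsilon> / (2 * A) * 1) \<le> \<epsilon> / 2"
      unfolding norm2_cmult using A \<open>0 < \<epsilon>\<close> by (simp add: abs_of_pos)
  qed
  ultimately have "approx (\<epsilon> / 2 + \<epsilon> / 2) (\<lambda>y. w y + (f y - w y))" by (rule approx_add)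
  then show "approx \<epsilon> f" by simp
qed

text \<open>
  A bump around \<open>c\<close>, repeated with period \<open>2L\<close> in every coordinate. It is a continuous function of the cosines
  of \<open>\<pi> (y\<^sub>j - c\<^sub>j) / L\<close>, so that the theorem of Stone and Weierstrass applies.
\<close>

definition periodic_bump :: "real \<Rightarrow> real \<Rightarrow> real^'m \<Rightarrow> real^'m \<Rightarrow> real" where
  "periodic_bump \<delta> L c y = (\<Prod>j\<in>UNIV. max 0 (1 - L * arccos (cos (pi / L * (y $ j - c $ j))) / (pi * \<delta>)))"

lemma approximable_periodic_bump:
  assumes cos: "\<And>j t c. multiplier (\<lambda>y. cos (t * (y $ j) + c))"
  shows "approximable (periodic_bump \<delta> L c)"
proof (rule approximable_uniform_limit)
  define w :: "real^'m \<Rightarrow> real^'m" where "w = (\<lambda>y. \<chi> j. cos (pi / L * (y $ j) + (- pi / L * (c $ j))))"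
  define \<Phi> :: "real^'m \<Rightarrow> real" where "\<Phi> = (\<lambda>z. \<Prod>j\<in>UNIV. max 0 (1 - L * arccos (z $ j) / (pi * \<delta>)))"
  let ?K = "cbox (\<chi> j. -1) (\<chi> j. 1) :: (real^'m) set"
  have bump: "periodic_bump \<delta> L c y = \<Phi> (w y)" for y
    by (simp add: periodic_bump_def \<Phi>_def w_def algebra_simps)
  have wK: "w y \<in> ?K" for y by (auto simp: w_def mem_box_cart)
  have cont: "continuous_on ?K \<Phi>"
    unfolding \<Phi>_def divide_inverse
    by (intro continuous_intros) (auto simp: mem_box_cart)
  have "continuous_on UNIV w"
    unfolding w_def by (intro continuous_intros)
  then have "continuous_on UNIV (\<lambda>y. \<Phi> (w y))"
    by (intro continuous_on_compose2[OF cont]) (use wK in auto)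
  then show "periodic_bump \<delta> L c \<in> borel_measurable borel"
    using borel_measurable_continuous_onI by (simp add: bump[abs_def])
  fix \<epsilon> :: real assume "0 < \<epsilon>"
  then obtain \<pi> where \<pi>: "real_polynomial_function \<pi>" "\<And>z. z \<in> ?K \<Longrightarrow> \<bar>\<Phi> z - \<pi> z\<bar> < \<epsilon>"
    using Stone_Weierstrass_real_polynomial_function[OF compact_cbox cont] by blast
  have "multiplier (\<lambda>y. \<pi> (w y))"
    by (rule multiplier_polynomial_function[OF \<pi>(1)]) (unfold w_def vec_lambda_beta, rule cos)
  then show "\<exists>v. multiplier v \<and> (\<forall>y. \<bar>periodic_bump \<delta> L c y - v y\<bar> \<le> \<epsilon>)"
    using \<pi>(2)[OF wK] by (intro exI[of _ "\<lambda>y. \<pi> (w y)"]) (auto simp: bump intro: less_imp_le)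
qed

end

section \<open>Carleman's condition\<close>

text \<open>
  Carleman's inequality. The weights \<open>i + 1\<close> in the inequality of arithmetic and geometric means are those for
  which \<open>a i = 1 / (i + 1)\<close> gives equality; the partial sums are then bounded by a telescoping estimate.
\<close>

lemma Carleman_summable:
  fixes a :: "nat \<Rightarrow> real"
  assumes pos: "\<And>i. 0 < a i" and sum: "summable a"
  shows "summable (\<lambda>n. (\<Prod>i<Suc n. a i) powr (1 / real (Suc n)))"
proof -
  define A where "A = (\<lambda>K. \<Sum>i<K. real (Suc i) * a i)"
  have A0: "0 \<le> A K" for K unfolding A_def using less_imp_le[OF pos] by (intro sum_nonneg) auto
  have mean: "(\<Prod>i<Suc n. a i) powr (1 / real (Suc n)) \<le> exp 1 * (A (Suc n) / (real (Suc n))\<^sup>2)" for n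
  proof -
    let ?N = "real (Suc n)"
    have "(\<Prod>i<Suc n. real (Suc i) * a i) = fact (Suc n) * (\<Prod>i<Suc n. a i)"
      by (simp add: prod.distrib fact_prod_Suc lessThan_atLeast0 del: prod.lessThan_Suc prod.op_ivl_Suc)
    then have "(\<Prod>i<Suc n. a i) powr (1 / ?N)
        = (\<Prod>i<Suc n. real (Suc i) * a i) powr (1 / ?N) / fact (Suc n) powr (1 / ?N)"
      using pos by (simp add: powr_mult prod_nonneg less_imp_le del: prod.lessThan_Suc fact_Suc)
    also have "\<dots> \<le> (A (Suc n) / ?N) / (?N / exp 1)"
    proof (intro frac_le)
      show "(\<Prod>i<Suc n. real (Suc i) * a i) powr (1 / ?N) \<le> A (Suc n) / ?N"
        using arith_geom_mean[of "{..<Suc n}" "\<lambda>i. real (Suc i) * a i"] less_imp_le[OF pos]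
        by (simp add: A_def sum_divide_distrib lessThan_empty_iff del: prod.lessThan_Suc sum.lessThan_Suc of_nat_Suc)
      have "?N ^ Suc n / fact (Suc n) \<le> (\<Sum>i\<le>Suc n. ?N ^ i / fact i)"
        by (rule member_le_sum) auto
      also have "\<dots> \<le> exp ?N" by (rule exp_partial_sum_le) simp
      finally have "(?N / exp 1) ^ Suc n \<le> fact (Suc n)"
        by (simp add: power_divide exp_of_nat_mult[symmetric] field_simps del: fact_Suc power_Suc of_nat_Suc)
      then have "((?N / exp 1) ^ Suc n) powr (1 / ?N) \<le> fact (Suc n) powr (1 / ?N)"
        by (intro powr_mono2) auto
      moreover have "((?N / exp 1) ^ Suc n) powr (1 / ?N) = ?N / exp 1"
        by (simp add: powr_powr del: power_Suc of_nat_Suc flip: powr_realpow)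
      ultimately show "?N / exp 1 \<le> fact (Suc n) powr (1 / ?N)" by simp
    qed (use A0 in auto)
    also have "\<dots> = exp 1 * (A (Suc n) / ?N\<^sup>2)"
      by (simp add: power2_eq_square mult.commute del: of_nat_Suc)
    finally show ?thesis .
  qed
  \<comment> \<open>The second summand makes the induction work; it accounts for the tail of \<open>\<Sum>n. 1 / n\<^sup>2\<close>.\<close>
  have tele: "(\<Sum>n<K. A (Suc n) / (real (Suc n))\<^sup>2) + A K / real K \<le> 2 * (\<Sum>i<K. a i)" for K
  proof (induction K)
    case (Suc K)
    let ?k = "real K"
    have "A (Suc K) / (real (Suc K))\<^sup>2 + A (Suc K) / real (Suc K) \<le> A K / ?k + 2 * a K"
    proof -
      have "A (Suc K) / (?k + 1)\<^sup>2 + A (Suc K) / (?k + 1)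
          = A K * ((?k + 2) / (?k + 1)\<^sup>2) + a K * ((?k + 2) / (?k + 1))"
      proof -
        have "(x + c * z) / c\<^sup>2 + (x + c * z) / c = x * ((c + 1) / c\<^sup>2) + z * ((c + 1) / c)"
          if "0 < c" for x c z :: real
          using that by (simp add: field_simps power2_eq_square)
        from this[of "?k + 1" "A K" "a K"] show ?thesis by (simp add: A_def add_ac)
      qed
      also have "\<dots> \<le> A K * (1 / ?k) + a K * 2"
      proof (cases "K = 0")
        case True
        then show ?thesis by (simp add: A_def)
      next
        case False
        have "(?k + 2) * ?k \<le> (?k + 1)\<^sup>2" by (simp add: power2_eq_square algebra_simps)
        then have "?k + 2 \<le> (?k + 1)\<^sup>2 / ?k" using False by (intro mult_imp_le_div_pos) auto
        then have "(?k + 2) / (?k + 1)\<^sup>2 \<le> 1 / ?k" by (intro mult_imp_div_pos_le) auto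
        moreover have "(?k + 2) / (?k + 1) \<le> 2" by (intro mult_imp_div_pos_le) auto
        ultimately show ?thesis using A0[of K] pos[of K] by (intro add_mono mult_left_mono) auto
      qed
      finally show ?thesis by (simp add: add.commute)
    qed
    then show ?case using Suc by simp
  qed (simp add: A_def)
  have "summable (\<lambda>n. A (Suc n) / (real (Suc n))\<^sup>2)"
  proof (rule summableI_nonneg_bounded)
    show "(\<Sum>n<K. A (Suc n) / (real (Suc n))\<^sup>2) \<le> 2 * suminf a" for K
    proof -
      have "0 \<le> A K / real K" using A0[of K] by simp
      moreover have "(\<Sum>i<K. a i) \<le> suminf a"
        using sum less_imp_le[OF pos] by (intro sum_le_suminf) auto
      ultimately show ?thesis using tele[of K] by linarith
    qed
  qed (use A0 in auto)
  then have "summable (\<lambda>n. exp 1 * (A (Suc n) / (real (Suc n))\<^sup>2))" by (rule summable_mult)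
  then show ?thesis
    by (rule summable_comparison_test'[where N = 0]) (use mean in auto)
qed

context polynomial_moments
begin

definition moment :: "'m \<Rightarrow> nat \<Rightarrow> real" where
  "moment j d = (\<integral>y. (y $ j) ^ (2 * d) \<partial>\<mu>)"

lemma L2_power: "L2 \<mu> (\<lambda>y. (y $ j) ^ k)"
proof -
  have "poly_x_value (Poly_Mapping.single (Poly_Mapping.single j k) 1) = (\<lambda>y. (y $ j) ^ k)"
    by (auto simp: monomial_value_single)
  then show ?thesis using L2_poly by metis
qed

lemma norm2_power: "norm2 \<mu> (\<lambda>y. (y $ j) ^ k) = sqrt (moment j k)"
  by (simp add: norm2_def moment_def power_mult[symmetric] mult.commute)

lemma moment_nonneg: "0 \<le> moment j d"
  by (simp add: moment_def power_mult)

lemma moment_log_convex: "(moment j (Suc d))\<^sup>2 \<le> moment j d * moment j (Suc (Suc d))"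
proof -
  have "moment j (Suc d) = (\<integral>y. (y $ j) ^ d * (y $ j) ^ Suc (Suc d) \<partial>\<mu>)"
    by (simp add: moment_def power_add[symmetric] mult_2 add.commute del: power_Suc)
  then have "\<bar>moment j (Suc d)\<bar> \<le> sqrt (moment j d) * sqrt (moment j (Suc (Suc d)))"
    using norm2_Cauchy_Schwarz[OF L2_power[of j d] L2_power[of j "Suc (Suc d)"]]
    by (simp add: norm2_power del: power_Suc)
  then have "\<bar>moment j (Suc d)\<bar>\<^sup>2 \<le> (sqrt (moment j d) * sqrt (moment j (Suc (Suc d))))\<^sup>2"
    by (intro power_mono) auto
  then show ?thesis by (simp add: power_mult_distrib moment_nonneg)
qed

text \<open>
  Bang's argument needs the ratios of consecutive moments, Carleman's condition speaks of roots. The product of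
  the square roots of the first ratios telescopes, so Carleman's inequality connects the two.
\<close>

lemma Carleman_moment_ratio:
  assumes pos: "\<And>d. 0 < moment j d"
    and div: "suminf (\<lambda>d. inverse (ennreal (moment j (Suc d) powr (1 / real (2 * Suc d))))) = \<infinity>"
  shows "\<not> summable (\<lambda>d. sqrt (moment j d / moment j (Suc d)))"
proof
  let ?m = "moment j"
  let ?a = "\<lambda>d. sqrt (?m d / ?m (Suc d))"
  assume "summable ?a"
  then have sum: "summable (\<lambda>n. (\<Prod>i<Suc n. ?a i) powr (1 / real (Suc n)))"
    using pos by (intro Carleman_summable) auto
  define C where "C = max 1 (1 / ?m 0)"
  have prod: "(\<Prod>i<n. ?a i) = sqrt (?m 0 / ?m n)" for n
    using pos[THEN less_imp_neq, THEN not_sym]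
    by (induction n) (auto simp flip: real_sqrt_mult)
  have le: "inverse (?m (Suc d) powr (1 / real (2 * Suc d)))
      \<le> C * (\<Prod>i<Suc d. ?a i) powr (1 / real (Suc d))" for d
  proof -
    let ?e = "1 / real (2 * Suc d)"
    have "(\<Prod>i<Suc d. ?a i) powr (1 / real (Suc d)) = (?m 0 / ?m (Suc d)) powr ?e"
      unfolding prod using pos[of 0] pos[of "Suc d"]
      by (simp add: powr_half_sqrt[symmetric] powr_powr)
    also have "\<dots> = ?m 0 powr ?e * inverse (?m (Suc d) powr ?e)"
      using pos[of 0] pos[of "Suc d"] by (subst powr_divide) (auto simp: divide_inverse less_imp_le)
    finally have eq: "(\<Prod>i<Suc d. ?a i) powr (1 / real (Suc d)) = ?m 0 powr ?e * inverse (?m (Suc d) powr ?e)" .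
    have "1 \<le> C * ?m 0 powr ?e"
    proof (cases "1 \<le> ?m 0")
      case True
      then have "1 \<le> ?m 0 powr ?e" by (intro ge_one_powr_ge_zero) auto
      moreover have "C = 1" using True by (simp add: C_def max_def)
      ultimately show ?thesis by simp
    next
      case False
      then have "?m 0 powr 1 \<le> ?m 0 powr ?e"
        using pos[of 0] by (intro powr_mono') auto
      moreover have "0 \<le> C" by (simp add: C_def)
      ultimately have "C * ?m 0 powr 1 \<le> C * ?m 0 powr ?e" by (rule mult_left_mono)
      moreover have "C * ?m 0 powr 1 = 1" using False pos[of 0] by (simp add: C_def max_def)
      ultimately show ?thesis by linarith
    qed
    then have "1 * inverse (?m (Suc d) powr ?e) \<le> (C * ?m 0 powr ?e) * inverse (?m (Suc d) powr ?e)"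
      by (intro mult_right_mono) auto
    then show ?thesis unfolding eq by (simp add: mult.assoc)
  qed
  have "summable (\<lambda>d. C * (\<Prod>i<Suc d. ?a i) powr (1 / real (Suc d)))"
    by (rule summable_mult[OF sum])
  then have "summable (\<lambda>d. inverse (?m (Suc d) powr (1 / real (2 * Suc d))))"
    by (rule summable_comparison_test'[where N = 0]) (use le in auto)
  then have "suminf (\<lambda>d. ennreal (inverse (?m (Suc d) powr (1 / real (2 * Suc d))))) < \<infinity>"
    by (subst suminf_ennreal2) auto
  moreover have "ennreal (inverse (?m (Suc d) powr (1 / real (2 * Suc d))))
      = inverse (ennreal (?m (Suc d) powr (1 / real (2 * Suc d))))" for d
    using pos[of "Suc d"] by (intro inverse_ennreal[symmetric]) simp
  ultimately show False using div by simp
qed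

definition weighted :: "'m poly_x \<Rightarrow> (real^'m) measure" where
  "weighted g = density \<mu> (\<lambda>y. ennreal (1 + (poly_x_value g y)\<^sup>2))"

lemma poly_measurable [measurable]: "poly_x_value q \<in> borel_measurable \<mu>"
  using integrable_poly by auto

lemma integral_weighted:
  assumes "f \<in> borel_measurable borel"
  shows "(\<integral>y. f y \<partial>weighted g) = (\<integral>y. (1 + (poly_x_value g y)\<^sup>2) * f y \<partial>\<mu>)"
proof -
  have [measurable]: "f \<in> borel_measurable \<mu>" using assms by measurable
  show ?thesis unfolding weighted_def by (subst integral_density) auto
qed

lemma polynomial_moments_weighted: "polynomial_moments (weighted g)"
proof
  show "sets (weighted g) = sets borel" by (simp add: weighted_def sets_eq)
  fix q
  have "poly_x_value ((1 + g * g) * q) = (\<lambda>y. (1 + (poly_x_value g y)\<^sup>2) *\<^sub>R poly_x_value q y)"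
    by (auto simp: power2_eq_square)
  then show "integrable (weighted g) (poly_x_value q)"
    unfolding weighted_def using integrable_poly[of "(1 + g * g) * q"]
    by (subst integrable_density) auto
qed

text \<open>
  The hypothesis of \<open>approx_poly_cos\<close>. The polynomial factors are separated from the powers of \<open>y\<^sub>j\<close> by
  the inequality of Cauchy and Schwarz, which leads to fourth roots of the moments of order \<open>4k\<close>. If
  some moment vanishes, so does \<open>y\<^sub>j\<close> almost everywhere, and a constant sequence serves.
\<close>

lemma Carleman_weighted_bounds:
  assumes div: "suminf (\<lambda>d. inverse (ennreal (moment j (Suc d) powr (1 / real (2 * Suc d))))) = \<infinity>"
  obtains M :: "nat \<Rightarrow> real" where "\<And>k. 0 < M k"
    and "\<And>a b. a \<le> b \<Longrightarrow> M (Suc a) / M a \<le> M (Suc b) / M b"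
    and "\<And>k. norm2 (weighted g) (\<lambda>y. poly_x_value q y * (y $ j) ^ k) \<le> M k"
    and "\<not> summable (\<lambda>k. M k / M (Suc k))"
proof (cases "\<exists>d. moment j d = 0")
  case True
  then obtain d where d: "moment j d = 0" by blast
  have "poly_x_value (Poly_Mapping.single (Poly_Mapping.single j (2 * d)) 1) = (\<lambda>y. (y $ j) ^ (2 * d))"
    by (auto simp: monomial_value_single)
  then have "integrable \<mu> (\<lambda>y. (y $ j) ^ (2 * d))" using integrable_poly by metis
  then have "AE y in \<mu>. (y $ j) ^ (2 * d) = 0"
    using d by (subst integral_nonneg_eq_0_iff_AE[symmetric]) (auto simp: moment_def)
  then have AE: "AE y in \<mu>. y $ j = 0" by (rule AE_mp) auto
  have bound: "norm2 (weighted g) (\<lambda>y. poly_x_value q y * (y $ j) ^ k)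
      \<le> norm2 (weighted g) (poly_x_value q) + 1" for k
  proof (cases "k = 0")
    case False
    have "(\<integral>y. (poly_x_value q y * (y $ j) ^ k)\<^sup>2 \<partial>weighted g) = 0"
      by (subst integral_weighted, measurable, subst integral_cong_AE[where g = "\<lambda>y. 0"])
        (use AE False in \<open>auto elim!: AE_mp\<close>)
    then have "norm2 (weighted g) (\<lambda>y. poly_x_value q y * (y $ j) ^ k) = 0" by (simp add: norm2_def)
    then show ?thesis by (simp add: add_nonneg_nonneg)
  qed simp
  let ?M = "\<lambda>k::nat. norm2 (weighted g) (poly_x_value q) + 1"
  have pos: "0 < norm2 (weighted g) (poly_x_value q) + 1" by (simp add: add_nonneg_pos)
  then have one: "?M k / ?M (Suc k) = 1" for k by simp
  show ?thesis
    by (rule that[of ?M]) (use pos bound one in \<open>auto simp: summable_const_iff\<close>)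
next
  case False
  let ?m = "moment j"
  have pos: "0 < ?m d" for d using False moment_nonneg[of j d] by (metis less_eq_real_def)
  define P where "P = q * q * (1 + g * g)"
  define A where "A = sqrt (norm2 \<mu> (poly_x_value P)) + 1"
  define M where "M = (\<lambda>k. A * sqrt (sqrt (?m (2 * k))))"
  define r where "r = (\<lambda>d. ?m (Suc d) / ?m d)"
  have A: "0 < A" by (simp add: A_def add_nonneg_pos)
  have Mpos: "0 < M k" for k using A pos by (simp add: M_def)
  have r0: "0 < r d" for d using pos by (simp add: r_def)
  have "r d \<le> r (Suc d)" for d
    using moment_log_convex[of j d] pos[of d] pos[of "Suc d"]
    by (simp add: r_def field_simps power2_eq_square)
  then have r_mono: "r d \<le> r e" if "d \<le> e" for d e
    using that by (rule lift_Suc_mono_le)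
  have Mratio: "M (Suc k) / M k = sqrt (sqrt (r (2 * k) * r (Suc (2 * k))))" for k
    using A pos[of "Suc (2 * k)"] by (simp add: M_def r_def real_sqrt_divide real_sqrt_mult less_imp_neq[THEN not_sym])
  show ?thesis
  proof (rule that[of M])
    show "0 < M k" for k by (rule Mpos)
    show "M (Suc a) / M a \<le> M (Suc b) / M b" if "a \<le> b" for a b
      unfolding Mratio using that r0 r_mono
      by (intro real_sqrt_le_mono mult_mono) (auto simp: less_imp_le)
    show "norm2 (weighted g) (\<lambda>y. poly_x_value q y * (y $ j) ^ k) \<le> M k" for k
    proof -
      have "(norm2 (weighted g) (\<lambda>y. poly_x_value q y * (y $ j) ^ k))\<^sup>2
          = (\<integral>y. (1 + (poly_x_value g y)\<^sup>2) * (poly_x_value q y * (y $ j) ^ k)\<^sup>2 \<partial>\<mu>)"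
        unfolding norm2_square by (rule integral_weighted) measurable
      also have "\<dots> = (\<integral>y. poly_x_value P y * (y $ j) ^ (2 * k) \<partial>\<mu>)"
        by (simp add: P_def power_even_eq) (simp add: power2_eq_square algebra_simps)
      also have "\<dots> \<le> norm2 \<mu> (poly_x_value P) * sqrt (?m (2 * k))"
        using norm2_Cauchy_Schwarz[OF L2_poly[of P] L2_power[of j "2 * k"]] by (simp add: norm2_power)
      finally have "norm2 (weighted g) (\<lambda>y. poly_x_value q y * (y $ j) ^ k)
          \<le> sqrt (norm2 \<mu> (poly_x_value P) * sqrt (?m (2 * k)))"
        by (rule real_le_rsqrt)
      also have "\<dots> \<le> M k"
        unfolding M_def A_def real_sqrt_mult by (intro mult_right_mono) (auto simp: moment_nonneg)
      finally show ?thesis .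
    qed
    show "\<not> summable (\<lambda>k. M k / M (Suc k))"
    proof
      assume "summable (\<lambda>k. M k / M (Suc k))"
      define s where "s = (\<lambda>d. sqrt (?m d / ?m (Suc d)))"
      have s_r: "s d = 1 / sqrt (r d)" for d by (simp add: s_def r_def real_sqrt_divide)
      have s0: "0 < s d" for d using r0 by (simp add: s_r)
      have s_mono: "s e \<le> s d" if "d \<le> e" for d e
        unfolding s_r using r_mono[OF that] r0 by (intro divide_left_mono) auto
      have "s (Suc (2 * k)) \<le> M k / M (Suc k)" for k
      proof -
        have "M (Suc k) / M k \<le> sqrt (sqrt ((r (Suc (2 * k)))\<^sup>2))"
          unfolding Mratio power2_eq_square using r0[THEN less_imp_le] r_mono[of "2 * k" "Suc (2 * k)"]
          by (intro real_sqrt_le_mono mult_right_mono) auto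
        also have "\<dots> = sqrt (r (Suc (2 * k)))" using r0[of "Suc (2 * k)"] by simp
        finally have "1 / sqrt (r (Suc (2 * k))) \<le> 1 / (M (Suc k) / M k)"
          using Mpos r0 by (intro divide_left_mono) auto
        then show ?thesis by (simp add: s_r)
      qed
      then have sum: "summable (\<lambda>k. s (Suc (2 * k)))"
        using s0 by (intro summable_comparison_test'[OF \<open>summable (\<lambda>k. M k / M (Suc k))\<close>, where N = 0])
          (auto simp: less_imp_le)
      define T where "T = suminf (\<lambda>k. s (Suc (2 * k)))"
      have "summable s"
      proof (rule summableI_nonneg_bounded)
        show "0 \<le> s n" for n using s0[of n] by simp
        show "(\<Sum>d<n. s d) \<le> s 0 + 2 * T" for n
        proof -
          have "(\<Sum>d<n. s d) \<le> (\<Sum>d<Suc (2 * n). s d)"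
            using s0[THEN less_imp_le] by (intro sum_mono2) auto
          also have "\<dots> \<le> s 0 + 2 * (\<Sum>k<n. s (Suc (2 * k)))"
          proof (induction n)
            case (Suc n)
            have "s (Suc (Suc (2 * n))) \<le> s (Suc (2 * n))" by (rule s_mono) simp
            then show ?case using Suc by simp
          qed simp
          also have "\<dots> \<le> s 0 + 2 * T"
            unfolding T_def using sum s0[THEN less_imp_le] by (simp add: sum_le_suminf)
          finally show ?thesis .
        qed
      qed
      then show False using Carleman_moment_ratio[OF pos div] by (simp add: s_def)
    qed
  qed
qed

text \<open>
  Squares of polynomials detect negative values of \<open>g\<close>: the weight \<open>1 + g\<^sup>2\<close> turns approximation in \<open>L\<^sup>2\<close> into
  approximation of \<open>\<integral> f\<^sup>2 g\<close>, and the function to approximate is a periodic bump around a point where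
  \<open>g\<close> is negative, with the other bumps so far away that they do not matter.
\<close>

lemma negative_square_integral:
  assumes div: "\<And>j. suminf (\<lambda>d. inverse (ennreal (moment j (Suc d) powr (1 / real (2 * Suc d))))) = \<infinity>"
    and supp: "\<And>U. open U \<Longrightarrow> y0 \<in> U \<Longrightarrow> 0 < emeasure \<mu> U"
    and neg: "poly_x_value g y0 < 0"
  shows "\<exists>q. (\<integral>y. (poly_x_value q y)\<^sup>2 * poly_x_value g y \<partial>\<mu>) < 0"
proof -
  let ?g = "poly_x_value g"
  interpret W: polynomial_moments "weighted g" by (rule polynomial_moments_weighted)
  have "open {y. ?g y < 0}"
    by (intro open_Collect_less continuous_on_poly_x_value continuous_on_const)
  then obtain \<rho> where \<rho>: "0 < \<rho>" "\<And>y. dist y y0 < \<rho> \<Longrightarrow> ?g y < 0"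
    using neg by (auto simp: open_dist)
  define \<delta> where "\<delta> = \<rho> / real CARD('m)"
  have \<delta>: "0 < \<delta>" using \<rho>(1) by (simp add: \<delta>_def)
  have g_neg: "?g y < 0" if "\<And>j. \<bar>y $ j - y0 $ j\<bar> < \<delta>" for y
  proof (rule \<rho>(2))
    have "dist y y0 \<le> (\<Sum>j\<in>UNIV. \<bar>(y - y0) $ j\<bar>)" unfolding dist_norm by (rule norm_le_l1_cart)
    also have "\<dots> < (\<Sum>j\<in>(UNIV :: 'm set). \<delta>)" by (rule sum_strict_mono) (use that in auto)
    also have "\<dots> = \<rho>" by (simp add: \<delta>_def)
    finally show "dist y y0 < \<rho>" .
  qed
  define b where "b = (\<lambda>y. \<Prod>j\<in>(UNIV :: 'm set). max 0 (1 - \<bar>y $ j - y0 $ j\<bar> / \<delta>))"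
  define f where "f = (\<lambda>n. W.periodic_bump \<delta> (real n) y0)"
  have [measurable]: "b \<in> borel_measurable borel" unfolding b_def by measurable
  have cos: "W.multiplier (\<lambda>y. cos (t * (y $ j) + c))" for j t c
    unfolding W.multiplier_def
  proof (intro conjI allI)
    show "\<exists>C. \<forall>y. \<bar>cos (t * y $ j + c)\<bar> \<le> C" by (intro exI[of _ 1]) auto
    fix q
    obtain M where "\<And>k. 0 < M k" "\<And>a b. a \<le> b \<Longrightarrow> M (Suc a) / M a \<le> M (Suc b) / M b"
      "\<And>k. norm2 (weighted g) (\<lambda>y. poly_x_value q y * (y $ j) ^ k) \<le> M k"
      "\<not> summable (\<lambda>k. M k / M (Suc k))"
      using Carleman_weighted_bounds[OF div] by blast
    then show "W.approximable (\<lambda>y. poly_x_value q y * cos (t * y $ j + c))"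
      unfolding W.approximable_def using W.approx_poly_cos by blast
  qed measurable
  have approx: "W.approximable (f n)" for n
    unfolding f_def by (rule W.approximable_periodic_bump[OF cos])
  have f_meas [measurable]: "f n \<in> borel_measurable borel" for n
    using approx[of n] measurable_cong_sets[OF W.sets_eq refl]
    by (auto simp: W.approximable_def W.approx_def L2_def dest: spec[of _ 1])
  have f01: "0 \<le> f n y \<and> f n y \<le> 1" for n y
  proof -
    have "0 \<le> real n * arccos (cos (pi / real n * (y $ j - y0 $ j))) / (pi * \<delta>)" for j
      using \<delta> by (intro divide_nonneg_nonneg mult_nonneg_nonneg arccos_lbound) auto
    then show ?thesis
      unfolding f_def W.periodic_bump_def by (auto intro!: prod_nonneg prod_le_1)
  qed
  have lim: "(\<lambda>n. f n y) \<longlonglongrightarrow> b y" for y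
  proof (rule tendsto_eventually)
    obtain n0 where n0: "(\<Sum>j\<in>UNIV. \<bar>y $ j - y0 $ j\<bar>) < real n0" using reals_Archimedean2 by blast
    have "f n y = b y" if n: "n \<ge> n0" for n
    proof -
      have "real n * arccos (cos (pi / real n * (y $ j - y0 $ j))) / (pi * \<delta>) = \<bar>y $ j - y0 $ j\<bar> / \<delta>" for j
      proof -
        have "\<bar>y $ j - y0 $ j\<bar> \<le> (\<Sum>j\<in>UNIV. \<bar>y $ j - y0 $ j\<bar>)" by (rule member_le_sum) auto
        then have le: "\<bar>y $ j - y0 $ j\<bar> \<le> real n" and n': "0 < real n"
          using n n0 sum_nonneg[of UNIV "\<lambda>j. \<bar>y $ j - y0 $ j\<bar>"] by (auto simp del: of_nat_0_less_iff)
        have "cos (pi / real n * (y $ j - y0 $ j)) = cos (pi / real n * \<bar>y $ j - y0 $ j\<bar>)"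
        proof -
          have "pi / real n * \<bar>y $ j - y0 $ j\<bar> = \<bar>pi / real n * (y $ j - y0 $ j)\<bar>"
            using n' by (simp add: abs_mult)
          then show ?thesis by (simp only: cos_abs_real)
        qed
        moreover have "pi / real n * \<bar>y $ j - y0 $ j\<bar> \<le> pi / real n * real n"
          using le by (intro mult_left_mono) auto
        ultimately show ?thesis using n' by (simp add: arccos_cos)
      qed
      then show ?thesis by (simp add: f_def W.periodic_bump_def b_def)
    qed
    then show "\<forall>\<^sub>F n in sequentially. f n y = b y" by (auto simp: eventually_sequentially)
  qed
  have b01: "0 \<le> b y \<and> b y \<le> 1" for y
    using LIMSEQ_le_const[OF lim, of 0 y] LIMSEQ_le_const2[OF lim, of y 1] f01 by blast
  have sq: "\<bar>c\<^sup>2 * ?g y\<bar> \<le> \<bar>?g y\<bar>" if "0 \<le> c \<and> c \<le> 1" for c y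
    using that by (simp add: abs_mult mult_left_le_one_le power_le_one)
  have int: "integrable \<mu> (\<lambda>y. (h y)\<^sup>2 * ?g y)"
    if "h \<in> borel_measurable borel" "\<And>y. 0 \<le> h y \<and> h y \<le> 1" for h
  proof (rule Bochner_Integration.integrable_bound[OF integrable_poly[of g]])
    have [measurable]: "h \<in> borel_measurable \<mu>" using that(1) by measurable
    show "(\<lambda>y. (h y)\<^sup>2 * ?g y) \<in> borel_measurable \<mu>" by measurable
  qed (use sq[OF that(2)] in auto)
  have "(\<integral>y. (b y)\<^sup>2 * ?g y \<partial>\<mu>) < 0"
  proof -
    have nonneg: "0 \<le> - ((b y)\<^sup>2 * ?g y)" for y
    proof (cases "\<forall>j. \<bar>y $ j - y0 $ j\<bar> < \<delta>")
      case True
      then show ?thesis using g_neg[of y] by (simp add: mult_nonneg_nonpos)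
    next
      case False
      then obtain j where "\<delta> \<le> \<bar>y $ j - y0 $ j\<bar>" by (auto simp: not_less)
      then have "max 0 (1 - \<bar>y $ j - y0 $ j\<bar> / \<delta>) = 0" using \<delta> by (simp add: max_def field_simps)
      then have "b y = 0" unfolding b_def by (auto intro!: prod_zero)
      then show ?thesis by simp
    qed
    have "(\<integral>y. - ((b y)\<^sup>2 * ?g y) \<partial>\<mu>) \<noteq> 0"
    proof
      assume "(\<integral>y. - ((b y)\<^sup>2 * ?g y) \<partial>\<mu>) = 0"
      then have "AE y in \<mu>. - ((b y)\<^sup>2 * ?g y) = 0"
        using int[of b] b01 nonneg by (subst (asm) integral_nonneg_eq_0_iff_AE) auto
      define U where "U = (\<Inter>j\<in>UNIV. {y. \<bar>y $ j - y0 $ j\<bar> < \<delta>})"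
      have "open U"
        unfolding U_def by (intro open_INT ballI open_Collect_less continuous_intros) auto
      have "y \<notin> U" if "- ((b y)\<^sup>2 * ?g y) = 0" for y
      proof
        assume U: "y \<in> U"
        have "0 < b y" unfolding b_def using U \<delta> by (intro prod_pos) (auto simp: U_def max_def less_imp_le)
        moreover have "?g y < 0" using U by (intro g_neg) (auto simp: U_def)
        ultimately show False using that by simp
      qed
      then have "AE y in \<mu>. y \<notin> U" using \<open>AE y in \<mu>. - ((b y)\<^sup>2 * ?g y) = 0\<close> by (auto elim: AE_mp)
      moreover have "U \<in> sets \<mu>" using \<open>open U\<close> by (simp add: sets_eq)
      ultimately have "emeasure \<mu> U = 0" by (simp add: AE_iff_null_sets null_setsD1)
      moreover have "y0 \<in> U" using \<delta> by (simp add: U_def)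
      ultimately show False using supp[OF \<open>open U\<close>] by simp
    qed
    moreover have "0 \<le> (\<integral>y. - ((b y)\<^sup>2 * ?g y) \<partial>\<mu>)" by (rule integral_nonneg_AE) (use nonneg in auto)
    ultimately show ?thesis by simp
  qed
  moreover have "(\<lambda>n. \<integral>y. (f n y)\<^sup>2 * ?g y \<partial>\<mu>) \<longlonglongrightarrow> (\<integral>y. (b y)\<^sup>2 * ?g y \<partial>\<mu>)"
  proof (rule integral_dominated_convergence)
    show "integrable \<mu> (\<lambda>y. \<bar>?g y\<bar>)" using integrable_poly[of g] by simp
    show "AE y in \<mu>. (\<lambda>n. (f n y)\<^sup>2 * ?g y) \<longlonglongrightarrow> (b y)\<^sup>2 * ?g y"
      by (intro AE_I2 tendsto_intros lim)
    show "AE y in \<mu>. norm ((f n y)\<^sup>2 * ?g y) \<le> \<bar>?g y\<bar>" for n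
      using sq[OF f01] by simp
    show "(\<lambda>y. (b y)\<^sup>2 * ?g y) \<in> borel_measurable \<mu>" using int[of b] b01 by auto
    show "(\<lambda>y. (f n y)\<^sup>2 * ?g y) \<in> borel_measurable \<mu>" for n using int[of "f n"] f01 by auto
  qed
  ultimately have "\<forall>\<^sub>F n in sequentially. (\<integral>y. (f n y)\<^sup>2 * ?g y \<partial>\<mu>) < 0"
    by (intro order_tendstoD(2))
  then obtain n where n: "(\<integral>y. (f n y)\<^sup>2 * ?g y \<partial>\<mu>) < 0"
    by (auto simp: eventually_sequentially)
  define I where "I = (\<integral>y. (f n y)\<^sup>2 * ?g y \<partial>\<mu>)"
  define B where "B = 2 * norm2 (weighted g) (f n) + 1"
  define \<epsilon> where "\<epsilon> = min 1 (- I / (2 * B))"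
  have B: "0 < B" by (simp add: B_def add_nonneg_pos)
  have \<epsilon>: "0 < \<epsilon>" "\<epsilon> \<le> 1" "\<epsilon> * B < - I"
  proof -
    have "\<epsilon> * B \<le> - I / (2 * B) * B" using B by (intro mult_right_mono) (auto simp: \<epsilon>_def)
    also have "\<dots> < - I" using B n by (simp add: I_def)
    finally show "\<epsilon> * B < - I" .
  qed (use B n in \<open>auto simp: \<epsilon>_def I_def divide_neg_pos\<close>)
  obtain q where Lf: "L2 (weighted g) (f n)" and q: "norm2 (weighted g) (\<lambda>y. f n y - poly_x_value q y) \<le> \<epsilon>"
    using approx[of n] \<epsilon>(1) by (auto simp: W.approximable_def W.approx_def)
  \<comment> \<open>The difference \<open>d\<close> is small and the sum \<open>s\<close> is bounded, and \<open>d s\<close> is the difference of the squares.\<close>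
  define d where "d = (\<lambda>y. f n y - poly_x_value q y)"
  define s where "s = (\<lambda>y. 2 * f n y + (-1) * d y)"
  have Ld: "L2 (weighted g) d" unfolding d_def by (rule L2_diff[OF Lf W.L2_poly])
  have Ls: "L2 (weighted g) s" unfolding s_def by (rule L2_add[OF L2_cmult[OF Lf] L2_cmult[OF Ld]])
  have [measurable]: "d \<in> borel_measurable borel" "s \<in> borel_measurable borel"
    unfolding s_def d_def by measurable
  have nd: "norm2 (weighted g) d \<le> \<epsilon>" using q by (simp add: d_def)
  have ns: "norm2 (weighted g) s \<le> B"
    using norm2_triangle[OF L2_cmult[OF Lf, of 2] L2_cmult[OF Ld, of "-1"]] nd \<epsilon>(2)
    unfolding s_def B_def norm2_cmult by simp
  have Labs: "L2 (weighted g) (\<lambda>y. \<bar>h y\<bar>)" "norm2 (weighted g) (\<lambda>y. \<bar>h y\<bar>) = norm2 (weighted g) h"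
    if "L2 (weighted g) h" for h
    using that by (auto simp: L2_def norm2_def)
  have int_q: "integrable \<mu> (\<lambda>y. (poly_x_value q y)\<^sup>2 * ?g y)"
    using integrable_poly[of "q * q * g"] by (simp add: power2_eq_square poly_x_value_mult[abs_def])
  have int_f: "integrable \<mu> (\<lambda>y. (f n y)\<^sup>2 * ?g y)" using int[of "f n"] f01 by auto
  have int_w: "integrable \<mu> (\<lambda>y. (1 + (?g y)\<^sup>2) * (\<bar>d y\<bar> * \<bar>s y\<bar>))"
  proof -
    have [measurable]: "d \<in> borel_measurable \<mu>" "s \<in> borel_measurable \<mu>" by measurable
    show ?thesis
      using L2_integrable_mult[OF Labs(1)[OF Ld] Labs(1)[OF Ls]]
      unfolding weighted_def by (subst (asm) integrable_density) auto
  qed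
  have "(\<integral>y. (poly_x_value q y)\<^sup>2 * ?g y \<partial>\<mu>) - I = (\<integral>y. (poly_x_value q y)\<^sup>2 * ?g y - (f n y)\<^sup>2 * ?g y \<partial>\<mu>)"
    unfolding I_def using int_q int_f by simp
  also have "\<dots> \<le> (\<integral>y. (1 + (?g y)\<^sup>2) * (\<bar>d y\<bar> * \<bar>s y\<bar>) \<partial>\<mu>)"
  proof (rule integral_mono)
    fix y
    have "(poly_x_value q y)\<^sup>2 * ?g y - (f n y)\<^sup>2 * ?g y = (- ?g y) * (d y * s y)"
      by (simp add: d_def s_def power2_eq_square algebra_simps)
    also have "\<dots> \<le> \<bar>?g y\<bar> * (\<bar>d y\<bar> * \<bar>s y\<bar>)"
      by (rule order_trans[OF abs_ge_self]) (simp add: abs_mult)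
    also have "\<dots> \<le> (1 + (?g y)\<^sup>2) * (\<bar>d y\<bar> * \<bar>s y\<bar>)"
    proof (rule mult_right_mono)
      show "\<bar>?g y\<bar> \<le> 1 + (?g y)\<^sup>2"
        using sum_squares_bound[of 1 "\<bar>?g y\<bar>"] by simp
    qed simp
    finally show "(poly_x_value q y)\<^sup>2 * ?g y - (f n y)\<^sup>2 * ?g y \<le> (1 + (?g y)\<^sup>2) * (\<bar>d y\<bar> * \<bar>s y\<bar>)" .
  qed (use int_q int_f int_w in auto)
  also have "\<dots> = (\<integral>y. \<bar>d y\<bar> * \<bar>s y\<bar> \<partial>weighted g)"
    by (rule integral_weighted[symmetric]) measurable
  also have "\<dots> \<le> norm2 (weighted g) d * norm2 (weighted g) s"
    using norm2_Cauchy_Schwarz[OF Labs(1)[OF Ld] Labs(1)[OF Ls]] by (simp add: Labs(2)[OF Ld] Labs(2)[OF Ls])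
  also have "\<dots> \<le> \<epsilon> * B"
    using nd ns B \<epsilon>(1) by (intro mult_mono) auto
  also have "\<dots> < - I" by (rule \<epsilon>(3))
  finally show ?thesis by (intro exI[of _ q]) linarith
qed

end

section \<open>Positive semidefinite matrices\<close>

definition outer :: "real^'p \<Rightarrow> real^'p^'p" where
  "outer v = (\<chi> a b. v $ a * v $ b)"

lemma quadratic_outer: "w \<bullet> (outer v *v w) = (v \<bullet> w)\<^sup>2"
  by (simp add: outer_def inner_vec_def matrix_vector_mult_def power2_eq_square sum_distrib_left
      sum_distrib_right sum_product mult_ac)

lemma symmetric_matrix_iff: "symmetric_matrix A \<longleftrightarrow> (\<forall>a b. A $ a $ b = A $ b $ a)"
  by (auto simp: symmetric_matrix_def transpose_def vec_eq_iff)

lemma quadratic_form: "w \<bullet> (A *v w) = (\<Sum>a\<in>UNIV. \<Sum>b\<in>UNIV. A $ a $ b * w $ a * w $ b)"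
  for A :: "real^'p::finite^'p"
  by (simp add: inner_vec_def matrix_vector_mult_def sum_distrib_left mult_ac)

lemma quadratic_axis_shift:
  fixes A :: "real^'p::finite^'p"
  assumes "symmetric_matrix A"
  shows "(w + t *\<^sub>R axis i 1) \<bullet> (A *v (w + t *\<^sub>R axis i 1)) =
    w \<bullet> (A *v w) + 2 * t * (A $ i \<bullet> w) + t\<^sup>2 * A $ i $ i"
proof -
  have sym: "A $ a $ b = A $ b $ a" for a b
    using assms unfolding symmetric_matrix_iff by blast
  have col: "A *v axis i 1 = A $ i"
    by (simp add: vec_eq_iff matrix_vector_mult_basis column_def sym)
  have row: "axis i 1 \<bullet> (A *v w) = A $ i \<bullet> w"
    by (simp add: inner_axis' matrix_vector_mul_component)
  have diag: "axis i 1 \<bullet> (A $ i) = A $ i $ i" by (simp add: inner_axis')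
  show ?thesis
    by (simp add: matrix_vector_right_distrib matrix_vector_mult_scaleR inner_add_left inner_add_right
        col row diag inner_commute[of w "A $ i"] power2_eq_square algebra_simps)
qed

text \<open>Otherwise the quadratic form would be affine and not constant on some line parallel to \<open>axis i 1\<close>, and
  hence negative somewhere.\<close>

lemma psd_diagonal_zero:
  fixes A :: "real^'p::finite^'p"
  assumes psd: "psd A" and "A $ i $ i = 0"
  shows "A $ i = 0"
proof (rule ccontr)
  assume "A $ i \<noteq> 0"
  then have pos: "0 < A $ i \<bullet> A $ i" by simp
  let ?w = "A $ i"
  define c where "c = ?w \<bullet> (A *v ?w)"
  define t where "t = - (c + 1) / (2 * (A $ i \<bullet> A $ i))"
  have "0 \<le> c + 2 * t * (A $ i \<bullet> A $ i)"
    using psd quadratic_axis_shift[of A ?w t i] assms(2) by (simp add: psd_def c_def) (metis)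
  then show False using pos by (simp add: t_def field_simps)
qed

text \<open>
  Symmetric elimination: subtracting \<open>outer (A $ i) / A $ i $ i\<close> clears the row \<open>i\<close>, revives none of the rows that
  vanish already, and replaces the quadratic form by its minimum over the translates by multiples of \<open>axis i 1\<close>.
\<close>

lemma psd_sum_outer:
  fixes A :: "real^'p::finite^'p"
  assumes "psd A"
  shows "\<exists>vs. A = (\<Sum>v\<leftarrow>vs. outer v)"
  using assms
proof (induction "card {i. A $ i \<noteq> 0}" arbitrary: A rule: less_induct)
  case less
  have sym: "A $ a $ b = A $ b $ a" for a b
    using less.prems unfolding psd_def symmetric_matrix_iff by blast
  show ?case
  proof (cases "A = 0")
    case True
    then show ?thesis by (intro exI[of _ "[]"]) simp
  next
    case False
    then obtain i where i: "A $ i \<noteq> 0" by (auto simp: vec_eq_iff)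
    have "0 \<le> axis i 1 \<bullet> (A *v axis i 1)" using less.prems by (simp add: psd_def)
    also have "\<dots> = A $ i $ i"
      using less.prems quadratic_axis_shift[of A 0 1 i] by (simp add: psd_def)
    finally have d: "0 < A $ i $ i" using psd_diagonal_zero[OF less.prems, of i] i by force
    let ?d = "A $ i $ i"
    let ?v = "(1 / sqrt ?d) *\<^sub>R (A $ i)"
    define B where "B = A - outer ?v"
    have B: "B $ a $ b = A $ a $ b - A $ i $ a * A $ i $ b / ?d" for a b
      using d by (simp add: B_def outer_def)
    have "psd B"
      unfolding psd_def
    proof (intro conjI allI)
      show "symmetric_matrix B"
        by (simp add: symmetric_matrix_iff B sym mult.commute)
      fix w
      define t where "t = - (A $ i \<bullet> w) / ?d"
      have "w \<bullet> (B *v w) = w \<bullet> (A *v w) - (?v \<bullet> w)\<^sup>2"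
        by (simp add: B_def matrix_vector_mult_diff_rdistrib inner_diff_right quadratic_outer)
      also have "\<dots> = w \<bullet> (A *v w) + 2 * t * (A $ i \<bullet> w) + t\<^sup>2 * ?d"
        using d by (simp add: t_def power_mult_distrib power_divide field_simps power2_eq_square)
      also have "\<dots> \<ge> 0"
        using less.prems quadratic_axis_shift[of A w t i] by (metis psd_def)
      finally show "0 \<le> w \<bullet> (B *v w)" .
    qed
    moreover have "card {j. B $ j \<noteq> 0} < card {j. A $ j \<noteq> 0}"
    proof (rule psubset_card_mono)
      have "B $ j = 0" if "A $ j = 0" for j
        using that sym[of i j] by (simp add: vec_eq_iff B)
      moreover have "B $ i = 0" using d by (simp add: vec_eq_iff B)
      ultimately show "{j. B $ j \<noteq> 0} \<subset> {j. A $ j \<noteq> 0}" using i by auto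
    qed simp
    ultimately obtain vs where "B = (\<Sum>v\<leftarrow>vs. outer v)" using less.hyps by blast
    then have "A = (\<Sum>v\<leftarrow>?v # vs. outer v)" by (simp add: B_def algebra_simps)
    then show ?thesis by blast
  qed
qed

section \<open>Sums of squares of functions\<close>

inductive sos_functions :: "('x \<Rightarrow> real) set \<Rightarrow> ('x \<Rightarrow> real) \<Rightarrow> bool" for V where
  zero: "sos_functions V (\<lambda>x. 0)"
| add: "sos_functions V f \<Longrightarrow> h \<in> V \<Longrightarrow> sos_functions V (\<lambda>x. f x + (h x)\<^sup>2)"

inductive sos_matrices :: "('x \<Rightarrow> real) set \<Rightarrow> ('x \<Rightarrow> real^'p^'p) \<Rightarrow> bool" for V where
  zero: "sos_matrices V (\<lambda>x. 0)"
| add: "sos_matrices V A \<Longrightarrow> (\<And>a. (\<lambda>x. T x $ a) \<in> V) \<Longrightarrow> sos_matrices V (\<lambda>x. A x + outer (T x))"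

lemma sos_functions_square: "h \<in> V \<Longrightarrow> sos_functions V (\<lambda>x. (h x)\<^sup>2)"
  using sos_functions.add[OF sos_functions.zero, of h V] by simp

lemma sos_functions_add:
  assumes "sos_functions V g" "sos_functions V f"
  shows "sos_functions V (\<lambda>x. f x + g x)"
  using assms(1)
proof induction
  case (add g h)
  then show ?case using sos_functions.add[of V "\<lambda>x. f x + g x" h] by (simp add: add.assoc)
qed (simp add: assms(2))

lemma sos_functions_sum:
  "(\<And>i. i \<in> I \<Longrightarrow> sos_functions V (f i)) \<Longrightarrow> sos_functions V (\<lambda>x. \<Sum>i\<in>I. f i x)"
  by (induction I rule: infinite_finite_induct) (auto intro: sos_functions.zero sos_functions_add)

lemma sos_functions_mult:
  assumes "sos_functions V f" "sos_functions W g" and VW: "\<And>h k. h \<in> V \<Longrightarrow> k \<in> W \<Longrightarrow> (\<lambda>x. h x * k x) \<in> U"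
  shows "sos_functions U (\<lambda>x. f x * g x)"
  using assms(2)
proof induction
  case zero
  then show ?case by (simp add: sos_functions.zero)
next
  case (add g k)
  have "sos_functions U (\<lambda>x. f x * (k x)\<^sup>2)"
    using assms(1)
  proof induction
    case (add f h)
    then show ?case
      using sos_functions.add[of U "\<lambda>x. f x * (k x)\<^sup>2" "\<lambda>x. h x * k x"] VW \<open>k \<in> W\<close>
      by (simp add: algebra_simps power_mult_distrib)
  qed (simp add: sos_functions.zero)
  from sos_functions_add[OF this add.IH] show ?case by (simp add: algebra_simps)
qed

lemma sos_matrices_add:
  assumes "sos_matrices V B" "sos_matrices V A"
  shows "sos_matrices V (\<lambda>x. A x + B x)"
  using assms(1)
proof induction
  case (add B T)
  then show ?case using sos_matrices.add[of V "\<lambda>x. A x + B x" T] by (simp add: add.assoc)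
qed (simp add: assms(2))

lemma sos_matrices_outer: "(\<And>a. (\<lambda>x. T x $ a) \<in> V) \<Longrightarrow> sos_matrices V (\<lambda>x. outer (T x))"
  using sos_matrices.add[OF sos_matrices.zero, of T V] by simp

lemma sos_matrices_sum:
  "(\<And>i. i \<in> I \<Longrightarrow> sos_matrices V (A i)) \<Longrightarrow> sos_matrices V (\<lambda>x. \<Sum>i\<in>I. A i x)"
  by (induction I rule: infinite_finite_induct) (auto intro: sos_matrices.zero sos_matrices_add)

lemma outer_scaleR: "outer (c *\<^sub>R v) = c\<^sup>2 *\<^sub>R outer v"
  by (simp add: outer_def vec_eq_iff power2_eq_square)

lemma sos_matrices_scale_psd:
  fixes B :: "real^'p::finite^'p"
  assumes f: "sos_functions V f" and "psd B" and V: "\<And>h c. h \<in> V \<Longrightarrow> (\<lambda>x. h x * c) \<in> V"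
  shows "sos_matrices V (\<lambda>x. f x *\<^sub>R B)"
proof -
  obtain vs where B: "B = (\<Sum>v\<leftarrow>vs. outer v)" using psd_sum_outer[OF assms(2)] by blast
  have outer: "sos_matrices V (\<lambda>x. f x *\<^sub>R outer v)" for v :: "real^'p"
    using f
  proof induction
    case (add f h)
    have "sos_matrices V (\<lambda>x. f x *\<^sub>R outer v + outer (h x *\<^sub>R v))"
      using add by (intro sos_matrices.add) (auto intro: V)
    then show ?case by (simp add: outer_scaleR scaleR_add_left)
  qed (simp add: sos_matrices.zero)
  show ?thesis
    unfolding B
  proof (induction vs)
    case (Cons v vs)
    from sos_matrices_add[OF this outer[of v]] show ?case by (simp add: scaleR_add_right)
  qed (simp add: sos_matrices.zero)
qed

section \<open>Forms with the norm adjoined\<close>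

text \<open>
  The elements of degree \<open>d\<close> of the polynomial ring with \<open>\<parallel>x\<parallel>\<close> adjoined. The function \<open>b\<close> stands for a form of degree
  \<open>d - 1\<close>; the condition on its products with the coordinates makes sense for \<open>d = 0\<close> as well.
\<close>

definition normed_forms :: "nat \<Rightarrow> (real^'n::finite \<Rightarrow> real) set" where
  "normed_forms d = {f. \<exists>a b. form d a \<and> (\<forall>j. form d (\<lambda>x. x $ j * b x)) \<and> f = (\<lambda>x. a x + norm x * b x)}"

lemma normed_formsI:
  "form d a \<Longrightarrow> (\<And>j. form d (\<lambda>x. x $ j * b x)) \<Longrightarrow> (\<lambda>x. a x + norm x * b x) \<in> normed_forms d"
  by (auto simp: normed_forms_def)

lemma form_normed: "form d a \<Longrightarrow> a \<in> normed_forms d"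
  using normed_formsI[of d a "\<lambda>x. 0"] by (simp add: form_zero)

lemma normed_forms_mult:
  assumes "f \<in> normed_forms d" "g \<in> normed_forms e"
  shows "(\<lambda>x. f x * g x) \<in> normed_forms (d + e)"
proof -
  from assms obtain a b a' b' where
    a: "form d a" "\<And>j. form d (\<lambda>x. x $ j * b x)" "f = (\<lambda>x. a x + norm x * b x)" and
    a': "form e a'" "\<And>j. form e (\<lambda>x. x $ j * b' x)" "g = (\<lambda>x. a' x + norm x * b' x)"
    by (auto simp: normed_forms_def)
  let ?A = "\<lambda>x. a x * a' x + (\<Sum>j\<in>UNIV. (x $ j * b x) * (x $ j * b' x))"
  let ?B = "\<lambda>x. a x * b' x + b x * a' x"
  have "form (d + e) ?A"
    using a a' by (intro form_add form_sum form_mult) auto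
  moreover have "form (d + e) (\<lambda>x. x $ j * ?B x)" for j
    using form_add[OF form_mult[OF a(1) a'(2)[of j]] form_mult[OF a(2)[of j] a'(1)]]
    by (simp add: algebra_simps)
  ultimately have "(\<lambda>x. ?A x + norm x * ?B x) \<in> normed_forms (d + e)"
    by (rule normed_formsI)
  moreover have "?A x + norm x * ?B x = f x * g x" for x
  proof -
    have "(\<Sum>j\<in>UNIV. (x $ j * b x) * (x $ j * b' x)) = (\<Sum>j\<in>UNIV. (x $ j)\<^sup>2) * (b x * b' x)"
      by (simp add: sum_distrib_left sum_distrib_right power2_eq_square mult_ac)
    then show ?thesis
      unfolding a(3) a'(3) norm_square_vec[symmetric] by (simp add: power2_eq_square algebra_simps)
  qed
  ultimately show ?thesis by simp
qed

lemma normed_forms_cmult: "f \<in> normed_forms d \<Longrightarrow> (\<lambda>x. f x * c) \<in> normed_forms d"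
  using normed_forms_mult[OF _ form_normed[OF form_const[of c]]] by fastforce

text \<open>Because \<open>2 \<parallel>x\<parallel> (\<parallel>x\<parallel> + s x\<^sub>l) = (\<parallel>x\<parallel> + s x\<^sub>l)\<^sup>2 + (\<Sum>j\<noteq>l. x\<^sub>j\<^sup>2)\<close> for \<open>s\<^sup>2 = 1\<close>.\<close>

lemma sos_norm_plus_component:
  assumes "s = 1 \<or> s = (- 1 :: real)"
  shows "sos_functions (normed_forms 1) (\<lambda>x::real^'n::finite. norm x * (norm x + s * x $ l) / 2)"
proof -
  have 1: "form 1 (\<lambda>x::real^'n. x $ j)" for j by (rule form_component)
  have n: "(\<lambda>x::real^'n. norm x * c + x $ j * e) \<in> normed_forms 1" for c e j
    using normed_formsI[of 1 "\<lambda>x. x $ j * e" "\<lambda>x. c"] form_cmult[OF 1]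
    by (simp add: mult.commute add.commute)
  let ?I = "UNIV - {l}"
  have "sos_functions (normed_forms 1) (\<lambda>x::real^'n. \<Sum>j\<in>?I. (norm x * 0 + x $ j * (1/2))\<^sup>2)"
    by (intro sos_functions_sum sos_functions_square n)
  from sos_functions_add[OF this sos_functions_square[OF n[of "1/2" l "s/2"]]]
  have "sos_functions (normed_forms 1)
      (\<lambda>x::real^'n. (norm x * (1/2) + x $ l * (s/2))\<^sup>2 + (\<Sum>j\<in>?I. (norm x * 0 + x $ j * (1/2))\<^sup>2))" .
  moreover have "(norm x * (1/2) + x $ l * (s/2))\<^sup>2 + (\<Sum>j\<in>?I. (norm x * 0 + x $ j * (1/2))\<^sup>2)
      = norm x * (norm x + s * x $ l) / 2" for x :: "real^'n"
  proof -
    have "(norm x)\<^sup>2 = (x $ l)\<^sup>2 + (\<Sum>j\<in>?I. (x $ j)\<^sup>2)"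
      unfolding norm_square_vec by (rule sum.remove) auto
    moreover have "(\<Sum>j\<in>?I. (norm x * 0 + x $ j * (1/2))\<^sup>2) = (\<Sum>j\<in>?I. (x $ j)\<^sup>2) / 4"
      by (simp add: sum_divide_distrib power_divide)
    ultimately have eq: "(\<Sum>j\<in>?I. (norm x * 0 + x $ j * (1/2))\<^sup>2) = ((norm x)\<^sup>2 - (x $ l)\<^sup>2) / 4"
      by simp
    show ?thesis
      unfolding eq using assms by (elim disjE) (simp_all add: power2_eq_square field_simps)
  qed
  ultimately show ?thesis by (simp only:)
qed

lemma sos_normed_one: "0 \<le> c \<Longrightarrow> sos_functions (normed_forms 0) (\<lambda>x. c)"
  using sos_functions_square[OF form_normed[OF form_const[of "sqrt c"]]] by simp

lemma sos_normed_mult: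
  "sos_functions (normed_forms d) f \<Longrightarrow> sos_functions (normed_forms e) g \<Longrightarrow>
    sos_functions (normed_forms (d + e)) (\<lambda>x. f x * g x)"
  by (rule sos_functions_mult) (auto intro: normed_forms_mult)

lemma sos_normed_power:
  "sos_functions (normed_forms d) f \<Longrightarrow> sos_functions (normed_forms (k * d)) (\<lambda>x. f x ^ k)"
proof (induction k)
  case (Suc k)
  from sos_normed_mult[OF Suc.prems Suc.IH[OF Suc.prems]] show ?case by simp
qed (simp add: sos_normed_one)

lemma sos_normed_prod:
  "finite L \<Longrightarrow> (\<And>l. l \<in> L \<Longrightarrow> sos_functions (normed_forms d) (f l)) \<Longrightarrow>
    sos_functions (normed_forms (card L * d)) (\<lambda>x. \<Prod>l\<in>L. f l x)"
proof (induction L rule: finite_induct)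
  case (insert l L)
  from sos_normed_mult[of d "f l" "card L * d" "\<lambda>x. \<Prod>l\<in>L. f l x"] insert show ?case by simp
qed (simp add: sos_normed_one)

text \<open>
  The mixed terms of \<open>(a + \<parallel>x\<parallel> b)\<^sup>2\<close> change sign under \<open>x \<mapsto> - x\<close>, so that they disappear from the even part, and
  \<open>\<parallel>x\<parallel>\<^sup>2 b\<^sup>2\<close> is the sum of the squares of \<open>x\<^sub>j b\<close>.
\<close>

lemma sos_matrices_even_part:
  fixes A :: "real^'n::finite \<Rightarrow> real^'p::finite^'p"
  assumes "sos_matrices (normed_forms d) A"
  shows "sos_matrices (Collect (form d)) (\<lambda>x. (1/2) *\<^sub>R (A x + A (- x)))"
  using assms
proof induction
  case zero
  then show ?case by (simp add: sos_matrices.zero)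
next
  case (add A T)
  have "\<forall>c. \<exists>a b. form d a \<and> (\<forall>j. form d (\<lambda>x. x $ j * b x)) \<and> (\<lambda>x. T x $ c) = (\<lambda>x. a x + norm x * b x)"
    using add.hyps(2) unfolding normed_forms_def by simp
  from choice[OF this] obtain a where
    "\<forall>c. \<exists>b. form d (a c) \<and> (\<forall>j. form d (\<lambda>x. x $ j * b x)) \<and> (\<lambda>x. T x $ c) = (\<lambda>x. a c x + norm x * b x)" ..
  from choice[OF this] obtain b where a: "\<And>c. form d (a c)" and b: "\<And>c j. form d (\<lambda>x. x $ j * b c x)"
    and T: "\<And>c. (\<lambda>x. T x $ c) = (\<lambda>x. a c x + norm x * b c x)"
    by blast
  have Tx: "T x $ c = a c x + norm x * b c x" for c x using T[of c] by meson
  have b_minus: "norm x * b c (- x) = - ((- 1) ^ d * (norm x * b c x))" for c x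
  proof (cases "x = 0")
    case False
    then obtain j where j: "x $ j \<noteq> 0" by (auto simp: vec_eq_iff)
    have "x $ j * b c (- x) = x $ j * (- ((- 1) ^ d * b c x))"
      using form_uminus[OF b[of j c], of x] by (simp add: algebra_simps)
    then have "b c (- x) = - ((- 1) ^ d * b c x)" using j by (simp only: mult_cancel_left) simp
    then show ?thesis by simp
  qed simp
  have Tminus: "T (- x) $ c = (- 1) ^ d * (a c x - norm x * b c x)" for c x
    using b_minus[of x c] by (simp add: Tx form_uminus[OF a] algebra_simps)
  have sq: "(- 1) ^ d * (- 1) ^ d = (1 :: real)" by (simp flip: power_add)
  have "(1/2) *\<^sub>R (outer (T x) + outer (T (- x))) =
      outer (\<chi> c. a c x) + (\<Sum>j\<in>UNIV. outer (\<chi> c. x $ j * b c x))" for x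
  proof -
    have "(1/2) * (T x $ c * T x $ e + T (- x) $ c * T (- x) $ e)
        = a c x * a e x + (\<Sum>j\<in>UNIV. (x $ j * b c x) * (x $ j * b e x))" for c e
    proof -
      have "T (- x) $ c * T (- x) $ e
          = ((- 1) ^ d * (- 1) ^ d) * ((a c x - norm x * b c x) * (a e x - norm x * b e x))"
        unfolding Tminus by (simp only: mult_ac)
      moreover have "(\<Sum>j\<in>UNIV. (x $ j * b c x) * (x $ j * b e x)) = (norm x)\<^sup>2 * (b c x * b e x)"
        unfolding norm_square_vec by (simp add: sum_distrib_left sum_distrib_right power2_eq_square mult_ac)
      ultimately show ?thesis
        unfolding sq Tx by (simp add: power2_eq_square algebra_simps)
    qed
    then show ?thesis by (simp add: outer_def vec_eq_iff)
  qed
  moreover have "sos_matrices (Collect (form d))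
      (\<lambda>x. outer (\<chi> c. a c x) + (\<Sum>j\<in>UNIV. outer (\<chi> c. x $ j * b c x)))"
    using a b by (intro sos_matrices_add[OF sos_matrices_sum] sos_matrices_outer) auto
  ultimately have "sos_matrices (Collect (form d)) (\<lambda>x. (1/2) *\<^sub>R (outer (T x) + outer (T (- x))))"
    by simp
  from sos_matrices_add[OF this add.IH] show ?case by (simp add: algebra_simps)
qed

lemma sos_matrices_norm_square:
  fixes A :: "real^'n::finite \<Rightarrow> real^'p::finite^'p"
  assumes "sos_matrices (Collect (form d)) A"
  shows "sos_matrices (Collect (form (Suc d))) (\<lambda>x. (norm x)\<^sup>2 *\<^sub>R A x)"
  using assms
proof induction
  case zero
  then show ?case by (simp add: sos_matrices.zero)
next
  case (add A T)
  have "sos_matrices (Collect (form (Suc d))) (\<lambda>x. \<Sum>j\<in>UNIV. outer (x $ j *\<^sub>R T x))"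
    using add.hyps(2) form_mult[OF form_component] by (intro sos_matrices_sum sos_matrices_outer) auto
  moreover have "(\<Sum>j\<in>UNIV. outer (x $ j *\<^sub>R T x)) = (norm x)\<^sup>2 *\<^sub>R outer (T x)" for x
    by (simp add: outer_scaleR norm_square_vec scaleR_sum_left)
  ultimately have "sos_matrices (Collect (form (Suc d))) (\<lambda>x. (norm x)\<^sup>2 *\<^sub>R outer (T x))" by simp
  from sos_matrices_add[OF this add.IH] show ?case by (simp add: algebra_simps)
qed

section \<open>Bernstein coefficients on the cube\<close>

definition bernstein :: "nat \<Rightarrow> nat \<Rightarrow> real \<Rightarrow> real" where
  "bernstein N i t = real (N choose i) * ((1 + t) / 2) ^ i * ((1 - t) / 2) ^ (N - i)"

text \<open>
  The coefficients of \<open>t ^ k\<close> in the Bernstein basis of degree \<open>N\<close> on the interval from \<open>-1\<close> to \<open>1\<close>. The recursion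
  multiplies by \<open>t = (1 + t) / 2 - (1 - t) / 2\<close>.
\<close>

fun monomial_coeff :: "nat \<Rightarrow> nat \<Rightarrow> nat \<Rightarrow> real" where
  "monomial_coeff 0 N i = 1"
| "monomial_coeff (Suc k) N i = (real i / real N) * monomial_coeff k (N - 1) (i - 1)
     - (1 - real i / real N) * monomial_coeff k (N - 1) i"

lemma bernstein_expansion:
  "k \<le> N \<Longrightarrow> t ^ k = (\<Sum>i\<le>N. monomial_coeff k N i * bernstein N i t)"
proof (induction k arbitrary: N)
  case 0
  have "((1 + t) / 2 + (1 - t) / 2) ^ N = (\<Sum>i\<le>N. bernstein N i t)"
    unfolding bernstein_def by (rule binomial_ring)
  then show ?case by (simp add: field_simps)
next
  case (Suc k)
  then obtain n where N: "N = Suc n" and "k \<le> n" by (cases N) auto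
  let ?b = "monomial_coeff k n"
  have up: "(1 + t) / 2 * bernstein n i t = real (Suc i) / real N * bernstein N (Suc i) t" for i
  proof -
    have "real (Suc i) * real (N choose Suc i) = real N * real (n choose i)"
      using Suc_times_binomial[of i n] unfolding N by (metis of_nat_mult)
    then have eq: "real (n choose i) = real (Suc i) / real N * real (N choose Suc i)"
      by (simp add: N field_simps del: of_nat_Suc)
    have "bernstein N (Suc i) t
        = real (N choose Suc i) * (((1 + t) / 2) * ((1 + t) / 2) ^ i) * ((1 - t) / 2) ^ (n - i)"
      by (simp add: bernstein_def N del: binomial_Suc_Suc)
    then show ?thesis by (simp only: bernstein_def[of n] eq mult_ac)
  qed
  have down: "(1 - t) / 2 * bernstein n i t = (1 - real i / real N) * bernstein N i t" if "i \<le> n" for i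
  proof -
    have "(N - i) * (N choose i) = N * (n choose i)"
      using binomial_absorb_comp[of N i] by (simp add: N)
    then have "(real N - real i) * real (N choose i) = real N * real (n choose i)"
      using that by (metis N le_SucI of_nat_diff of_nat_mult)
    then have "real (n choose i) = (1 - real i / real N) * real (N choose i)"
      by (simp add: N field_simps del: of_nat_Suc)
    moreover have "N - i = Suc (n - i)" using that by (simp add: N)
    ultimately show ?thesis by (simp add: bernstein_def)
  qed
  have "t ^ Suc k = ((1 + t) / 2 - (1 - t) / 2) * t ^ k" by (simp add: field_simps)
  also have "\<dots> = (\<Sum>i\<le>n. ?b i * ((1 + t) / 2 * bernstein n i t)) - (\<Sum>i\<le>n. ?b i * ((1 - t) / 2 * bernstein n i t))"
    unfolding Suc.IH[OF \<open>k \<le> n\<close>] left_diff_distrib sum_distrib_left by (simp only: sum_subtractf mult_ac)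
  also have "(\<Sum>i\<le>n. ?b i * ((1 + t) / 2 * bernstein n i t))
      = (\<Sum>i\<le>N. real i / real N * ?b (i - 1) * bernstein N i t)"
    unfolding up unfolding N sum.atMost_Suc_shift by (simp add: mult_ac del: of_nat_Suc)
  also have "(\<Sum>i\<le>n. ?b i * ((1 - t) / 2 * bernstein n i t))
      = (\<Sum>i\<le>N. (1 - real i / real N) * ?b i * bernstein N i t)"
  proof -
    have "(\<Sum>i\<le>n. ?b i * ((1 - t) / 2 * bernstein n i t)) = (\<Sum>i\<le>n. (1 - real i / real N) * ?b i * bernstein N i t)"
      using down by (intro sum.cong) auto
    then show ?thesis by (simp add: N del: of_nat_Suc)
  qed
  finally show ?case
    by (simp add: N sum_subtractf left_diff_distrib del: of_nat_Suc sum.atMost_Suc)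
qed

lemma monomial_coeff_bound: "i \<le> N \<Longrightarrow> k \<le> N \<Longrightarrow> \<bar>monomial_coeff k N i\<bar> \<le> 1"
proof (induction k arbitrary: N i)
  case (Suc k)
  then obtain n where N: "N = Suc n" and "k \<le> n" by (cases N) auto
  let ?p = "real i / real N"
  have p: "0 \<le> ?p" "?p \<le> 1" using Suc.prems by (auto simp: N)
  have "\<bar>monomial_coeff k n (i - 1)\<bar> \<le> 1" using Suc.IH[of "i - 1" n] Suc.prems \<open>k \<le> n\<close> by (simp add: N)
  then have 1: "\<bar>?p * monomial_coeff k n (i - 1)\<bar> \<le> ?p"
    unfolding abs_mult abs_of_nonneg[OF p(1)] using p(1) by (rule mult_left_le)
  have 2: "\<bar>(1 - ?p) * monomial_coeff k n i\<bar> \<le> 1 - ?p"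
  proof (cases "i = N")
    case False
    then have "\<bar>monomial_coeff k n i\<bar> \<le> 1" using Suc.IH[of i n] Suc.prems \<open>k \<le> n\<close> by (auto simp: N)
    then show ?thesis using p by (auto simp: abs_mult intro: mult_left_le)
  qed (simp add: N)
  have "\<bar>?p * monomial_coeff k n (i - 1) - (1 - ?p) * monomial_coeff k n i\<bar> \<le> ?p + (1 - ?p)"
    using 1 2 by linarith
  then show ?case by (simp add: N)
qed simp

text \<open>
  At the node \<open>z = 2 i / N - 1\<close> the weights of the recursion are \<open>(1 + z) / 2\<close> and \<open>(1 - z) / 2\<close>, whose difference is
  \<open>z\<close>. The error comes from the nodes of degree \<open>N - 1\<close>, which lie within \<open>2 / (N - 1)\<close> of \<open>z\<close>.
\<close>

lemma monomial_coeff_limit: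
  assumes "0 < \<epsilon>"
  shows "\<forall>\<^sub>F N in sequentially. \<forall>i\<le>N. \<bar>monomial_coeff k N i - (2 * real i / real N - 1) ^ k\<bar> \<le> \<epsilon>"
  using assms
proof (induction k arbitrary: \<epsilon>)
  case (Suc k)
  obtain n0 where n0: "\<And>n i. n \<ge> n0 \<Longrightarrow> i \<le> n \<Longrightarrow>
      \<bar>monomial_coeff k n i - (2 * real i / real n - 1) ^ k\<bar> \<le> \<epsilon> / 2"
    using Suc.IH[of "\<epsilon> / 2"] Suc.prems by (auto simp: eventually_sequentially)
  obtain n1 where n1: "4 * real k / \<epsilon> < real n1" using reals_Archimedean2 by blast
  have "\<bar>monomial_coeff (Suc k) N i - (2 * real i / real N - 1) ^ Suc k\<bar> \<le> \<epsilon>"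
    if N: "N \<ge> Suc (max n0 (Suc n1))" and i: "i \<le> N" for N i
  proof -
    obtain n where n: "N = Suc n" "n0 \<le> n" "n1 \<le> n" "0 < n" using N by (cases N) auto
    define p where "p = real i / real N"
    define z where "z = 2 * p - 1"
    have p: "0 \<le> p" "p \<le> 1" using i by (auto simp: p_def n)
    have z: "\<bar>z\<bar> \<le> 1" using p by (auto simp: z_def)
    have kn: "real k * (2 / real n) \<le> \<epsilon> / 2"
    proof -
      have "4 * real k / \<epsilon> < real n" using n1 n(3) by linarith
      then show ?thesis using Suc.prems n(4) by (simp add: field_simps)
    qed
    have near: "\<bar>monomial_coeff k n e - z ^ k\<bar> \<le> \<epsilon>" if e: "e \<le> n" "\<bar>2 * real e / real n - 1 - z\<bar> \<le> 2 / real n" for e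
    proof -
      let ?w = "2 * real e / real n - 1"
      have "\<bar>?w\<bar> \<le> 1" using e(1) n(4) by (auto simp: abs_le_iff field_simps)
      then have "\<bar>?w ^ k - z ^ k\<bar> \<le> real k * \<bar>?w - z\<bar>"
        using norm_power_diff[of ?w z k] z by simp
      also have "\<dots> \<le> real k * (2 / real n)" using e(2) by (intro mult_left_mono) auto
      finally show ?thesis using kn n0[OF n(2) e(1)] by linarith
    qed
    have 1: "\<bar>p * (monomial_coeff k n (i - 1) - z ^ k)\<bar> \<le> p * \<epsilon>"
    proof (cases i)
      case (Suc e)
      have "2 * real e / real n - 1 - z = 2 * (real e - real n) / (real n * real N)"
        using n(4) by (simp add: z_def p_def Suc n(1) field_simps)
      moreover have "\<bar>2 * (real e - real n) / (real n * real N)\<bar> \<le> 2 / real n"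
      proof -
        have "\<bar>real e - real n\<bar> \<le> real N" using i by (simp add: Suc n(1))
        then have "2 / real n * (\<bar>real e - real n\<bar> / real N) \<le> 2 / real n * 1"
          using n(1) by (intro mult_left_mono) auto
        moreover have "\<bar>2 * y / (real n * real N)\<bar> = 2 / real n * (\<bar>y\<bar> / real N)" for y
          by (simp add: abs_mult)
        ultimately show ?thesis by (simp only: mult_1_right)
      qed
      ultimately have "\<bar>monomial_coeff k n (i - 1) - z ^ k\<bar> \<le> \<epsilon>"
        using near[of e] i by (simp add: Suc n(1))
      then show ?thesis using p by (simp add: abs_mult mult_left_mono)
    qed (simp add: p_def)
    have 2: "\<bar>(1 - p) * (monomial_coeff k n i - z ^ k)\<bar> \<le> (1 - p) * \<epsilon>"
    proof (cases "i = N")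
      case True
      then have "p = 1" by (simp add: p_def n(1))
      then show ?thesis by simp
    next
      case False
      then have "i \<le> n" using i n(1) by simp
      have "2 * real i / real n - 1 - z = 2 / real n * (real i / real N)"
        using n(4) by (simp add: z_def p_def n(1) field_simps)
      moreover have "\<bar>2 / real n * (real i / real N)\<bar> \<le> 2 / real n"
      proof -
        have "2 / real n * (real i / real N) \<le> 2 / real n"
          using p unfolding p_def by (intro mult_left_le) auto
        moreover have "0 \<le> 2 / real n * (real i / real N)" by simp
        ultimately show ?thesis by linarith
      qed
      ultimately have "\<bar>monomial_coeff k n i - z ^ k\<bar> \<le> \<epsilon>"
        using near[OF \<open>i \<le> n\<close>] by simp
      then show ?thesis using p by (simp add: abs_mult mult_left_mono)
    qed
    have "monomial_coeff (Suc k) N i - z ^ Suc k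
        = p * (monomial_coeff k n (i - 1) - z ^ k) - (1 - p) * (monomial_coeff k n i - z ^ k)"
    proof -
      have "monomial_coeff (Suc k) N i = p * monomial_coeff k n (i - 1) - (1 - p) * monomial_coeff k n i"
        by (simp add: p_def n(1))
      then show ?thesis by (simp add: z_def algebra_simps)
    qed
    then have "\<bar>monomial_coeff (Suc k) N i - z ^ Suc k\<bar> \<le> p * \<epsilon> + (1 - p) * \<epsilon>"
      using 1 2 by linarith
    then show ?thesis by (simp add: z_def p_def algebra_simps)
  qed
  then show ?case unfolding eventually_sequentially by blast
qed simp

text \<open>The coefficients of \<open>P\<close> in the tensor products of the Bernstein polynomials of degree \<open>N\<close>. As \<open>N\<close> grows, the
  coefficient at \<open>\<iota>\<close> approaches the value of \<open>P\<close> at \<open>node N \<iota>\<close>.\<close>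

definition cube_indices :: "nat \<Rightarrow> ('n \<Rightarrow> nat) set" where
  "cube_indices N = PiE UNIV (\<lambda>l. {..N})"

definition bernstein_coeff :: "'n::finite poly_x \<Rightarrow> nat \<Rightarrow> ('n \<Rightarrow> nat) \<Rightarrow> real" where
  "bernstein_coeff P N \<iota> = (\<Sum>\<alpha>\<in>Poly_Mapping.keys P. Poly_Mapping.lookup P \<alpha> *
     (\<Prod>l\<in>UNIV. monomial_coeff (Poly_Mapping.lookup \<alpha> l) N (\<iota> l)))"

definition node :: "nat \<Rightarrow> ('n::finite \<Rightarrow> nat) \<Rightarrow> real^'n" where
  "node N \<iota> = (\<chi> l. 2 * real (\<iota> l) / real N - 1)"

lemma eventually_degree_le:
  fixes P :: "'n::finite poly_x"
  shows "\<forall>\<^sub>F N in sequentially. \<forall>\<alpha>\<in>Poly_Mapping.keys P. \<forall>l. Poly_Mapping.lookup \<alpha> l \<le> N"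
  by (intro eventually_ball_finite eventually_all_finite ballI) (auto intro: eventually_ge_at_top)

lemma multivariate_bernstein_expansion:
  fixes P :: "'n::finite poly_x"
  assumes "\<forall>\<alpha>\<in>Poly_Mapping.keys P. \<forall>l. Poly_Mapping.lookup \<alpha> l \<le> N"
  shows "poly_x_value P x = (\<Sum>\<iota>\<in>cube_indices N. bernstein_coeff P N \<iota> * (\<Prod>l\<in>UNIV. bernstein N (\<iota> l) (x $ l)))"
proof -
  have mono: "monomial_value \<alpha> x = (\<Sum>\<iota>\<in>cube_indices N.
      (\<Prod>l\<in>UNIV. monomial_coeff (Poly_Mapping.lookup \<alpha> l) N (\<iota> l)) * (\<Prod>l\<in>UNIV. bernstein N (\<iota> l) (x $ l)))"
    if "\<alpha> \<in> Poly_Mapping.keys P" for \<alpha>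
  proof -
    have "monomial_value \<alpha> x = (\<Prod>l\<in>UNIV. \<Sum>i\<le>N. monomial_coeff (Poly_Mapping.lookup \<alpha> l) N i * bernstein N i (x $ l))"
      unfolding monomial_value_def using assms that by (intro prod.cong bernstein_expansion) auto
    then show ?thesis
      by (simp add: prod_sum_PiE cube_indices_def prod.distrib)
  qed
  have "poly_x_value P x = (\<Sum>\<alpha>\<in>Poly_Mapping.keys P. \<Sum>\<iota>\<in>cube_indices N. Poly_Mapping.lookup P \<alpha> *
      ((\<Prod>l\<in>UNIV. monomial_coeff (Poly_Mapping.lookup \<alpha> l) N (\<iota> l)) * (\<Prod>l\<in>UNIV. bernstein N (\<iota> l) (x $ l))))"
    unfolding poly_x_value_def by (intro sum.cong refl) (simp add: mono sum_distrib_left)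
  also have "\<dots> = (\<Sum>\<iota>\<in>cube_indices N. bernstein_coeff P N \<iota> * (\<Prod>l\<in>UNIV. bernstein N (\<iota> l) (x $ l)))"
    by (subst sum.swap) (simp add: bernstein_coeff_def sum_distrib_right mult.assoc)
  finally show ?thesis .
qed

lemma bernstein_coeff_limit:
  fixes P :: "'n::finite poly_x"
  assumes "0 < \<epsilon>"
  shows "\<forall>\<^sub>F N in sequentially. \<forall>\<iota>\<in>cube_indices N. \<bar>bernstein_coeff P N \<iota> - poly_x_value P (node N \<iota>)\<bar> \<le> \<epsilon>"
proof -
  define W where "W = (\<Sum>\<alpha>\<in>Poly_Mapping.keys P. \<bar>Poly_Mapping.lookup P \<alpha>\<bar>) + 1"
  define \<delta> where "\<delta> = \<epsilon> / (W * real CARD('n))"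
  have W: "0 < W" by (simp add: W_def add_nonneg_pos sum_nonneg)
  then have "0 < \<delta>" using assms by (simp add: \<delta>_def)
  then have "\<forall>\<^sub>F N in sequentially. \<forall>\<alpha>\<in>Poly_Mapping.keys P. \<forall>l. \<forall>i\<le>N.
      \<bar>monomial_coeff (Poly_Mapping.lookup \<alpha> l) N i - (2 * real i / real N - 1) ^ Poly_Mapping.lookup \<alpha> l\<bar> \<le> \<delta>"
    by (intro eventually_ball_finite eventually_all_finite ballI monomial_coeff_limit) auto
  then show ?thesis
    using eventually_degree_le[of P]
  proof eventually_elim
    case (elim N)
    show ?case
    proof
      fix \<iota> assume "\<iota> \<in> (cube_indices N :: ('n \<Rightarrow> nat) set)"
      then have \<iota>: "\<iota> l \<le> N" for l by (auto simp: cube_indices_def)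
      have node: "\<bar>node N \<iota> $ l\<bar> \<le> 1" for l
        using \<iota>[of l] by (cases "N = 0") (auto simp: node_def abs_le_iff field_simps)
      let ?c = "\<lambda>\<alpha>. \<Prod>l\<in>UNIV. monomial_coeff (Poly_Mapping.lookup \<alpha> l) N (\<iota> l)"
      have "\<bar>?c \<alpha> - monomial_value \<alpha> (node N \<iota>)\<bar> \<le> real CARD('n) * \<delta>" if \<alpha>: "\<alpha> \<in> Poly_Mapping.keys P" for \<alpha>
      proof -
        have "\<bar>?c \<alpha> - monomial_value \<alpha> (node N \<iota>)\<bar> \<le> (\<Sum>l\<in>(UNIV :: 'n set).
            \<bar>monomial_coeff (Poly_Mapping.lookup \<alpha> l) N (\<iota> l) - (node N \<iota> $ l) ^ Poly_Mapping.lookup \<alpha> l\<bar>)"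
          unfolding monomial_value_def real_norm_def[symmetric]
        proof (rule norm_prod_diff)
          show "norm (monomial_coeff (Poly_Mapping.lookup \<alpha> l) N (\<iota> l)) \<le> 1" for l
            using elim(2) \<alpha> \<iota> by (simp add: monomial_coeff_bound)
          show "norm ((node N \<iota> $ l) ^ Poly_Mapping.lookup \<alpha> l) \<le> 1" for l
            using node[of l] by (simp add: power_abs power_le_one)
        qed
        also have "\<dots> \<le> (\<Sum>l\<in>(UNIV :: 'n set). \<delta>)"
          using elim(1) \<alpha> \<iota> by (intro sum_mono) (simp add: node_def)
        finally show ?thesis by simp
      qed
      then have le: "\<bar>Poly_Mapping.lookup P \<alpha> * (?c \<alpha> - monomial_value \<alpha> (node N \<iota>))\<bar>
          \<le> \<bar>Poly_Mapping.lookup P \<alpha>\<bar> * (real CARD('n) * \<delta>)" if "\<alpha> \<in> Poly_Mapping.keys P" for \<alpha>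
        using that by (simp add: abs_mult mult_left_mono)
      have "\<bar>bernstein_coeff P N \<iota> - poly_x_value P (node N \<iota>)\<bar>
          = \<bar>\<Sum>\<alpha>\<in>Poly_Mapping.keys P. Poly_Mapping.lookup P \<alpha> * (?c \<alpha> - monomial_value \<alpha> (node N \<iota>))\<bar>"
        by (simp add: bernstein_coeff_def poly_x_value_def sum_subtractf right_diff_distrib)
      also have "\<dots> \<le> (\<Sum>\<alpha>\<in>Poly_Mapping.keys P. \<bar>Poly_Mapping.lookup P \<alpha>\<bar> * (real CARD('n) * \<delta>))"
        using le by (intro order_trans[OF sum_abs] sum_mono) auto
      also have "\<dots> \<le> W * (real CARD('n) * \<delta>)"
        unfolding sum_distrib_right[symmetric] W_def using \<open>0 < \<delta>\<close> by (intro mult_right_mono) auto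
      also have "\<dots> = \<epsilon>" using W by (simp add: \<delta>_def)
      finally show "\<bar>bernstein_coeff P N \<iota> - poly_x_value P (node N \<iota>)\<bar> \<le> \<epsilon>" .
    qed
  qed
qed

text \<open>
  Positivity on the cube passes to the Bernstein coefficients: they are close to values of the
  matrix, whose quadratic forms have a positive lower bound by compactness.
\<close>

lemma bernstein_coeff_psd:
  fixes A :: "('n::finite poly_x)^'p::finite^'p"
  assumes sym: "symmetric_matrix A"
    and pos: "\<And>x v. x \<in> cbox (\<chi> l. -1) (\<chi> l. 1) \<Longrightarrow> norm v = 1 \<Longrightarrow> 0 < v \<bullet> (matrix_x_value A x *v v)"
  shows "\<forall>\<^sub>F N in sequentially. 0 < N \<and> (\<exists>B. (\<forall>\<iota>\<in>cube_indices N. psd (B \<iota>)) \<and>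
    (\<forall>x. matrix_x_value A x = (\<Sum>\<iota>\<in>cube_indices N. (\<Prod>l\<in>UNIV. bernstein N (\<iota> l) (x $ l)) *\<^sub>R B \<iota>)))"
proof -
  let ?K = "cbox (\<chi> l. -1) (\<chi> l. 1) :: (real^'n) set"
  let ?q = "\<lambda>z. snd z \<bullet> (matrix_x_value A (fst z) *v snd z)"
  have cont: "continuous_on (?K \<times> sphere 0 1) ?q"
    unfolding quadratic_form matrix_x_value_def vec_lambda_beta
    by (intro continuous_intros continuous_on_compose2[OF continuous_on_poly_x_value]) auto
  have "compact (?K \<times> (sphere 0 1 :: (real^'p) set))" by (intro compact_Times) auto
  moreover have "(0, axis undefined 1) \<in> ?K \<times> (sphere 0 1 :: (real^'p) set)" by (simp add: mem_box_cart)
  ultimately obtain z0 where z0: "z0 \<in> ?K \<times> sphere 0 1" and min: "\<And>z. z \<in> ?K \<times> sphere 0 1 \<Longrightarrow> ?q z0 \<le> ?q z"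
    using continuous_attains_inf[OF _ _ cont] by (metis empty_iff)
  define \<delta> where "\<delta> = ?q z0"
  have \<delta>: "0 < \<delta>" unfolding \<delta>_def using pos[of "fst z0" "snd z0"] z0 by (auto simp: mem_Times_iff)
  have lower: "\<delta> * (norm v)\<^sup>2 \<le> v \<bullet> (matrix_x_value A x *v v)" if "x \<in> ?K" for x v
  proof (cases "v = 0")
    case False
    define u where "u = (1 / norm v) *\<^sub>R v"
    have "\<delta> \<le> u \<bullet> (matrix_x_value A x *v u)"
      using min[of "(x, u)"] that False by (simp add: \<delta>_def u_def)
    also have "\<dots> = (v \<bullet> (matrix_x_value A x *v v)) / (norm v)\<^sup>2"
      by (simp add: u_def matrix_vector_mult_scaleR power2_eq_square)
    finally show ?thesis using False by (simp add: field_simps)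
  qed simp
  define \<epsilon> where "\<epsilon> = \<delta> / (real CARD('p))\<^sup>2"
  have \<epsilon>: "0 < \<epsilon>" using \<delta> by (simp add: \<epsilon>_def)
  have "\<forall>\<^sub>F N in sequentially. \<forall>a b. \<forall>\<iota>\<in>cube_indices N.
      \<bar>bernstein_coeff (A $ a $ b) N \<iota> - poly_x_value (A $ a $ b) (node N \<iota>)\<bar> \<le> \<epsilon>"
    by (intro eventually_all_finite bernstein_coeff_limit \<epsilon>)
  moreover have "\<forall>\<^sub>F N in sequentially. \<forall>a b. \<forall>\<alpha>\<in>Poly_Mapping.keys (A $ a $ b). \<forall>l. Poly_Mapping.lookup \<alpha> l \<le> N"
    by (intro eventually_all_finite eventually_degree_le)
  moreover have "\<forall>\<^sub>F N in sequentially. 0 < (N::nat)" by (rule eventually_gt_at_top)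
  ultimately show ?thesis
  proof eventually_elim
    case (elim N)
    define B where "B = (\<lambda>\<iota>. \<chi> a b. bernstein_coeff (A $ a $ b) N \<iota>)"
    have "psd (B \<iota>)" if "\<iota> \<in> cube_indices N" for \<iota>
      unfolding psd_def
    proof (intro conjI allI)
      show "symmetric_matrix (B \<iota>)" using sym by (simp add: symmetric_matrix_iff B_def)
      fix v :: "real^'p"
      have "\<iota> l \<le> N" for l using that by (auto simp: cube_indices_def)
      then have "node N \<iota> \<in> ?K" using elim(3) by (auto simp: node_def mem_box_cart field_simps)
      then have "\<delta> * (norm v)\<^sup>2 \<le> v \<bullet> (matrix_x_value A (node N \<iota>) *v v)" by (rule lower)
      moreover have "\<bar>v \<bullet> (B \<iota> *v v) - v \<bullet> (matrix_x_value A (node N \<iota>) *v v)\<bar> \<le> \<delta> * (norm v)\<^sup>2"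
      proof -
        have "\<bar>v \<bullet> (B \<iota> *v v) - v \<bullet> (matrix_x_value A (node N \<iota>) *v v)\<bar>
            = \<bar>\<Sum>a\<in>UNIV. \<Sum>b\<in>UNIV. (bernstein_coeff (A $ a $ b) N \<iota> - poly_x_value (A $ a $ b) (node N \<iota>)) * (v $ a * v $ b)\<bar>"
          by (simp add: quadratic_form B_def matrix_x_value_def sum_subtractf left_diff_distrib mult.assoc)
        also have "\<dots> \<le> (\<Sum>a\<in>(UNIV::'p set). \<Sum>b\<in>(UNIV::'p set). \<epsilon> * (norm v)\<^sup>2)"
        proof (intro order_trans[OF sum_abs] sum_mono)
          fix a b
          have "\<bar>v $ a * v $ b\<bar> \<le> (norm v)\<^sup>2"
            unfolding abs_mult power2_eq_square by (intro mult_mono component_le_norm_cart) auto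
          then show "\<bar>(bernstein_coeff (A $ a $ b) N \<iota> - poly_x_value (A $ a $ b) (node N \<iota>)) * (v $ a * v $ b)\<bar> \<le> \<epsilon> * (norm v)\<^sup>2"
            unfolding abs_mult[of "_ - _"] using elim(1) that \<epsilon> by (intro mult_mono) auto
        qed
        also have "\<dots> = \<delta> * (norm v)\<^sup>2" by (simp add: \<epsilon>_def power2_eq_square)
        finally show ?thesis .
      qed
      ultimately show "0 \<le> v \<bullet> (B \<iota> *v v)" by linarith
    qed
    moreover have "matrix_x_value A x = (\<Sum>\<iota>\<in>cube_indices N. (\<Prod>l\<in>UNIV. bernstein N (\<iota> l) (x $ l)) *\<^sub>R B \<iota>)" for x
      using elim(2)
      by (simp add: vec_eq_iff matrix_x_value_def B_def multivariate_bernstein_expansion[of _ N] mult.commute)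
    ultimately show ?case using elim(3) by blast
  qed
qed

section \<open>Positive definite forms are sums of squares up to a power of the norm\<close>

text \<open>One half of Dini's theorem: pointwise positivity of some member of an increasing sequence becomes
  uniform on a compact set.\<close>

lemma compact_increasing_positive:
  fixes f :: "nat \<Rightarrow> 'a::topological_space \<Rightarrow> real"
  assumes "compact K" and cont: "\<And>k. continuous_on UNIV (f k)"
    and inc: "\<And>k z. z \<in> K \<Longrightarrow> f k z \<le> f (Suc k) z"
    and pos: "\<And>z. z \<in> K \<Longrightarrow> \<exists>k. 0 < f k z"
  shows "\<exists>k. \<forall>z\<in>K. 0 < f k z"
proof -
  have "open {z. 0 < f k z}" for k
    using cont by (intro open_Collect_less continuous_on_const) auto
  moreover have "K \<subseteq> (\<Union>k\<in>UNIV. {z. 0 < f k z})" using pos by auto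
  ultimately obtain D where D: "finite D" "K \<subseteq> (\<Union>k\<in>D. {z. 0 < f k z})"
    using compactE_image[OF \<open>compact K\<close>, of UNIV "\<lambda>k. {z. 0 < f k z}"] by metis
  have "0 < f (Max D) z" if z: "z \<in> K" for z
  proof -
    obtain k where k: "k \<in> D" "0 < f k z" using subsetD[OF D(2) z] by auto
    have "k \<le> Max D" using D(1) k(1) by simp
    then have "f k z \<le> f (Max D) z"
      by (rule lift_Suc_mono_le[of "\<lambda>k. f k z", OF inc[OF z]])
    then show ?thesis using k(2) by linarith
  qed
  then show ?thesis by blast
qed

lemma matrix_x_value_scale:
  "matrix_homogeneous d H \<Longrightarrow> matrix_x_value H (c *\<^sub>R x) = c ^ d *\<^sub>R matrix_x_value H x"
  by (auto simp: matrix_x_value_def matrix_homogeneous_def vec_eq_iff poly_x_value_scale)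

text \<open>
  On the sphere, \<open>H\<close> agrees with \<open>H + C (1 - \<parallel>x\<parallel>\<^sup>2)\<^sup>2\<close>, which is positive definite on the whole cube for large
  \<open>C\<close> and so has positive semidefinite Bernstein coefficients. The Bernstein polynomials become sums of
  squares because \<open>2 \<parallel>x\<parallel> (\<parallel>x\<parallel> \<plusminus> x\<^sub>l)\<close> is one, and homogenizing with \<open>\<parallel>x\<parallel>\<close> followed by passing to
  the even part removes the odd powers of \<open>\<parallel>x\<parallel>\<close>.
\<close>

lemma positive_definite_form_sos:
  fixes H :: "('n::finite poly_x)^'p::finite^'p"
  assumes sym: "symmetric_matrix H" and hom: "matrix_homogeneous (2 * d) H"
    and pos: "\<And>x v. norm x = 1 \<Longrightarrow> norm v = 1 \<Longrightarrow> 0 < v \<bullet> (matrix_x_value H x *v v)"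
  shows "\<exists>K0. \<forall>K\<ge>K0. sos_matrices (Collect (form (K + d))) (\<lambda>x. norm x ^ (2 * K) *\<^sub>R matrix_x_value H x)"
proof -
  let ?K = "cbox (\<chi> l. -1) (\<chi> l. 1) :: (real^'n) set"
  define q where "q = (\<lambda>k z. snd z \<bullet> (matrix_x_value H (fst z) *v snd z) + real k * (1 - (norm (fst z))\<^sup>2)\<^sup>2)"
  have "\<exists>k. \<forall>z\<in>?K \<times> sphere (0 :: real^'p) 1. 0 < q k z"
  proof (rule compact_increasing_positive)
    show "compact (?K \<times> sphere (0 :: real^'p) 1)" by (intro compact_Times) auto
    show "continuous_on UNIV (q k)" for k
      unfolding q_def quadratic_form matrix_x_value_def vec_lambda_beta
      by (intro continuous_intros continuous_on_compose2[OF continuous_on_poly_x_value]) auto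
    show "q k z \<le> q (Suc k) z" for k z
      unfolding q_def by (intro add_left_mono mult_right_mono) auto
    show "\<exists>k. 0 < q k z" if "z \<in> ?K \<times> sphere 0 1" for z
    proof (cases "norm (fst z) = 1")
      case True
      then show ?thesis using pos[of "fst z" "snd z"] that by (auto simp: q_def mem_Times_iff)
    next
      case False
      moreover have "norm (fst z) \<noteq> - 1" using norm_ge_zero[of "fst z"] by linarith
      ultimately have "1 - (norm (fst z))\<^sup>2 \<noteq> 0" by (simp add: power2_eq_1_iff)
      then have s: "0 < (1 - (norm (fst z))\<^sup>2)\<^sup>2" by simp
      obtain k where "- (snd z \<bullet> (matrix_x_value H (fst z) *v snd z)) / (1 - (norm (fst z))\<^sup>2)\<^sup>2 < real k"
        using reals_Archimedean2 by blast
      then show ?thesis using s by (intro exI[of _ k]) (simp add: q_def field_simps)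
    qed
  qed
  then obtain C where C: "\<And>z. z \<in> ?K \<times> sphere 0 1 \<Longrightarrow> 0 < q C z" by blast
  \<comment> \<open>The constant \<open>C\<close> is the index at which the increasing sequence \<open>q k\<close> has become positive.\<close>
  define R :: "'n poly_x" where "R = (1 - (\<Sum>l\<in>UNIV. Poly_Mapping.single (Poly_Mapping.single l 2) 1)) ^ 2"
  define A :: "('n poly_x)^'p^'p" where
    "A = (\<chi> a b. H $ a $ b + (if a = b then Poly_Mapping.single 0 (real C) * R else 0))"
  have R: "poly_x_value R x = (1 - (norm x)\<^sup>2)\<^sup>2" for x
    by (simp add: R_def monomial_value_single norm_square_vec)
  have A: "matrix_x_value A x = matrix_x_value H x + (real C * (1 - (norm x)\<^sup>2)\<^sup>2) *\<^sub>R mat 1" for x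
    by (simp add: vec_eq_iff matrix_x_value_def A_def mat_def R)
  have A_sphere: "matrix_x_value A x = matrix_x_value H x" if "norm x = 1" for x
    using that by (simp add: A)
  have "\<forall>\<^sub>F N in sequentially. 0 < N \<and> (\<exists>B. (\<forall>\<iota>\<in>cube_indices N. psd (B \<iota>)) \<and>
    (\<forall>x. matrix_x_value A x = (\<Sum>\<iota>\<in>cube_indices N. (\<Prod>l\<in>UNIV. bernstein N (\<iota> l) (x $ l)) *\<^sub>R B \<iota>)))"
  proof (rule bernstein_coeff_psd)
    show "symmetric_matrix A" using sym by (simp add: symmetric_matrix_iff A_def)
    fix x :: "real^'n" and v :: "real^'p"
    assume "x \<in> ?K" "norm v = 1"
    moreover from \<open>norm v = 1\<close> have "v \<bullet> v = 1" by (simp add: norm_eq_1)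
    ultimately show "0 < v \<bullet> (matrix_x_value A x *v v)"
      using C[of "(x, v)"]
      by (simp add: A q_def matrix_vector_mult_add_rdistrib inner_add_right scaleR_matrix_vector_assoc[symmetric])
  qed
  then have "\<forall>\<^sub>F N in sequentially. d < N \<and> (\<exists>B. (\<forall>\<iota>\<in>cube_indices N. psd (B \<iota>)) \<and>
    (\<forall>x. matrix_x_value A x = (\<Sum>\<iota>\<in>cube_indices N. (\<Prod>l\<in>UNIV. bernstein N (\<iota> l) (x $ l)) *\<^sub>R B \<iota>)))"
    using eventually_gt_at_top[of d] by eventually_elim auto
  from eventually_happens'[OF sequentially_bot this] obtain N B where N: "d < N" and B: "\<And>\<iota>. \<iota> \<in> cube_indices N \<Longrightarrow> psd (B \<iota>)"
    and expand: "\<And>x. matrix_x_value A x = (\<Sum>\<iota>\<in>cube_indices N. (\<Prod>l\<in>UNIV. bernstein N (\<iota> l) (x $ l)) *\<^sub>R B \<iota>)"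
    by blast
  define M where "M = CARD('n) * N"
  have MN: "N \<le> M" by (simp add: M_def Suc_leI)
  define K0 where "K0 = M - d"
  have K0: "K0 + d = M" "0 < K0" using N MN by (auto simp: K0_def)
  \<comment> \<open>The products of Bernstein polynomials at \<open>x / norm x\<close>, multiplied by \<open>norm x ^ (2 * M)\<close>.\<close>
  define s where "s = (\<lambda>\<iota> (x::real^'n). \<Prod>l\<in>UNIV. real (N choose \<iota> l) *
    ((norm x * (norm x + 1 * x $ l) / 2) ^ \<iota> l * (norm x * (norm x + (-1) * x $ l) / 2) ^ (N - \<iota> l)))"
  define W where "W = (\<lambda>x. \<Sum>\<iota>\<in>cube_indices N. s \<iota> x *\<^sub>R B \<iota>)"
  have "sos_functions (normed_forms M) (s \<iota>)" if "\<iota> \<in> cube_indices N" for \<iota>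
  proof -
    have \<iota>: "\<iota> l \<le> N" for l using that by (auto simp: cube_indices_def)
    have "sos_functions (normed_forms (0 + (\<iota> l * 1 + (N - \<iota> l) * 1))) (\<lambda>x::real^'n. real (N choose \<iota> l) *
        ((norm x * (norm x + 1 * x $ l) / 2) ^ \<iota> l * (norm x * (norm x + (-1) * x $ l) / 2) ^ (N - \<iota> l)))" for l
      by (intro sos_normed_mult sos_normed_one sos_normed_power sos_norm_plus_component) auto
    then show ?thesis
      unfolding s_def M_def using \<iota> by (intro sos_normed_prod) auto
  qed
  then have "sos_matrices (normed_forms M) W"
    unfolding W_def by (intro sos_matrices_sum sos_matrices_scale_psd B normed_forms_cmult)
  moreover have W: "W x = norm x ^ (2 * K0) *\<^sub>R matrix_x_value H x" for x
  proof (cases "x = 0")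
    case True
    have "s \<iota> 0 = 0" if "\<iota> \<in> cube_indices N" for \<iota> :: "'n \<Rightarrow> nat"
      using N by (auto simp: s_def intro!: prod_zero bexI[of _ undefined] simp: power_0_left)
    then show ?thesis using True K0(2) by (simp add: W_def)
  next
    case False
    let ?r = "norm x"
    have r: "0 < ?r" using False by simp
    define y where "y = (1 / ?r) *\<^sub>R x"
    have "s \<iota> x = ?r ^ (2 * M) * (\<Prod>l\<in>UNIV. bernstein N (\<iota> l) (y $ l))" if "\<iota> \<in> cube_indices N" for \<iota>
    proof -
      have "real (N choose \<iota> l) * ((?r * (?r + 1 * x $ l) / 2) ^ \<iota> l * (?r * (?r + (-1) * x $ l) / 2) ^ (N - \<iota> l))
          = ?r ^ (2 * N) * bernstein N (\<iota> l) (y $ l)" for l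
      proof -
        have 1: "?r * (?r + 1 * x $ l) / 2 = ?r\<^sup>2 * ((1 + y $ l) / 2)"
          and 2: "?r * (?r + (-1) * x $ l) / 2 = ?r\<^sup>2 * ((1 - y $ l) / 2)"
          using r by (simp_all add: y_def power2_eq_square field_simps)
        have "\<iota> l \<le> N" using that by (auto simp: cube_indices_def)
        then have "(?r\<^sup>2) ^ \<iota> l * (?r\<^sup>2) ^ (N - \<iota> l) = ?r ^ (2 * N)"
          by (simp add: power_add[symmetric] power_mult[symmetric] flip: distrib_left)
        then show ?thesis
          unfolding 1 2 power_mult_distrib bernstein_def by (simp add: mult_ac)
      qed
      then have "s \<iota> x = (\<Prod>l\<in>UNIV. ?r ^ (2 * N) * bernstein N (\<iota> l) (y $ l))"
        unfolding s_def by (simp only:)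
      then show ?thesis
        by (simp add: prod.distrib M_def power_mult[symmetric] mult_ac)
    qed
    then have "W x = ?r ^ (2 * M) *\<^sub>R matrix_x_value A y"
      unfolding W_def expand by (simp add: scaleR_sum_right)
    also have "matrix_x_value A y = matrix_x_value H y"
      using r by (intro A_sphere) (simp add: y_def)
    also have "\<dots> = (1 / ?r) ^ (2 * d) *\<^sub>R matrix_x_value H x"
      unfolding y_def by (rule matrix_x_value_scale[OF hom])
    also have "?r ^ (2 * M) *\<^sub>R ((1 / ?r) ^ (2 * d) *\<^sub>R matrix_x_value H x) = ?r ^ (2 * K0) *\<^sub>R matrix_x_value H x"
      using r by (simp add: K0(1)[symmetric] power_add distrib_left power_divide)
    finally show ?thesis .
  qed
  ultimately have "sos_matrices (Collect (form M)) (\<lambda>x. (1/2) *\<^sub>R (W x + W (- x)))"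
    using sos_matrices_even_part by blast
  moreover have "(1/2) *\<^sub>R (W x + W (- x)) = norm x ^ (2 * K0) *\<^sub>R matrix_x_value H x" for x
  proof -
    have "matrix_x_value H (- x) = matrix_x_value H x"
      using matrix_x_value_scale[OF hom, of "-1" x] by simp
    then show ?thesis by (simp add: W scaleR_add_left[symmetric])
  qed
  ultimately have base: "sos_matrices (Collect (form (K0 + d))) (\<lambda>x. norm x ^ (2 * K0) *\<^sub>R matrix_x_value H x)"
    by (simp only: K0(1))
  have "sos_matrices (Collect (form (K + d))) (\<lambda>x. norm x ^ (2 * K) *\<^sub>R matrix_x_value H x)" if "K0 \<le> K" for K
    using that
  proof (induction K rule: dec_induct)
    case (step K)
    from sos_matrices_norm_square[OF step.IH] show ?case
      by (simp add: power2_eq_square mult.assoc)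
  qed (rule base)
  then show ?thesis by blast
qed

section \<open>Finitely many scalar constraints\<close>

context polynomial_moments
begin

lemma integrable_monomial: "integrable \<mu> (monomial_value \<beta>)"
proof -
  have "poly_x_value (Poly_Mapping.single \<beta> 1) = monomial_value \<beta>" by auto
  then show ?thesis using integrable_poly by metis
qed

lemma poly_xy_integrable: "integrable \<mu> (poly_xy_value H x)"
proof -
  have "poly_x_value (specialize x H) = poly_xy_value H x" by auto
  then show ?thesis using integrable_poly by metis
qed

lemma integral_y_value:
  assumes "AE y in \<mu>. y \<in> Y" and "Y \<in> sets borel"
  shows "poly_x_value (integral_y \<mu> Y H) x = (\<integral>y. poly_xy_value H x y \<partial>\<mu>)"
proof -
  have [measurable]: "Y \<in> sets \<mu>" "monomial_value \<beta> \<in> borel_measurable \<mu>" for \<beta>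
    using assms(2) integrable_monomial[of \<beta>] by (auto simp: sets_eq)
  have set: "(LINT y:Y|\<mu>. monomial_value \<beta> y) = (\<integral>y. monomial_value \<beta> y \<partial>\<mu>)" for \<beta>
    unfolding set_lebesgue_integral_def
    by (rule integral_cong_AE, measurable, use assms(1) in \<open>auto elim!: AE_mp\<close>)
  show ?thesis
    unfolding integral_y_def poly_xy_value_def set
    by (simp add: integrable_monomial)
qed

text \<open>The polynomial \<open>x \<mapsto> \<integral> q(y)\<^sup>2 (v \<bullet> G(x, y) v) d\<mu>(y)\<close>, nonnegative wherever \<open>G(x, y)\<close> is
  positive semidefinite for almost all \<open>y\<close>.\<close>

definition constraint :: "(('n::finite, 'm) poly_xy)^'q::finite^'q \<Rightarrow> 'm poly_x \<Rightarrow> real^'q \<Rightarrow> 'n poly_x" where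
  "constraint G q v = integral_y \<mu> UNIV (in_y (q * q) *
     (\<Sum>k\<in>UNIV. \<Sum>l\<in>UNIV. Poly_Mapping.single 0 (Poly_Mapping.single 0 (v $ k * v $ l)) * G $ k $ l))"

lemma constraint_value:
  "poly_x_value (constraint G q v) x = (\<integral>y. (poly_x_value q y)\<^sup>2 * (v \<bullet> (matrix_xy_value G x y *v v)) \<partial>\<mu>)"
proof -
  have "poly_x_value (constraint G q v) x = (\<integral>y. poly_xy_value (in_y (q * q) *
     (\<Sum>k\<in>UNIV. \<Sum>l\<in>UNIV. Poly_Mapping.single 0 (Poly_Mapping.single 0 (v $ k * v $ l)) * G $ k $ l)) x y \<partial>\<mu>)"
    unfolding constraint_def by (rule integral_y_value) auto
  also have "\<dots> = (\<integral>y. (poly_x_value q y)\<^sup>2 * (v \<bullet> (matrix_xy_value G x y *v v)) \<partial>\<mu>)"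
    by (intro Bochner_Integration.integral_cong refl)
      (simp add: quadratic_form matrix_xy_value_def power2_eq_square mult_ac)
  finally show ?thesis .
qed

lemma constraint_scale: "poly_x_value (constraint G q (c *\<^sub>R v)) x = c\<^sup>2 * poly_x_value (constraint G q v) x"
proof -
  have "(poly_x_value q y)\<^sup>2 * ((c *\<^sub>R v) \<bullet> (matrix_xy_value G x y *v (c *\<^sub>R v)))
      = c\<^sup>2 * ((poly_x_value q y)\<^sup>2 * (v \<bullet> (matrix_xy_value G x y *v v)))" for y
    by (simp add: matrix_vector_mult_scaleR power2_eq_square mult_ac)
  then have "poly_x_value (constraint G q (c *\<^sub>R v)) x
      = (\<integral>y. c\<^sup>2 * ((poly_x_value q y)\<^sup>2 * (v \<bullet> (matrix_xy_value G x y *v v))) \<partial>\<mu>)"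
    unfolding constraint_value by (simp only:)
  then show ?thesis unfolding constraint_value by simp
qed

lemma constraint_homogeneous:
  assumes "matrix_homogeneous_in_x e G"
  shows "homogeneous e (constraint G q v)"
proof -
  let ?H = "in_y (q * q) *
     (\<Sum>k\<in>UNIV. \<Sum>l\<in>UNIV. Poly_Mapping.single 0 (Poly_Mapping.single 0 (v $ k * v $ l)) * G $ k $ l)"
  have "homogeneous_in_x (0 + (0 + e)) ?H"
    using assms unfolding matrix_homogeneous_in_x_def
    by (intro homogeneous_in_x_mult homogeneous_in_x_in_y homogeneous_in_x_sum homogeneous_in_x_single
        homogeneous_single) auto
  then have "homogeneous (e + 0) (Poly_Mapping.lookup ?H \<beta> * Poly_Mapping.single 0 c)" for \<beta> c
    by (intro homogeneous_mult homogeneous_single) (auto simp: homogeneous_in_x_iff)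
  then show ?thesis
    unfolding constraint_def integral_y_def by (intro homogeneous_sum) simp
qed

text \<open>
  A vector \<open>v\<close> on which \<open>G(x, y)\<close> is negative reduces the claim to the polynomial \<open>v \<bullet> G(x, \<cdot>) v\<close>, which is
  negative at the point \<open>y\<close> of the support.
\<close>

lemma negative_constraint:
  assumes div: "\<And>j. suminf (\<lambda>d. inverse (ennreal (moment j (Suc d) powr (1 / real (2 * Suc d))))) = \<infinity>"
    and supp: "\<And>U. open U \<Longrightarrow> y \<in> U \<Longrightarrow> 0 < emeasure \<mu> U"
    and sym: "symmetric_matrix G" and neg: "\<not> psd (matrix_xy_value G x y)"
  shows "\<exists>q v. poly_x_value (constraint G q v) x < 0"
proof -
  have "symmetric_matrix (matrix_xy_value G x y)"
    using sym by (simp add: symmetric_matrix_iff matrix_xy_value_def)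
  then obtain v where v: "v \<bullet> (matrix_xy_value G x y *v v) < 0"
    using neg by (auto simp: psd_def not_le)
  define g where "g = specialize x (\<Sum>k\<in>UNIV. \<Sum>l\<in>UNIV.
    Poly_Mapping.single 0 (Poly_Mapping.single 0 (v $ k * v $ l)) * G $ k $ l)"
  have g: "poly_x_value g z = v \<bullet> (matrix_xy_value G x z *v v)" for z
    by (simp add: g_def quadratic_form matrix_xy_value_def mult_ac)
  obtain q where "(\<integral>z. (poly_x_value q z)\<^sup>2 * poly_x_value g z \<partial>\<mu>) < 0"
    using negative_square_integral[OF div supp, where g = g] v by (auto simp: g)
  then have "poly_x_value (constraint G q v) x < 0" unfolding constraint_value g .
  then show ?thesis by blast
qed

end

text \<open>
  The factors \<open>(1 - \<gamma>)\<^sup>2\<^sup>k\<close> make \<open>\<gamma> (1 - \<gamma>)\<^sup>2\<^sup>k\<close> decrease in \<open>k\<close>: to \<open>0\<close> where \<open>\<gamma> \<ge> 0\<close> and to \<open>- \<infinity>\<close> where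
  \<open>\<gamma> < 0\<close>. So the difference is eventually positive at every point, and compactness makes this uniform.
\<close>

lemma eventually_positive_difference:
  fixes \<phi> :: "'a::topological_space \<Rightarrow> real" and \<gamma> :: "'i \<Rightarrow> 'a \<Rightarrow> real"
  assumes "compact K" "finite I" and cont: "continuous_on UNIV \<phi>" "\<And>i. continuous_on UNIV (\<gamma> i)"
    and small: "\<And>i z. i \<in> I \<Longrightarrow> z \<in> K \<Longrightarrow> \<bar>\<gamma> i z\<bar> \<le> 1/2"
    and pos: "\<And>z. z \<in> K \<Longrightarrow> (\<And>i. i \<in> I \<Longrightarrow> 0 \<le> \<gamma> i z) \<Longrightarrow> 0 < \<phi> z"
  shows "\<exists>k. \<forall>z\<in>K. 0 < \<phi> z - (\<Sum>i\<in>I. \<gamma> i z * (1 - \<gamma> i z) ^ (2 * k))"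
proof (rule compact_increasing_positive[OF \<open>compact K\<close>])
  show "continuous_on UNIV (\<lambda>z. \<phi> z - (\<Sum>i\<in>I. \<gamma> i z * (1 - \<gamma> i z) ^ (2 * k)))" for k
    using cont by (intro continuous_intros) auto
next
  fix k z assume z: "z \<in> K"
  have "\<gamma> i z * (1 - \<gamma> i z) ^ (2 * Suc k) \<le> \<gamma> i z * (1 - \<gamma> i z) ^ (2 * k)" if "i \<in> I" for i
  proof -
    let ?c = "\<gamma> i z"
    have c: "\<bar>?c\<bar> \<le> 1/2" using small[OF that z] .
    have "?c * ((1 - ?c)\<^sup>2 - 1) \<le> 0"
    proof (cases "0 \<le> ?c")
      case True
      then have "(1 - ?c)\<^sup>2 \<le> 1" using c by (intro power_le_one) auto
      then show ?thesis using True by (intro mult_nonneg_nonpos) auto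
    next
      case False
      then have "1 \<le> (1 - ?c)\<^sup>2" by (intro one_le_power) auto
      then show ?thesis using False by (intro mult_nonpos_nonneg) auto
    qed
    then have "((1 - ?c) ^ k)\<^sup>2 * (?c * ((1 - ?c)\<^sup>2 - 1)) \<le> 0"
      by (rule mult_nonneg_nonpos[OF zero_le_power2])
    moreover have "?c * (1 - ?c) ^ (2 * Suc k) - ?c * (1 - ?c) ^ (2 * k)
        = ((1 - ?c) ^ k)\<^sup>2 * (?c * ((1 - ?c)\<^sup>2 - 1))"
    proof -
      have "(1 - ?c) ^ (2 * Suc k) = ((1 - ?c) ^ k)\<^sup>2 * (1 - ?c)\<^sup>2"
        by (simp only: power_even_eq power_Suc2 power_mult_distrib)
      moreover have "?c * (u * w) - ?c * u = u * (?c * (w - 1))" for u w :: real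
        by (simp add: algebra_simps)
      ultimately show ?thesis by (simp only: power_even_eq)
    qed
    ultimately show ?thesis by linarith
  qed
  then show "\<phi> z - (\<Sum>i\<in>I. \<gamma> i z * (1 - \<gamma> i z) ^ (2 * k)) \<le> \<phi> z - (\<Sum>i\<in>I. \<gamma> i z * (1 - \<gamma> i z) ^ (2 * Suc k))"
    by (intro diff_left_mono sum_mono)
next
  fix z assume z: "z \<in> K"
  show "\<exists>k. 0 < \<phi> z - (\<Sum>i\<in>I. \<gamma> i z * (1 - \<gamma> i z) ^ (2 * k))"
  proof (cases "\<forall>i\<in>I. 0 \<le> \<gamma> i z")
    case True
    have "(\<lambda>k. \<gamma> i z * (1 - \<gamma> i z) ^ (2 * k)) \<longlonglongrightarrow> 0" if i: "i \<in> I" for i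
    proof (cases "\<gamma> i z = 0")
      case False
      then have "0 < \<gamma> i z" "\<gamma> i z \<le> 1/2" using True i small[OF i z] by force+
      then have "\<bar>(1 - \<gamma> i z)\<^sup>2\<bar> < 1" by (auto simp: abs_square_less_1)
      then have "(\<lambda>k. \<gamma> i z * ((1 - \<gamma> i z)\<^sup>2) ^ k) \<longlonglongrightarrow> \<gamma> i z * 0"
        by (intro tendsto_mult tendsto_const LIMSEQ_power_zero) simp
      then show ?thesis by (simp add: power_mult)
    qed simp
    then have "(\<lambda>k. \<phi> z - (\<Sum>i\<in>I. \<gamma> i z * (1 - \<gamma> i z) ^ (2 * k))) \<longlonglongrightarrow> \<phi> z - (\<Sum>i\<in>I. 0)"
      by (intro tendsto_diff tendsto_const tendsto_sum)
    moreover have "0 < \<phi> z - (\<Sum>i\<in>I. 0 :: real)" using pos[OF z] True by simp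
    ultimately have "\<forall>\<^sub>F k in sequentially. 0 < \<phi> z - (\<Sum>i\<in>I. \<gamma> i z * (1 - \<gamma> i z) ^ (2 * k))"
      by (rule order_tendstoD(1))
    then show ?thesis by (auto dest: eventually_happens'[OF sequentially_bot])
  next
    case False
    then obtain m where m: "m \<in> I" "\<gamma> m z < 0" by (auto simp: not_le)
    define a where "a = - \<gamma> m z"
    have a: "0 < a" using m by (simp add: a_def)
    obtain k where k: "(real (card I) - \<phi> z) / (a * a) < real k" using reals_Archimedean2 by blast
    have "real (card I) - \<phi> z < real k * (a * a)" using k a by (simp add: field_simps)
    also have "\<dots> \<le> a * (1 + real (2 * k) * a)"
      using a by (simp add: algebra_simps)
    also have "\<dots> \<le> a * (1 + a) ^ (2 * k)"
      using a by (intro mult_left_mono Bernoulli_inequality) auto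
    finally have big: "real (card I) - \<phi> z < - (\<gamma> m z * (1 - \<gamma> m z) ^ (2 * k))" by (simp add: a_def)
    have "(\<Sum>i\<in>I - {m}. \<gamma> i z * (1 - \<gamma> i z) ^ (2 * k)) \<le> (\<Sum>i\<in>I - {m}. 1)"
    proof (rule sum_mono)
      fix i assume "i \<in> I - {m}"
      then have c: "\<bar>\<gamma> i z\<bar> \<le> 1/2" using small z by blast
      show "\<gamma> i z * (1 - \<gamma> i z) ^ (2 * k) \<le> 1"
      proof (cases "0 \<le> \<gamma> i z")
        case True
        then show ?thesis using c by (intro mult_le_one power_le_one) auto
      next
        case False
        then have "\<gamma> i z * (1 - \<gamma> i z) ^ (2 * k) \<le> 0" by (intro mult_nonpos_nonneg) auto
        then show ?thesis by linarith
      qed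
    qed
    also have "\<dots> \<le> real (card I)" using \<open>finite I\<close> by (simp add: card_mono)
    finally have "(\<Sum>i\<in>I. \<gamma> i z * (1 - \<gamma> i z) ^ (2 * k)) \<le> \<gamma> m z * (1 - \<gamma> m z) ^ (2 * k) + real (card I)"
      using m(1) \<open>finite I\<close> by (simp add: sum.remove)
    then show ?thesis using big by (intro exI[of _ k]) linarith
  qed
qed

section \<open>Assembling the polynomial matrices\<close>

lemma sos_matrix_add_outer:
  assumes "sos_matrix S"
  shows "sos_matrix (S + (\<chi> i j. t $ i * t $ j))"
proof -
  obtain l T where S: "S = (\<chi> i j. \<Sum>k<(l::nat). T k $ i * T k $ j)" using assms by (auto simp: sos_matrix_def)
  show ?thesis
    unfolding sos_matrix_def
    by (intro exI[of _ "Suc l"] exI[of _ "T(l := t)"]) (simp add: S vec_eq_iff)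
qed

lemma sos_matrix_sum:
  assumes "finite J"
  shows "sos_matrix (\<chi> i j. \<Sum>t\<in>J. T t $ i * T t $ j)"
  using assms
proof (induction J rule: finite_induct)
  case empty
  then show ?case unfolding sos_matrix_def by (intro exI[of _ 0]) simp
next
  case (insert t J)
  have "(\<chi> i j. \<Sum>t\<in>insert t J. T t $ i * T t $ j) = (\<chi> i j. \<Sum>t\<in>J. T t $ i * T t $ j) + (\<chi> i j. T t $ i * T t $ j)"
    using insert by (simp add: vec_eq_iff add.commute)
  then show ?case using sos_matrix_add_outer[OF insert.IH] by simp
qed

lemma sos_matrices_polynomial:
  fixes W :: "real^'n::finite \<Rightarrow> real^'p::finite^'p"
  assumes "sos_matrices (Collect (form d)) W"
  shows "\<exists>S. sos_matrix S \<and> matrix_homogeneous (d + d) S \<and> matrix_x_value S = W"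
  using assms
proof induction
  case zero
  have "sos_matrix (0 :: ('n poly_x)^'p^'p)"
    unfolding sos_matrix_def by (intro exI[of _ 0]) (simp add: vec_eq_iff)
  then show ?case
    by (intro exI[of _ 0]) (auto simp: matrix_homogeneous_def matrix_x_value_def vec_eq_iff fun_eq_iff)
next
  case (add W T)
  then obtain S where S: "sos_matrix S" "matrix_homogeneous (d + d) S" "matrix_x_value S = W" by blast
  have "\<forall>a. \<exists>P. homogeneous d P \<and> (\<lambda>x. T x $ a) = poly_x_value P"
    using add.hyps(2) by (auto simp: form_def)
  from choice[OF this] obtain P where P: "\<And>a. homogeneous d (P a)" "\<And>a x. T x $ a = poly_x_value (P a) x"
    by (auto simp: fun_eq_iff)
  let ?S = "S + (\<chi> i j. (\<chi> a. P a) $ i * (\<chi> a. P a) $ j)"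
  have "sos_matrix ?S" by (rule sos_matrix_add_outer[OF S(1)])
  moreover have "matrix_homogeneous (d + d) ?S"
    using S(2) P(1) by (auto simp: matrix_homogeneous_def intro!: homogeneous_add homogeneous_mult)
  moreover have "matrix_x_value ?S = (\<lambda>x. W x + outer (T x))"
    unfolding S(3)[symmetric] by (auto simp: matrix_x_value_def outer_def P(2) vec_eq_iff fun_eq_iff)
  ultimately show ?case by blast
qed

lemma block_inner_entry:
  fixes S :: "'a::comm_ring_1^('p::finite \<times> 'q::finite)^('p \<times> 'q)" and G :: "'a^'q^'q"
  shows "block_inner S G $ a $ b = (\<Sum>k\<in>UNIV. \<Sum>l\<in>UNIV. S $ (b, l) $ (a, k) * G $ l $ k)"
proof -
  have pairs: "(\<Sum>r\<in>UNIV. f r) = (\<Sum>c\<in>UNIV. \<Sum>l\<in>UNIV. f (c, l))" for f :: "'p \<times> 'q \<Rightarrow> 'a"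
    by (simp add: sum.cartesian_product)
  have "block_inner S G $ a $ b = (\<Sum>k\<in>UNIV. \<Sum>r\<in>UNIV. S $ r $ (a, k) * (mat 1 $ fst r $ b * G $ snd r $ k))"
    by (simp add: block_inner_def block_trace_def trace_def matrix_matrix_mult_def transpose_def kronecker_def)
  also have "\<dots> = (\<Sum>k\<in>UNIV. \<Sum>c\<in>UNIV. if c = b then (\<Sum>l\<in>UNIV. S $ (c, l) $ (a, k) * G $ l $ k) else 0)"
    unfolding pairs by (intro sum.cong refl) (auto simp: mat_def)
  finally show ?thesis by simp
qed

lemma matrix_homogeneous_degree:
  assumes "\<exists>d. even d \<and> matrix_homogeneous d A"
  shows "even (matrix_x_degree A)" "matrix_homogeneous (matrix_x_degree A) A"
proof -
  obtain d where d: "even d" "matrix_homogeneous d A" using assms by blast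
  show "even (matrix_x_degree A)" using d by (simp add: matrix_x_degree_homogeneous)
  show "matrix_homogeneous (matrix_x_degree A) A"
    using d by (cases "A = 0") (auto simp: matrix_x_degree_homogeneous matrix_homogeneous_def)
qed

lemma matrix_homogeneous_in_x_degree:
  assumes "\<exists>d. even d \<and> matrix_homogeneous_in_x d A"
  shows "even (matrix_xy_degree_x A)" "matrix_homogeneous_in_x (matrix_xy_degree_x A) A"
proof -
  obtain d where d: "even d" "matrix_homogeneous_in_x d A" using assms by blast
  show "even (matrix_xy_degree_x A)" using d by (simp add: matrix_xy_degree_x_homogeneous)
  show "matrix_homogeneous_in_x (matrix_xy_degree_x A) A"
    using d by (cases "A = 0") (auto simp: matrix_xy_degree_x_homogeneous matrix_homogeneous_in_x_def)
qed

section \<open>The support of the measure\<close>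

text \<open>The complement of the support is a union of null open sets, and by Lindelof a countable one.\<close>

lemma AE_measure_support:
  fixes \<nu> :: "'a::second_countable_topology measure"
  assumes sets: "sets \<nu> = sets borel"
  shows "AE y in \<nu>. y \<in> measure_support \<nu>"
proof -
  let ?F = "{U. open U \<and> emeasure \<nu> U = 0}"
  obtain F' where F': "F' \<subseteq> ?F" "countable F'" "\<Union>F' = \<Union>?F"
    by (rule Lindelof[of ?F]) auto
  have "(\<Union>U\<in>F'. U) \<in> null_sets \<nu>"
    using F'(1,2) sets by (intro null_sets_UN') (auto simp: null_sets_def)
  moreover have "{y \<in> space \<nu>. y \<notin> measure_support \<nu>} \<subseteq> (\<Union>U\<in>F'. U)"
    using F'(3) by (auto simp: measure_support_def)
  ultimately show ?thesis by (rule AE_I')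
qed

lemma polynomial_moments_of_support:
  fixes \<nu> :: "(real^'m::finite) measure"
  assumes sets: "sets \<nu> = sets borel" and AE: "AE y in \<nu>. y \<in> Y" and Y: "closed Y"
    and fin: "\<And>h :: 'm poly_x. (\<integral>\<^sup>+y\<in>Y. ennreal \<bar>poly_x_value h y\<bar> \<partial>\<nu>) < \<infinity>"
  shows "polynomial_moments \<nu>"
proof
  show "sets \<nu> = sets borel" by (rule sets)
  fix q :: "'m poly_x"
  have [measurable]: "poly_x_value q \<in> borel_measurable \<nu>"
    using poly_x_value_measurable[of q] measurable_cong_sets[OF sets refl] by blast
  have "(\<integral>\<^sup>+y. ennreal (norm (poly_x_value q y)) \<partial>\<nu>) = (\<integral>\<^sup>+y\<in>Y. ennreal \<bar>poly_x_value q y\<bar> \<partial>\<nu>)"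
    using AE by (intro nn_integral_cong_AE) (auto elim!: AE_mp)
  then show "integrable \<nu> (poly_x_value q)"
    using fin[of q] by (intro integrableI_bounded) auto
qed

section \<open>The certificate of positivity\<close>

theorem theoremC:
  fixes Y :: "(real^'m::finite) set"
    and \<nu> :: "(real^'m) measure"
    and F :: "('n::finite poly_x)^'p::finite^'p"
    and G :: "(('n, 'm) poly_xy)^'q::finite^'q"
    and X :: "(real^'n) set"
  assumes "closed Y"
    and "sets \<nu> = sets borel"
    and "measure_support \<nu> = Y"
    and "\<And>h :: 'm poly_x. (\<integral>\<^sup>+y\<in>Y. ennreal \<bar>poly_x_value h y\<bar> \<partial>\<nu>) < \<infinity>"
    and "\<And>j. carleman \<nu> Y j"
    and "symmetric_matrix F"
    and "symmetric_matrix G"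
    and "\<exists>d. even d \<and> matrix_homogeneous d F"
    and "\<exists>d. even d \<and> matrix_homogeneous_in_x d G"
    and "X = {x. \<forall>y\<in>Y. psd (matrix_xy_value G x y)}"
    and "\<forall>x\<in>X - {0}. pd (matrix_x_value F x)"
  shows "\<exists>(N::nat) (S0 :: ('n poly_x)^'p^'p) (S :: (('n, 'm) poly_xy)^('p \<times> 'q)^('p \<times> 'q)).
           sos_matrix S0 \<and> sos_matrix S \<and>
           (\<exists>d. matrix_homogeneous d S0) \<and> (\<exists>d. matrix_homogeneous_in_x d S) \<and>
           matrix_x_degree S0 = 2 * N + matrix_x_degree F \<and>
           int (matrix_xy_degree_x S) =
             2 * int N + int (matrix_x_degree F) - int (matrix_xy_degree_x G) \<and>
           (\<forall>x. norm x ^ (2 * N) *\<^sub>R matrix_x_value F x =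
                  matrix_x_value S0 x
                  + matrix_x_value (matrix_integral_y \<nu> Y (block_inner S G)) x)"
proof -
  have AE: "AE y in \<nu>. y \<in> Y"
    using AE_measure_support[OF assms(2)] by (simp add: assms(3))
  interpret polynomial_moments \<nu>
    by (rule polynomial_moments_of_support[OF assms(2) AE assms(1) assms(4)])
  have Y: "Y \<in> sets borel" using assms(1) by (rule borel_closed)
  have div: "suminf (\<lambda>d. inverse (ennreal (moment j (Suc d) powr (1 / real (2 * Suc d))))) = \<infinity>" for j
  proof -
    have "(LINT y:Y|\<nu>. (y $ j) ^ (2 * Suc d)) = moment j (Suc d)" for d
      unfolding moment_def set_lebesgue_integral_def
    proof (rule integral_cong_AE)
      have [measurable]: "Y \<in> sets \<nu>" using Y assms(2) by simp
      show "(\<lambda>y. indicat_real Y y *\<^sub>R (y $ j) ^ (2 * Suc d)) \<in> borel_measurable \<nu>" by measurable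
    qed (use AE in \<open>auto elim!: AE_mp\<close>)
    then show ?thesis using assms(5)[of j] unfolding carleman_def by simp
  qed
  obtain d e where d: "matrix_x_degree F = 2 * d" "matrix_homogeneous (2 * d) F"
    and e: "matrix_xy_degree_x G = 2 * e" "matrix_homogeneous_in_x (2 * e) G"
    using matrix_homogeneous_degree[OF assms(8)] matrix_homogeneous_in_x_degree[OF assms(9)]
    by (metis evenE)

  let ?K = "sphere (0 :: real^'n) 1 \<times> sphere (0 :: real^'p) 1"
  define \<phi> where "\<phi> = (\<lambda>z :: (real^'n) \<times> (real^'p). snd z \<bullet> (matrix_x_value F (fst z) *v snd z))"
  have \<phi>_cont: "continuous_on UNIV \<phi>"
    unfolding \<phi>_def quadratic_form matrix_x_value_def vec_lambda_beta
    by (intro continuous_intros continuous_on_compose2[OF continuous_on_poly_x_value]) auto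
  have poly_cont: "continuous_on UNIV (\<lambda>z :: (real^'n) \<times> (real^'p). poly_x_value P (fst z))" for P
    by (intro continuous_intros continuous_on_compose2[OF continuous_on_poly_x_value]) auto
  have compact: "compact ?K" by (intro compact_Times) auto

  \<comment> \<open>The index \<open>None\<close> stands for the open set where \<open>F\<close> itself is positive.\<close>
  define U where "U = (\<lambda>c. case c of None \<Rightarrow> {z. 0 < \<phi> z}
    | Some (q, v) \<Rightarrow> {z :: (real^'n) \<times> (real^'p). poly_x_value (constraint G q v) (fst z) < 0})"
  have "open (U c)" for c
    unfolding U_def
    by (cases c) (auto intro!: open_Collect_less \<phi>_cont poly_cont continuous_on_const)
  moreover have "?K \<subseteq> (\<Union>c\<in>UNIV. U c)"
  proof
    fix z assume z: "z \<in> ?K"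
    show "z \<in> (\<Union>c\<in>UNIV. U c)"
    proof (cases "fst z \<in> X")
      case True
      have "fst z \<noteq> 0" "snd z \<noteq> 0" using z by (auto simp: mem_Times_iff)
      then have "0 < \<phi> z" using assms(11) True by (auto simp: pd_def \<phi>_def)
      then have "z \<in> U None" by (simp add: U_def)
      then show ?thesis by blast
    next
      case False
      then obtain y where y: "y \<in> Y" "\<not> psd (matrix_xy_value G (fst z) y)" using assms(10) by blast
      have "0 < emeasure \<nu> V" if "open V" "y \<in> V" for V
        using y(1) that assms(3) by (auto simp: measure_support_def)
      then obtain q v where "poly_x_value (constraint G q v) (fst z) < 0"
        using negative_constraint[OF div _ assms(7) y(2)] by blast
      then have "z \<in> U (Some (q, v))" by (simp add: U_def)
      then show ?thesis by blast
    qed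
  qed
  ultimately obtain D where D: "finite D" "?K \<subseteq> (\<Union>c\<in>D. U c)"
    using compactE_image[OF compact, of UNIV U] by metis

  \<comment> \<open>One more constraint, with constant \<open>q\<close> and nonzero \<open>v\<close>, guarantees that \<open>S\<close> does not vanish.\<close>
  define v0 :: "real^'q" where "v0 = axis undefined 1"
  define I where "I = insert (1, v0) {i. Some i \<in> D}"
  have finI: "finite I"
  proof -
    have "{i. Some i \<in> D} = Some -` D" by auto
    then show ?thesis using D(1) by (simp add: I_def finite_vimageI)
  qed
  have cover: "0 < \<phi> z" if z: "z \<in> ?K" and nonneg: "\<And>q v. (q, v) \<in> I \<Longrightarrow> 0 \<le> poly_x_value (constraint G q v) (fst z)" for z
  proof -
    obtain c where c: "c \<in> D" "z \<in> U c" using D(2) z by blast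
    show ?thesis
    proof (cases c)
      case None
      then show ?thesis using c by (simp add: U_def)
    next
      case (Some i)
      obtain q v where i: "i = (q, v)" by (cases i)
      have "(q, v) \<in> I" using c Some i by (simp add: I_def)
      then show ?thesis using nonneg[of q v] c Some i by (simp add: U_def)
    qed
  qed
  have "\<exists>B>0. \<forall>x\<in>sphere 0 1. \<bar>poly_x_value P x\<bar> \<le> B" for P :: "'n poly_x"
  proof -
    have "bounded (poly_x_value P ` sphere 0 1)"
      by (intro compact_imp_bounded compact_continuous_image continuous_on_poly_x_value) auto
    then show ?thesis by (auto simp: bounded_pos)
  qed
  then obtain \<beta> where \<beta>: "\<And>P :: 'n poly_x. 0 < \<beta> P" "\<And>P x. x \<in> sphere 0 1 \<Longrightarrow> \<bar>poly_x_value P x\<bar> \<le> \<beta> P"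
    by metis
  \<comment> \<open>A common bound on the sphere, which fixes the factor \<open>c\<close> of the vectors.\<close>
  define B where "B = (\<Sum>i\<in>I. \<beta> (constraint G (fst i) (snd i)))"
  have \<beta>B: "\<beta> (constraint G (fst i) (snd i)) \<le> B" if "i \<in> I" for i
    unfolding B_def using that finI \<beta>(1) less_imp_le by (intro member_le_sum) auto
  have B: "0 < B" using \<beta>B[of "(1, v0)"] \<beta>(1) by (force simp: I_def intro: less_le_trans)
  define c where "c = sqrt (1 / (2 * B))"
  have c: "0 < c" "c\<^sup>2 = 1 / (2 * B)" using B by (auto simp: c_def)
  define \<gamma> where "\<gamma> = (\<lambda>i. constraint G (fst i) (c *\<^sub>R snd i))"
  have \<gamma>: "poly_x_value (\<gamma> i) x = poly_x_value (constraint G (fst i) (snd i)) x / (2 * B)" for i x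
    by (simp add: \<gamma>_def constraint_scale c(2))
  have \<gamma>_small: "\<bar>poly_x_value (\<gamma> i) x\<bar> \<le> 1/2" if "i \<in> I" "norm x = 1" for i x
  proof -
    have "\<bar>poly_x_value (constraint G (fst i) (snd i)) x\<bar> \<le> B"
      using \<beta>(2)[of x "constraint G (fst i) (snd i)"] \<beta>B[OF that(1)] that(2) by simp
    then show ?thesis using B by (simp add: \<gamma> field_simps)
  qed
  have \<gamma>_hom: "homogeneous (2 * e) (\<gamma> i)" for i
    unfolding \<gamma>_def by (rule constraint_homogeneous[OF e(2)])
  obtain k where k: "\<And>z. z \<in> ?K \<Longrightarrow>
      0 < \<phi> z - (\<Sum>i\<in>I. poly_x_value (\<gamma> i) (fst z) * (1 - poly_x_value (\<gamma> i) (fst z)) ^ (2 * k))"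
  proof -
    have "\<exists>k. \<forall>z\<in>?K. 0 < \<phi> z - (\<Sum>i\<in>I. poly_x_value (\<gamma> i) (fst z) * (1 - poly_x_value (\<gamma> i) (fst z)) ^ (2 * k))"
    proof (rule eventually_positive_difference[OF compact finI \<phi>_cont poly_cont])
      show "\<bar>poly_x_value (\<gamma> i) (fst z)\<bar> \<le> 1/2" if "i \<in> I" "z \<in> ?K" for i z
        using \<gamma>_small[OF that(1)] that(2) by (auto simp: mem_Times_iff)
      show "0 < \<phi> z" if z: "z \<in> ?K" and nonneg: "\<And>i. i \<in> I \<Longrightarrow> 0 \<le> poly_x_value (\<gamma> i) (fst z)" for z
      proof (rule cover[OF z])
        show "0 \<le> poly_x_value (constraint G q v) (fst z)" if "(q, v) \<in> I" for q v
          using nonneg[OF that] B by (simp add: \<gamma> zero_le_divide_iff)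
      qed
    qed
    then show ?thesis using that by blast
  qed

  \<comment> \<open>Homogenized with powers of \<open>R\<close>, the square of the norm.\<close>
  define R :: "'n poly_x" where "R = (\<Sum>l\<in>UNIV. Poly_Mapping.single (Poly_Mapping.single l 2) 1)"
  have R: "poly_x_value R x = (norm x)\<^sup>2" for x
    by (simp add: R_def monomial_value_single norm_square_vec)
  have R_hom: "homogeneous (m * 2) (R ^ m)" for m
    unfolding R_def
    by (intro homogeneous_power homogeneous_sum homogeneous_single) (simp add: monomial_degree_single)
  define \<eta> where "\<eta> = (\<lambda>i. (R ^ e - \<gamma> i) ^ k)"
  have \<eta>_hom: "homogeneous (k * (2 * e)) (\<eta> i)" for i
    unfolding \<eta>_def using R_hom[of e] \<gamma>_hom[of i]
    by (intro homogeneous_power homogeneous_diff) (auto simp: mult.commute)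
  have \<eta>_value: "poly_x_value (\<eta> i) x = (norm x ^ (2 * e) - poly_x_value (\<gamma> i) x) ^ k" for i x
    by (simp add: \<eta>_def R power_mult)
  define E where "E = (\<Sum>i\<in>I. \<gamma> i * (\<eta> i * \<eta> i))"
  define H :: "('n poly_x)^'p^'p" where
    "H = (\<chi> a b. R ^ ((2 * k + 1) * e) * F $ a $ b - (if a = b then R ^ d * E else 0))"
  define D' where "D' = (2 * k + 1) * e + d"
  have H_value: "matrix_x_value H x = norm x ^ (2 * ((2 * k + 1) * e)) *\<^sub>R matrix_x_value F x
      - (norm x ^ (2 * d) * poly_x_value E x) *\<^sub>R mat 1" for x
    by (simp add: vec_eq_iff matrix_x_value_def H_def mat_def R power_mult[symmetric] power_add distrib_right)
  have H_sym: "symmetric_matrix H" using assms(6) by (simp add: symmetric_matrix_iff H_def)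
  have H_hom: "matrix_homogeneous (2 * D') H"
    unfolding matrix_homogeneous_def
  proof (intro allI)
    fix a b
    have deg: "2 * D' = (2 * k + 1) * e * 2 + 2 * d" "2 * D' = d * 2 + (2 * e + (k * (2 * e) + k * (2 * e)))"
      by (simp_all add: D'_def algebra_simps)
    have 1: "homogeneous (2 * D') (R ^ ((2 * k + 1) * e) * F $ a $ b)"
      unfolding deg(1) using d(2) by (intro homogeneous_mult R_hom) (simp add: matrix_homogeneous_def)
    have "homogeneous (2 * D') (R ^ d * E)"
      unfolding deg(2) E_def by (intro homogeneous_mult R_hom homogeneous_sum \<gamma>_hom \<eta>_hom)
    then have 2: "homogeneous (2 * D') (if a = b then R ^ d * E else 0)" by simp
    show "homogeneous (2 * D') (H $ a $ b)"
      unfolding H_def vec_lambda_beta by (rule homogeneous_diff[OF 1 2])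
  qed
  have H_pos: "0 < v \<bullet> (matrix_x_value H x *v v)" if "norm x = 1" "norm v = 1" for x v
  proof -
    have "v \<bullet> v = 1" using that(2) by (simp add: norm_eq_1)
    moreover have "poly_x_value E x = (\<Sum>i\<in>I. poly_x_value (\<gamma> i) x * (1 - poly_x_value (\<gamma> i) x) ^ (2 * k))"
      using that(1) by (simp add: E_def \<eta>_value power_add[symmetric] mult_2)
    ultimately have "v \<bullet> (matrix_x_value H x *v v)
        = \<phi> (x, v) - (\<Sum>i\<in>I. poly_x_value (\<gamma> i) x * (1 - poly_x_value (\<gamma> i) x) ^ (2 * k))"
      using that(1)
      by (simp add: H_value \<phi>_def matrix_vector_mult_diff_rdistrib inner_diff_right scaleR_matrix_vector_assoc[symmetric])
    then show ?thesis using k[of "(x, v)"] that by simp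
  qed
  obtain K0 where K0: "\<And>K. K0 \<le> K \<Longrightarrow>
      sos_matrices (Collect (form (K + D'))) (\<lambda>x. norm x ^ (2 * K) *\<^sub>R matrix_x_value H x)"
    using positive_definite_form_sos[OF H_sym H_hom H_pos] by blast

  \<comment> \<open>The choice of \<open>K\<close> makes \<open>norm x ^ (2 * (K + d))\<close> the square of \<open>R ^ r\<close>.\<close>
  define K where "K = 2 * K0 + d"
  define r where "r = K0 + d"
  define N where "N = K + (2 * k + 1) * e"
  have Kr: "K + d = 2 * r" by (simp add: K_def r_def)
  obtain S0 where S0: "sos_matrix S0" "matrix_homogeneous (K + D' + (K + D')) S0"
    and S0_value: "matrix_x_value S0 = (\<lambda>x. norm x ^ (2 * K) *\<^sub>R matrix_x_value H x)"
    using sos_matrices_polynomial[OF K0[of K]] by (auto simp: K_def)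
  define \<rho> where "\<rho> = (\<lambda>i. R ^ r * \<eta> i)"
  define d\<rho> where "d\<rho> = r * 2 + k * (2 * e)"
  have \<rho>_hom: "homogeneous d\<rho> (\<rho> i)" for i
    unfolding \<rho>_def d\<rho>_def by (intro homogeneous_mult R_hom \<eta>_hom)
  define T :: "(('m poly_x \<times> (real^'q)) \<times> 'p) \<Rightarrow> (('n, 'm) poly_xy)^('p \<times> 'q)" where
    "T = (\<lambda>(i, b). \<chi> al. if fst al = b then Poly_Mapping.single 0 (\<rho> i) * (in_y (fst i) *
       Poly_Mapping.single 0 (Poly_Mapping.single 0 (c * snd i $ snd al))) else 0)"
  define S where "S = (\<chi> s t. \<Sum>j\<in>I \<times> UNIV. T j $ s * T j $ t)"
  have S_sos: "sos_matrix S" unfolding S_def using finI by (intro sos_matrix_sum) auto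
  have S_hom: "matrix_homogeneous_in_x (d\<rho> + d\<rho>) S"
  proof -
    have "homogeneous_in_x (d\<rho> + (0 + 0)) (T j $ s)" for j s
    proof -
      have "homogeneous_in_x (d\<rho> + (0 + 0)) (Poly_Mapping.single 0 (\<rho> i) * (in_y q *
          Poly_Mapping.single 0 (Poly_Mapping.single 0 t)))" for i t and q :: "'m poly_x"
        by (intro homogeneous_in_x_mult homogeneous_in_x_single \<rho>_hom homogeneous_in_x_in_y homogeneous_single) simp
      then show ?thesis by (simp add: T_def case_prod_beta)
    qed
    then have "homogeneous_in_x d\<rho> (T j $ s)" for j s by simp
    then show ?thesis
      unfolding matrix_homogeneous_in_x_def S_def
      by (auto intro!: homogeneous_in_x_sum homogeneous_in_x_mult)
  qed
  have S_value: "poly_xy_value (S $ s $ t) x y = (if fst s = fst t then \<Sum>i\<in>I. (poly_x_value (\<rho> i) x)\<^sup>2 *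
      ((poly_x_value (fst i) y)\<^sup>2 * ((c * snd i $ snd s) * (c * snd i $ snd t))) else 0)" for s t x y
  proof -
    have "poly_xy_value (S $ s $ t) x y = (\<Sum>i\<in>I. \<Sum>b\<in>UNIV. poly_xy_value (T (i, b) $ s) x y * poly_xy_value (T (i, b) $ t) x y)"
      by (simp add: S_def sum.cartesian_product case_prod_beta)
    also have "\<dots> = (\<Sum>i\<in>I. \<Sum>b\<in>UNIV. if b = fst s then (if fst s = fst t then (poly_x_value (\<rho> i) x)\<^sup>2 *
      ((poly_x_value (fst i) y)\<^sup>2 * ((c * snd i $ snd s) * (c * snd i $ snd t))) else 0) else 0)"
      by (intro sum.cong refl) (auto simp: T_def power2_eq_square)
    finally show ?thesis by (auto intro!: sum.cong)
  qed
  have integral: "matrix_x_value (matrix_integral_y \<nu> Y (block_inner S G)) x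
      = (norm x ^ (2 * K) * (norm x ^ (2 * d) * poly_x_value E x)) *\<^sub>R mat 1" for x
  proof -
    have "poly_x_value (integral_y \<nu> Y (block_inner S G $ a $ b)) x
        = (if a = b then norm x ^ (2 * K) * (norm x ^ (2 * d) * poly_x_value E x) else 0)" for a b
    proof -
      let ?w = "\<lambda>i. c *\<^sub>R snd i"
      have point: "poly_xy_value (block_inner S G $ a $ b) x y = (if a = b then \<Sum>i\<in>I. (poly_x_value (\<rho> i) x)\<^sup>2 *
          ((poly_x_value (fst i) y)\<^sup>2 * (?w i \<bullet> (matrix_xy_value G x y *v ?w i))) else 0)" for y
      proof (cases "a = b")
        case True
        have "poly_xy_value (block_inner S G $ a $ b) x y = (\<Sum>m\<in>UNIV. \<Sum>l\<in>UNIV. \<Sum>i\<in>I. (poly_x_value (\<rho> i) x)\<^sup>2 *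
          ((poly_x_value (fst i) y)\<^sup>2 * (poly_xy_value (G $ l $ m) x y * (c * snd i $ l) * (c * snd i $ m))))"
        proof -
          have "poly_xy_value (block_inner S G $ a $ b) x y = (\<Sum>m\<in>UNIV. \<Sum>l\<in>UNIV. \<Sum>i\<in>I. (poly_x_value (\<rho> i) x)\<^sup>2 *
            ((poly_x_value (fst i) y)\<^sup>2 * ((c * snd i $ l) * (c * snd i $ m))) * poly_xy_value (G $ l $ m) x y)"
            using True by (simp add: block_inner_entry S_value sum_distrib_right)
          also have "\<dots> = (\<Sum>m\<in>UNIV. \<Sum>l\<in>UNIV. \<Sum>i\<in>I. (poly_x_value (\<rho> i) x)\<^sup>2 *
            ((poly_x_value (fst i) y)\<^sup>2 * (poly_xy_value (G $ l $ m) x y * (c * snd i $ l) * (c * snd i $ m))))"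
            by (intro sum.cong refl) (simp only: mult_ac)
          finally show ?thesis .
        qed
        also have "\<dots> = (\<Sum>l\<in>UNIV. \<Sum>m\<in>UNIV. \<Sum>i\<in>I. (poly_x_value (\<rho> i) x)\<^sup>2 *
          ((poly_x_value (fst i) y)\<^sup>2 * (poly_xy_value (G $ l $ m) x y * (c * snd i $ l) * (c * snd i $ m))))"
          by (rule sum.swap)
        also have "\<dots> = (\<Sum>l\<in>UNIV. \<Sum>i\<in>I. \<Sum>m\<in>UNIV. (poly_x_value (\<rho> i) x)\<^sup>2 *
          ((poly_x_value (fst i) y)\<^sup>2 * (poly_xy_value (G $ l $ m) x y * (c * snd i $ l) * (c * snd i $ m))))"
          by (intro sum.cong refl sum.swap)
        also have "\<dots> = (\<Sum>i\<in>I. \<Sum>l\<in>UNIV. \<Sum>m\<in>UNIV. (poly_x_value (\<rho> i) x)\<^sup>2 *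
          ((poly_x_value (fst i) y)\<^sup>2 * (poly_xy_value (G $ l $ m) x y * (c * snd i $ l) * (c * snd i $ m))))"
          by (rule sum.swap)
        finally show ?thesis
          using True by (simp add: quadratic_form matrix_xy_value_def sum_distrib_left)
      next
        case False
        then show ?thesis by (simp add: block_inner_entry S_value)
      qed
      have int: "integrable \<nu> (\<lambda>y. (poly_x_value q y)\<^sup>2 * (w \<bullet> (matrix_xy_value G x y *v w)))" for q w
      proof -
        have eq: "poly_xy_value (in_y (q * q) *
            (\<Sum>k\<in>UNIV. \<Sum>l\<in>UNIV. Poly_Mapping.single 0 (Poly_Mapping.single 0 (w $ k * w $ l)) * G $ k $ l)) x
            = (\<lambda>y. (poly_x_value q y)\<^sup>2 * (w \<bullet> (matrix_xy_value G x y *v w)))"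
          by (auto simp: quadratic_form matrix_xy_value_def power2_eq_square mult_ac)
        show ?thesis by (rule subst[where P = "integrable \<nu>", OF eq poly_xy_integrable])
      qed
      have "poly_x_value (integral_y \<nu> Y (block_inner S G $ a $ b)) x
          = (\<integral>y. poly_xy_value (block_inner S G $ a $ b) x y \<partial>\<nu>)"
        by (rule integral_y_value[OF AE Y])
      also have "\<dots> = (if a = b then \<Sum>i\<in>I. (poly_x_value (\<rho> i) x)\<^sup>2 * poly_x_value (\<gamma> i) x else 0)"
      proof -
        define h where "h = (\<lambda>i y. (poly_x_value (fst i) y)\<^sup>2 * (?w i \<bullet> (matrix_xy_value G x y *v ?w i)))"
        have "poly_xy_value (block_inner S G $ a $ b) x y
            = (if a = b then \<Sum>i\<in>I. (poly_x_value (\<rho> i) x)\<^sup>2 * h i y else 0)" for y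
          unfolding point h_def ..
        moreover have "integrable \<nu> (h i)" for i unfolding h_def by (rule int)
        moreover have "poly_x_value (\<gamma> i) x = (\<integral>y. h i y \<partial>\<nu>)" for i
          unfolding \<gamma>_def constraint_value h_def ..
        ultimately show ?thesis by simp
      qed
      also have "(\<Sum>i\<in>I. (poly_x_value (\<rho> i) x)\<^sup>2 * poly_x_value (\<gamma> i) x)
          = (norm x ^ (2 * r))\<^sup>2 * poly_x_value E x"
        by (simp add: \<rho>_def E_def R power_mult_distrib power_mult sum_distrib_left power2_eq_square mult_ac)
      also have "(norm x ^ (2 * r))\<^sup>2 = norm x ^ (2 * K) * norm x ^ (2 * d)"
      proof -
        have "2 * K + 2 * d = 2 * r * 2" using Kr by simp
        then show ?thesis by (simp only: power_mult[symmetric] power_add[symmetric])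
      qed
      finally show ?thesis by (simp add: mult.assoc)
    qed
    then show ?thesis by (simp add: vec_eq_iff matrix_x_value_def matrix_integral_y_def mat_def)
  qed
  have identity: "norm x ^ (2 * N) *\<^sub>R matrix_x_value F x =
      matrix_x_value S0 x + matrix_x_value (matrix_integral_y \<nu> Y (block_inner S G)) x" for x
    unfolding integral S0_value H_value N_def
    by (simp add: scaleR_diff_right power_add distrib_left)

  obtain x0 :: "real^'n" where x0: "norm x0 = 1" using vector_choose_size[of 1] by auto
  have "S0 \<noteq> 0"
  proof
    assume "S0 = 0"
    then have "matrix_x_value S0 x0 = 0" by (simp add: matrix_x_value_def vec_eq_iff)
    then have "matrix_x_value H x0 = 0" using x0 by (simp add: S0_value)
    then show False using H_pos[OF x0, of "axis undefined 1"] by simp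
  qed
  then have S0_degree: "matrix_x_degree S0 = 2 * N + matrix_x_degree F"
    using matrix_x_degree_homogeneous[OF S0(2)] by (simp add: N_def D'_def d(1))
  have "S \<noteq> 0"
  proof
    assume "S = 0"
    define s :: "'p \<times> 'q" where "s = (undefined, undefined)"
    have "poly_xy_value (S $ s $ s) x0 0 = 0" using \<open>S = 0\<close> by simp
    moreover have "0 < poly_xy_value (S $ s $ s) x0 0"
      unfolding S_value if_P[OF refl]
    proof (rule sum_pos2[OF finI])
      have I0: "(1, v0) \<in> I" by (simp add: I_def)
      have "poly_x_value (\<gamma> (1, v0)) x0 < 1" using \<gamma>_small[OF I0 x0] by linarith
      then have "poly_x_value (\<rho> (1, v0)) x0 \<noteq> 0"
        using x0 by (simp add: \<rho>_def \<eta>_value R)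
      then show "0 < (poly_x_value (\<rho> (1, v0)) x0)\<^sup>2 * ((poly_x_value (fst (1, v0)) 0)\<^sup>2 *
          ((c * snd (1, v0) $ snd s) * (c * snd (1, v0) $ snd s)))"
        using c(1) by (simp add: v0_def s_def)
      show "(1, v0) \<in> I" by (rule I0)
      show "0 \<le> (poly_x_value (\<rho> i) x0)\<^sup>2 * ((poly_x_value (fst i) 0)\<^sup>2 *
          ((c * snd i $ snd s) * (c * snd i $ snd s)))" for i
        by simp
    qed
    ultimately show False by simp
  qed
  then have "int (matrix_xy_degree_x S) = 2 * int N + int (matrix_x_degree F) - int (matrix_xy_degree_x G)"
    using matrix_xy_degree_x_homogeneous[OF S_hom] by (simp add: d\<rho>_def N_def d(1) e(1) K_def r_def algebra_simps)
  then show ?thesis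
    using S0 S_sos S_hom S0_degree identity by blast
qed

end
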